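(* Let $A_n$ and $B_m$ be NCCW complexes of dimension $n$ and $m$ respectively, and let $\alpha : A_n\to B_m$ be a simplicial morphism. Then the NC mapping cylinder $\mathrm{Cyl}(\alpha)$ is an NCCW complex of dimension $\max\{n,m+1\}$.
   Context: Morphisms of C*-algebras are $*$-homomorphisms. Notation: $\mathbb{I}=[0,1]$, $\mathbb{I}^k=[0,1]^k$, $\mathbb{I}_0^k=(0,1)^k$. For a C*-algebra $F$: $\mathbb{I}F=C(\mathbb{I}\to F)$, $\mathbb{I}^kF=C(\mathbb{I}^k\to F)$, $\mathbb{I}_0^kF=C_0(\mathbb{I}_0^k\to F)$, $S^{k-1}F=C(S^{k-1}\to F)$, where $S^{k-1}$ is identified with the boundary $\mathbb{I}^k\setminus\mathbb{I}_0^k$; all have pointwise operations and supremum norm. $\partial:\mathbb{I}^kF\to S^{k-1}F$ is restriction. NCCW complexes: an NCCW complex of dimension $0$ is a finite-dimensional C*-algebra $A_0$. An NCCW complex of dimension $n$ is given by a sequence of C*-algebras $\{A_0,A_1,\dots,A_n\}$, where $A_0$ is finite-dimensional and for each $1\le k\le n$ there are a finite-dimensional C*-algebra $F_k$ and an arbitrary morphism $\sigma_k:A_{k-1}\to S^{k-1}F_k$ with $A_k=\mathbb{I}^kF_k\bigoplus_{S^{k-1}F_k}A_{k-1}=\{f\oplus a\in \mathbb{I}^kF_k\oplus A_{k-1} : \partial f=\sigma_k(a)\}$ (the pullback); thus there is an extension $0\to\mathbb{I}_0^kF_k\to A_k\to A_{k-1}\to 0$. One calls $A_n$ itself the NCCW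 complex. It has a decreasing family of closed ideals (canonical ideals) $A_n=I_0\supset I_1\supset\dots\supset I_n\neq 0$, where for $k\ge 1$, $I_k$ is the kernel of the projection $A_n\to A_{k-1}$; so $I_n=\mathbb{I}_0^nF_n$, $I_k/I_{k+1}=\mathbb{I}_0^kF_k$ (with $F_0=A_0$, $I_{n+1}=0$), and $A_n/I_{k+1}=A_k$. Simplicial morphisms: let $A_n$, $B_m$ be NCCW complexes of dimensions $n,m$ with canonical ideals $I_0\supset\dots\supset I_n$ and $J_0\supset\dots\supset J_m$, and $I_k/I_{k+1}=\mathbb{I}_0^kF_k$, $J_k/J_{k+1}=\mathbb{I}_0^kG_k$. A morphism $\alpha:A_n\to B_m$ is simplicial if (i) $\alpha(I_k)\subset J_k$ for all $k$ (in particular $\alpha(I_k)=0$ for $k>m$), and (ii) for $0\le k\le n$, the induced homomorphism $\tilde\alpha_k:\mathbb{I}_0^kF_k\to\mathbb{I}_0^kG_k$ has the form $\tilde\alpha_k=i_k^*\otimes\varphi_k$ for some morphism $\varphi_k:F_k\to G_k$ and some homeomorphism $i_k$ of $\mathbb{I}^k$, where $i_k^*$ is the induced map on $C_0(\mathbb{I}_0^k)$ and $\mathbb{I}_0^kF_k$ is identified with $C_0(\mathbb{I}_0^k)\otimes F_k$ (similarly for $G_k$). NC mapping cylinder: for a morphism $\alpha:A\to B$, $\mathrm{Cyl}(\alpha)=\{a\oplus f\in A\oplus \mathbb{I}B : f(1)=\alpha(a)\}$. *)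

theory Defs
  imports "HOL-Analysis.Analysis"
begin

section \<open>C*-algebras on carrier sets\<close>

text \<open>
  All C*-algebras below are complex, not necessarily unital, and possibly zero.  They live on
  explicit carrier sets, because the algebras of an NCCW complex are subsets of function and
  product types cut out by equations.  Operations are only constrained on the carrier.
\<close>

record 'a cstar_alg =
  ccarrier :: "'a set"
  czero :: 'a
  cadd :: "'a \<Rightarrow> 'a \<Rightarrow> 'a"
  cscale :: "complex \<Rightarrow> 'a \<Rightarrow> 'a"
  cmult :: "'a \<Rightarrow> 'a \<Rightarrow> 'a"
  cstar :: "'a \<Rightarrow> 'a"
  cnorm :: "'a \<Rightarrow> real"

text \<open>
  The metric is set to \<open>0\<close> off the carrier, since \<^locale>\<open>Metric_space\<close> asks for symmetry and
  nonnegativity on the whole type.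
\<close>

definition cdist :: "'a cstar_alg \<Rightarrow> 'a \<Rightarrow> 'a \<Rightarrow> real" where
  "cdist A x y = (if x \<in> ccarrier A \<and> y \<in> ccarrier A
                  then cnorm A (cadd A x (cscale A (-1) y)) else 0)"

definition ctopology :: "'a cstar_alg \<Rightarrow> 'a topology" where
  "ctopology A = Metric_space.mtopology (ccarrier A) (cdist A)"

locale cstar_algebra =
  fixes A :: "'a cstar_alg"
  assumes zero_closed: "czero A \<in> ccarrier A"
    and add_closed: "\<lbrakk>x \<in> ccarrier A; y \<in> ccarrier A\<rbrakk> \<Longrightarrow> cadd A x y \<in> ccarrier A"
    and scale_closed: "x \<in> ccarrier A \<Longrightarrow> cscale A c x \<in> ccarrier A"
    and mult_closed: "\<lbrakk>x \<in> ccarrier A; y \<in> ccarrier A\<rbrakk> \<Longrightarrow> cmult A x y \<in> ccarrier A"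
    and star_closed: "x \<in> ccarrier A \<Longrightarrow> cstar A x \<in> ccarrier A"
    and add_assoc: "\<lbrakk>x \<in> ccarrier A; y \<in> ccarrier A; z \<in> ccarrier A\<rbrakk>
          \<Longrightarrow> cadd A (cadd A x y) z = cadd A x (cadd A y z)"
    and add_commute: "\<lbrakk>x \<in> ccarrier A; y \<in> ccarrier A\<rbrakk> \<Longrightarrow> cadd A x y = cadd A y x"
    and add_zero: "x \<in> ccarrier A \<Longrightarrow> cadd A (czero A) x = x"
    and add_inverse: "x \<in> ccarrier A \<Longrightarrow> cadd A x (cscale A (-1) x) = czero A"
    and scale_one: "x \<in> ccarrier A \<Longrightarrow> cscale A 1 x = x"
    and scale_scale: "x \<in> ccarrier A \<Longrightarrow> cscale A c (cscale A d x) = cscale A (c * d) x"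
    and scale_add_left: "x \<in> ccarrier A
          \<Longrightarrow> cscale A (c + d) x = cadd A (cscale A c x) (cscale A d x)"
    and scale_add_right: "\<lbrakk>x \<in> ccarrier A; y \<in> ccarrier A\<rbrakk>
          \<Longrightarrow> cscale A c (cadd A x y) = cadd A (cscale A c x) (cscale A c y)"
    and mult_assoc: "\<lbrakk>x \<in> ccarrier A; y \<in> ccarrier A; z \<in> ccarrier A\<rbrakk>
          \<Longrightarrow> cmult A (cmult A x y) z = cmult A x (cmult A y z)"
    and mult_add_left: "\<lbrakk>x \<in> ccarrier A; y \<in> ccarrier A; z \<in> ccarrier A\<rbrakk>
          \<Longrightarrow> cmult A (cadd A x y) z = cadd A (cmult A x z) (cmult A y z)"
    and mult_add_right: "\<lbrakk>x \<in> ccarrier A; y \<in> ccarrier A; z \<in> ccarrier A\<rbrakk>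
          \<Longrightarrow> cmult A x (cadd A y z) = cadd A (cmult A x y) (cmult A x z)"
    and scale_mult_left: "\<lbrakk>x \<in> ccarrier A; y \<in> ccarrier A\<rbrakk>
          \<Longrightarrow> cmult A (cscale A c x) y = cscale A c (cmult A x y)"
    and scale_mult_right: "\<lbrakk>x \<in> ccarrier A; y \<in> ccarrier A\<rbrakk>
          \<Longrightarrow> cmult A x (cscale A c y) = cscale A c (cmult A x y)"
    and star_star: "x \<in> ccarrier A \<Longrightarrow> cstar A (cstar A x) = x"
    and star_add: "\<lbrakk>x \<in> ccarrier A; y \<in> ccarrier A\<rbrakk>
          \<Longrightarrow> cstar A (cadd A x y) = cadd A (cstar A x) (cstar A y)"
    and star_scale: "x \<in> ccarrier A \<Longrightarrow> cstar A (cscale A c x) = cscale A (cnj c) (cstar A x)"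
    and star_mult: "\<lbrakk>x \<in> ccarrier A; y \<in> ccarrier A\<rbrakk>
          \<Longrightarrow> cstar A (cmult A x y) = cmult A (cstar A y) (cstar A x)"
    and norm_nonneg: "x \<in> ccarrier A \<Longrightarrow> 0 \<le> cnorm A x"
    and norm_eq_zero: "x \<in> ccarrier A \<Longrightarrow> cnorm A x = 0 \<longleftrightarrow> x = czero A"
    and norm_triangle: "\<lbrakk>x \<in> ccarrier A; y \<in> ccarrier A\<rbrakk>
          \<Longrightarrow> cnorm A (cadd A x y) \<le> cnorm A x + cnorm A y"
    and norm_scale: "x \<in> ccarrier A \<Longrightarrow> cnorm A (cscale A c x) = cmod c * cnorm A x"
    and norm_mult: "\<lbrakk>x \<in> ccarrier A; y \<in> ccarrier A\<rbrakk>
          \<Longrightarrow> cnorm A (cmult A x y) \<le> cnorm A x * cnorm A y"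
    and norm_star_mult: "x \<in> ccarrier A \<Longrightarrow> cnorm A (cmult A (cstar A x) x) = (cnorm A x)\<^sup>2"
    and complete: "Metric_space.mcomplete (ccarrier A) (cdist A)"

inductive_set cspan :: "'a cstar_alg \<Rightarrow> 'a set \<Rightarrow> 'a set" for A S where
  cspan_zero: "czero A \<in> cspan A S"
| cspan_step: "\<lbrakk>b \<in> S; x \<in> cspan A S\<rbrakk> \<Longrightarrow> cadd A (cscale A c b) x \<in> cspan A S"

definition fd_cstar_algebra :: "'a cstar_alg \<Rightarrow> bool" where
  "fd_cstar_algebra A \<longleftrightarrow> cstar_algebra A \<and>
     (\<exists>S. finite S \<and> S \<subseteq> ccarrier A \<and> ccarrier A \<subseteq> cspan A S)"

text \<open>Morphisms are *-homomorphisms; boundedness is automatic between C*-algebras.\<close>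

definition cstar_hom :: "'a cstar_alg \<Rightarrow> 'b cstar_alg \<Rightarrow> ('a \<Rightarrow> 'b) \<Rightarrow> bool" where
  "cstar_hom A B h \<longleftrightarrow>
     h \<in> ccarrier A \<rightarrow> ccarrier B \<and>
     (\<forall>x\<in>ccarrier A. \<forall>y\<in>ccarrier A. h (cadd A x y) = cadd B (h x) (h y)) \<and>
     (\<forall>c. \<forall>x\<in>ccarrier A. h (cscale A c x) = cscale B c (h x)) \<and>
     (\<forall>x\<in>ccarrier A. \<forall>y\<in>ccarrier A. h (cmult A x y) = cmult B (h x) (h y)) \<and>
     (\<forall>x\<in>ccarrier A. h (cstar A x) = cstar B (h x))"

definition cstar_isomorphic :: "'a cstar_alg \<Rightarrow> 'b cstar_alg \<Rightarrow> bool" where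
  "cstar_isomorphic A B \<longleftrightarrow> (\<exists>h. cstar_hom A B h \<and> bij_betw h (ccarrier A) (ccarrier B))"

text \<open>
  \<open>C(X \<rightarrow> F)\<close> for compact \<open>X\<close>, with the supremum norm (the inserted \<open>0\<close> only matters for empty
  \<open>X\<close>).  Functions are \<^const>\<open>undefined\<close> off \<open>X\<close>, so that equality in the carrier is equality
  on \<open>X\<close>.
\<close>

definition C_alg :: "'x topology \<Rightarrow> 'a cstar_alg \<Rightarrow> ('x \<Rightarrow> 'a) cstar_alg" where
  "C_alg X F =
    \<lparr> ccarrier = {f \<in> extensional (topspace X). continuous_map X (ctopology F) f},
      czero = (\<lambda>t\<in>topspace X. czero F),
      cadd = (\<lambda>f g. \<lambda>t\<in>topspace X. cadd F (f t) (g t)),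
      cscale = (\<lambda>c f. \<lambda>t\<in>topspace X. cscale F c (f t)),
      cmult = (\<lambda>f g. \<lambda>t\<in>topspace X. cmult F (f t) (g t)),
      cstar = (\<lambda>f. \<lambda>t\<in>topspace X. cstar F (f t)),
      cnorm = (\<lambda>f. Sup (insert 0 ((\<lambda>t. cnorm F (f t)) ` topspace X))) \<rparr>"

text \<open>The pullback \<open>{x \<oplus> y \<in> A \<oplus> B. p x = q y}\<close>, with pointwise operations and maximum norm.\<close>

definition pullback ::
    "'a cstar_alg \<Rightarrow> 'b cstar_alg \<Rightarrow> ('a \<Rightarrow> 'c) \<Rightarrow> ('b \<Rightarrow> 'c) \<Rightarrow> ('a \<times> 'b) cstar_alg" where
  "pullback A B p q =
    \<lparr> ccarrier = {(x, y). x \<in> ccarrier A \<and> y \<in> ccarrier B \<and> p x = q y},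
      czero = (czero A, czero B),
      cadd = (\<lambda>(x, y) (x', y'). (cadd A x x', cadd B y y')),
      cscale = (\<lambda>c (x, y). (cscale A c x, cscale B c y)),
      cmult = (\<lambda>(x, y) (x', y'). (cmult A x x', cmult B y y')),
      cstar = (\<lambda>(x, y). (cstar A x, cstar B y)),
      cnorm = (\<lambda>(x, y). max (cnorm A x) (cnorm B y)) \<rparr>"

definition Cyl :: "'a cstar_alg \<Rightarrow> 'b cstar_alg \<Rightarrow> ('a \<Rightarrow> 'b) \<Rightarrow> ('a \<times> (real \<Rightarrow> 'b)) cstar_alg"
  where "Cyl A B \<alpha> = pullback A (C_alg (top_of_set {0..1}) B) \<alpha> (\<lambda>f. f 1)"

text \<open>Transport of the structure of \<open>A\<close> along a map \<open>h\<close> that is injective on the carrier.\<close>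

definition transport :: "('a \<Rightarrow> 'b) \<Rightarrow> 'a cstar_alg \<Rightarrow> 'b cstar_alg" where
  "transport h A = (let g = inv_into (ccarrier A) h in
    \<lparr> ccarrier = h ` ccarrier A,
      czero = h (czero A),
      cadd = (\<lambda>x y. h (cadd A (g x) (g y))),
      cscale = (\<lambda>c x. h (cscale A c (g x))),
      cmult = (\<lambda>x y. h (cmult A (g x) (g y))),
      cstar = (\<lambda>x. h (cstar A (g x))),
      cnorm = (\<lambda>x. cnorm A (g x)) \<rparr>)"


section \<open>Cubes\<close>

text \<open>
  Points of the \<open>k\<close>-cube are functions on \<open>{..<k}\<close>; the \<open>0\<close>-cube is one point with empty boundary.
\<close>

definition cube :: "nat \<Rightarrow> (nat \<Rightarrow> real) topology" where
  "cube k = product_topology (\<lambda>_. top_of_set {0..1}) {..<k}"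

definition open_cube :: "nat \<Rightarrow> (nat \<Rightarrow> real) set" where
  "open_cube k = ({..<k} \<rightarrow>\<^sub>E {0<..<1})"

definition cube_boundary :: "nat \<Rightarrow> (nat \<Rightarrow> real) set" where
  "cube_boundary k = topspace (cube k) - open_cube k"

definition sphere_top :: "nat \<Rightarrow> (nat \<Rightarrow> real) topology" where
  "sphere_top k = subtopology (cube k) (cube_boundary k)"


section \<open>NCCW complexes\<close>

text \<open>
  The algebras \<open>A\<^sub>0, A\<^sub>1, \<dots>\<close> of a complex all get the same type: \<^term>\<open>Glue f a\<close> stands for the
  element \<open>f \<oplus> a\<close> of the pullback \<open>A\<^sub>k\<close> over \<open>A\<^sub>k\<^sub>-\<^sub>1\<close>, and \<^term>\<open>Base x\<close> for an element of \<open>A\<^sub>0\<close>.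
\<close>

datatype 'f tower = Base 'f | Glue "(nat \<Rightarrow> real) \<Rightarrow> 'f" "'f tower"

text \<open>
  The data of a complex: its dimension \<open>n\<close>, the finite-dimensional algebras \<open>F\<^sub>0 = A\<^sub>0, F\<^sub>1, \<dots>, F\<^sub>n\<close>
  and the morphisms \<open>\<sigma>\<^sub>1, \<dots>, \<sigma>\<^sub>n\<close>.  Values at other indices are irrelevant.
\<close>

record 'f nccw =
  nc_dim :: nat
  fibre :: "nat \<Rightarrow> 'f cstar_alg"
  attach :: "nat \<Rightarrow> 'f tower \<Rightarrow> (nat \<Rightarrow> real) \<Rightarrow> 'f"

primrec skeleton :: "'f nccw \<Rightarrow> nat \<Rightarrow> 'f tower cstar_alg" where
  "skeleton X 0 = transport Base (fibre X 0)"
| "skeleton X (Suc k) =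
     transport (\<lambda>(f, a). Glue f a)
       (pullback (C_alg (cube (Suc k)) (fibre X (Suc k))) (skeleton X k)
          (\<lambda>f. restrict f (cube_boundary (Suc k))) (attach X (Suc k)))"

definition nc_alg :: "'f nccw \<Rightarrow> 'f tower cstar_alg" where
  "nc_alg X = skeleton X (nc_dim X)"

primrec tower_tail :: "'f tower \<Rightarrow> 'f tower" where
  "tower_tail (Base x) = Base x"
| "tower_tail (Glue f a) = a"

text \<open>The projection \<open>A\<^sub>n \<rightarrow> A\<^sub>k\<close> for \<open>k \<le> n\<close>, where \<open>n\<close> is the dimension.\<close>

definition nc_proj :: "'f nccw \<Rightarrow> nat \<Rightarrow> 'f tower \<Rightarrow> 'f tower" where
  "nc_proj X k = tower_tail ^^ (nc_dim X - k)"

text \<open>The canonical ideals, with \<open>I\<^sub>k = 0\<close> above the dimension.\<close>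

definition canonical_ideal :: "'f nccw \<Rightarrow> nat \<Rightarrow> 'f tower set" where
  "canonical_ideal X k =
     (if k = 0 then ccarrier (nc_alg X)
      else if k \<le> nc_dim X
        then {a \<in> ccarrier (nc_alg X). nc_proj X (k - 1) a = czero (skeleton X (k - 1))}
      else {czero (nc_alg X)})"

text \<open>
  The condition \<open>I\<^sub>n \<noteq> 0\<close> makes the dimension meaningful: without it, zero algebras could be used
  as \<open>F\<^sub>k\<close> to raise the dimension arbitrarily.  For \<open>k < n\<close> the algebra \<open>F\<^sub>k\<close> may be zero.
\<close>

definition nccw_complex :: "'f nccw \<Rightarrow> bool" where
  "nccw_complex X \<longleftrightarrow>
     (\<forall>k\<le>nc_dim X. fd_cstar_algebra (fibre X k)) \<and>
     (\<forall>k\<in>{1..nc_dim X}.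
        cstar_hom (skeleton X (k - 1)) (C_alg (sphere_top k) (fibre X k)) (attach X k)) \<and>
     canonical_ideal X (nc_dim X) \<noteq> {czero (nc_alg X)}"


section \<open>Simplicial morphisms\<close>

primrec tower_head :: "'f tower \<Rightarrow> (nat \<Rightarrow> real) \<Rightarrow> 'f" where
  "tower_head (Base x) = (\<lambda>t. x)"
| "tower_head (Glue f a) = f"

text \<open>
  For \<open>k \<le> n\<close>, \<open>cell_part X k\<close> is the \<open>k\<close>-th component of an element of \<open>A\<^sub>n\<close>, restricted to the
  open cube.  On \<open>I\<^sub>k\<close> this is the quotient map \<open>I\<^sub>k \<rightarrow> I\<^sub>k / I\<^sub>k\<^sub>+\<^sub>1 = C\<^sub>0((0,1)\<^sup>k \<rightarrow> F\<^sub>k)\<close>.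
\<close>

definition cell_part :: "'f nccw \<Rightarrow> nat \<Rightarrow> 'f tower \<Rightarrow> (nat \<Rightarrow> real) \<Rightarrow> 'f" where
  "cell_part X k a = restrict (tower_head (nc_proj X k a)) (open_cube k)"

text \<open>
  The map \<open>i\<^sup>* \<otimes> \<phi>\<close>, under the identification of \<open>C\<^sub>0((0,1)\<^sup>k) \<otimes> F\<close> with \<open>C\<^sub>0((0,1)\<^sup>k \<rightarrow> F)\<close> in which
  \<open>h \<otimes> x\<close> is the function \<open>t \<mapsto> h(t) x\<close>.
\<close>

definition pull_tensor ::
    "nat \<Rightarrow> ((nat \<Rightarrow> real) \<Rightarrow> (nat \<Rightarrow> real)) \<Rightarrow> ('f \<Rightarrow> 'g)
      \<Rightarrow> ((nat \<Rightarrow> real) \<Rightarrow> 'f) \<Rightarrow> ((nat \<Rightarrow> real) \<Rightarrow> 'g)" where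
  "pull_tensor k i \<phi> f = (\<lambda>t\<in>open_cube k. \<phi> (f (i t)))"

text \<open>
  The last equation says that \<open>i\<^sup>* \<otimes> \<phi>\<close> is the map induced by \<open>\<alpha>\<close> on the quotients
  \<open>I\<^sub>k / I\<^sub>k\<^sub>+\<^sub>1 \<rightarrow> J\<^sub>k / J\<^sub>k\<^sub>+\<^sub>1\<close>.  For \<open>k\<close> above the dimension of \<open>Y\<close> the target quotient is zero, and
  nothing is required beyond \<open>\<alpha>(I\<^sub>k) = 0\<close>.
\<close>

definition simplicial :: "'f nccw \<Rightarrow> 'g nccw \<Rightarrow> ('f tower \<Rightarrow> 'g tower) \<Rightarrow> bool" where
  "simplicial X Y \<alpha> \<longleftrightarrow>
     cstar_hom (nc_alg X) (nc_alg Y) \<alpha> \<and>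
     (\<forall>k. \<alpha> ` canonical_ideal X k \<subseteq> canonical_ideal Y k) \<and>
     (\<forall>k. k \<le> nc_dim X \<and> k \<le> nc_dim Y \<longrightarrow>
        (\<exists>\<phi> i. cstar_hom (fibre X k) (fibre Y k) \<phi> \<and>
               homeomorphic_map (cube k) (cube k) i \<and>
               (\<forall>a\<in>canonical_ideal X k.
                  cell_part Y k (\<alpha> a) = pull_tensor k i \<phi> (cell_part X k a))))"

end

theory Submission
  imports Defs
begin

text \<open>
  The mapping cylinder of a cellular map is again a cell complex: its cells are those of the two
  complexes, together with the products of an interval with the cells of one of them.  The proof
  is the dual of this remark.  Write \<open>A\<^sub>k\<close>, \<open>B\<^sub>k\<close> for the skeleta and \<open>F\<^sub>k\<close>, \<open>G\<^sub>k\<close> for the fibres.  As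
  \<open>\<alpha>(I\<^sub>k\<^sub>+\<^sub>1) \<subseteq> J\<^sub>k\<^sub>+\<^sub>1\<close>, the morphism \<open>\<alpha>\<close> induces morphisms \<open>\<alpha>\<^sub>k : A\<^sub>k \<rightarrow> B\<^sub>k\<close>.  Let \<open>C\<^sub>k\<close> consist of
  the triples \<open>(x, y, g)\<close> with \<open>x \<in> A\<^sub>k\<close>, \<open>y \<in> B\<^sub>k\<close> and \<open>g : [0,1] \<rightarrow> B\<^sub>k\<^sub>-\<^sub>1\<close> such that \<open>g 0\<close> is the
  image of \<open>y\<close> and \<open>g 1\<close> is \<open>\<alpha>\<^sub>k\<^sub>-\<^sub>1\<close> of the image of \<open>x\<close>.  Compared to \<open>C\<^sub>k\<^sub>-\<^sub>1\<close>, such a triple carries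
  as additional data the top cells of \<open>x\<close>, of \<open>y\<close> and of all \<open>g t\<close>.  The last of these is a
  function of \<open>(t, s) \<in> [0,1] \<times> [0,1]\<^sup>k\<^sup>-\<^sup>1\<close>, that is, a \<open>k\<close>-cell with values in \<open>G\<^sub>k\<^sub>-\<^sub>1\<close>.  Its
  boundary values are determined by \<open>C\<^sub>k\<^sub>-\<^sub>1\<close>: at \<open>t = 0\<close> by \<open>y\<close>, at \<open>t = 1\<close> by \<open>\<alpha>\<^sub>k\<^sub>-\<^sub>1\<close>, and for \<open>s\<close> on
  the boundary by the attaching map of \<open>B\<close>, applied to the image of \<open>g t\<close> in \<open>B\<^sub>k\<^sub>-\<^sub>2\<close>.  So \<open>C\<^sub>k\<close> is a
  pullback of the required form, with fibre \<open>F\<^sub>k \<oplus> G\<^sub>k \<oplus> G\<^sub>k\<^sub>-\<^sub>1\<close>.  For \<open>k = max n (m + 1)\<close> the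
  component \<open>y\<close> is determined by \<open>g 0\<close>, and \<open>C\<^sub>k\<close> is the mapping cylinder.

  Four points need work.

  \<^item> The new attaching map must take values in continuous functions, so \<open>t \<mapsto> \<sigma>(g t)\<close> must be
  continuous for the attaching maps \<open>\<sigma>\<close> of \<open>B\<close>.  This is automatic continuity of morphisms,
  \<open>cstar_hom_contractive\<close>.  It needs complete C*-algebras as domains, so pullbacks and function
  algebras are shown to be C*-algebras.

  \<^item> The functions \<open>[0,1] \<rightarrow> C([0,1]\<^sup>k \<rightarrow> G)\<close> have to be identified with functions on a cube of one
  dimension more (\<open>continuous_map_curry\<close>, \<open>continuous_map_uncurry\<close>).

  \<^item> The morphism \<open>\<alpha>\<^sub>k\<close> is defined on all of \<open>A\<^sub>k\<close> only because \<open>A\<^sub>n \<rightarrow> A\<^sub>k\<close> is surjective.  This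
  amounts to extending functions from the boundary of a cube to the cube
  (\<open>extend_from_cube_boundary\<close>).

  \<^item> The dimensions \<open>n\<close> and \<open>m\<close> are unrelated.  Both complexes are therefore continued by zero
  fibres, which does not change the algebras (\<open>bij_to_level\<close>).

  The attaching map of the cylinder complex is studied in \<open>hom_attach_Z\<close>, its skeleta are
  identified in \<open>skeleton_Z_isomorphic\<close>, and the top one is compared to the mapping cylinder in
  \<open>Cyl_isomorphic_double_cyl\<close>.
\<close>

section \<open>Elementary identities and estimates\<close>

abbreviation cdiff :: "'a cstar_alg \<Rightarrow> 'a \<Rightarrow> 'a \<Rightarrow> 'a" where
  "cdiff A x y \<equiv> cadd A x (cscale A (-1) y)"

context cstar_algebra
begin

lemmas closed [simp] = zero_closed add_closed scale_closed mult_closed star_closed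

lemma add_left_commute:
  assumes "x \<in> ccarrier A" "y \<in> ccarrier A" "z \<in> ccarrier A"
  shows "cadd A x (cadd A y z) = cadd A y (cadd A x z)"
  using assms by (metis add_assoc add_commute)

lemmas add_ac = add_assoc add_commute add_left_commute

lemma add_zero_right: "x \<in> ccarrier A \<Longrightarrow> cadd A x (czero A) = x"
  using add_commute add_zero zero_closed by metis

lemma scale_zero_left: "x \<in> ccarrier A \<Longrightarrow> cscale A 0 x = czero A"
  using scale_add_left[of x 1 "-1"] by (simp add: scale_one add_inverse)

lemma scale_zero_right: "cscale A c (czero A) = czero A"
  using scale_zero_left[of "czero A"] scale_scale[of "czero A" c 0] by simp

lemma cancel_left:
  assumes "x \<in> ccarrier A" "z \<in> ccarrier A"
  shows "cadd A x (cadd A (cscale A (-1) x) z) = z"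
  using assms by (simp add: add_assoc[symmetric] add_inverse add_zero)

lemma diff_self: "x \<in> ccarrier A \<Longrightarrow> cdiff A x x = czero A"
  by (rule add_inverse)

lemma diff_eq_zero_iff:
  assumes "x \<in> ccarrier A" "y \<in> ccarrier A"
  shows "cdiff A x y = czero A \<longleftrightarrow> x = y"
proof
  assume *: "cdiff A x y = czero A"
  have "x = cadd A y (cdiff A x y)"
    using assms by (metis add_left_commute add_inverse add_zero_right scale_closed)
  then show "x = y" using * assms by (simp add: add_zero_right)
qed (use assms in \<open>simp add: add_inverse\<close>)

lemma diff_swap:
  assumes "x \<in> ccarrier A" "y \<in> ccarrier A"
  shows "cdiff A y x = cscale A (-1) (cdiff A x y)"
  using assms by (simp add: scale_add_right scale_scale scale_one add_commute)

lemma norm_uminus: "x \<in> ccarrier A \<Longrightarrow> cnorm A (cscale A (-1) x) = cnorm A x"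
  by (simp add: norm_scale)

lemma norm_diff_swap:
  assumes "x \<in> ccarrier A" "y \<in> ccarrier A"
  shows "cnorm A (cdiff A y x) = cnorm A (cdiff A x y)"
  using diff_swap[OF assms] norm_uminus assms by simp

lemma norm_zero [simp]: "cnorm A (czero A) = 0"
  by (simp add: norm_eq_zero)

lemma diff_add_diff:
  assumes "x \<in> ccarrier A" "y \<in> ccarrier A" "z \<in> ccarrier A"
  shows "cadd A (cdiff A x y) (cdiff A y z) = cdiff A x z"
proof -
  have "cadd A (cdiff A x y) (cdiff A y z)
      = cadd A x (cadd A y (cadd A (cscale A (-1) y) (cscale A (-1) z)))"
    using assms by (metis add_assoc add_left_commute add_closed scale_closed)
  then show ?thesis using assms by (simp add: cancel_left)
qed

lemma norm_diff_triangle: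
  assumes "x \<in> ccarrier A" "y \<in> ccarrier A" "z \<in> ccarrier A"
  shows "cnorm A (cdiff A x z) \<le> cnorm A (cdiff A x y) + cnorm A (cdiff A y z)"
  using norm_triangle[of "cdiff A x y" "cdiff A y z"] diff_add_diff[OF assms] assms by simp

lemma norm_triangle_diff:
  assumes "x \<in> ccarrier A" "y \<in> ccarrier A"
  shows "cnorm A x \<le> cnorm A y + cnorm A (cdiff A x y)"
proof -
  have "x = cadd A y (cdiff A x y)"
    using assms by (metis add_left_commute add_inverse add_zero_right scale_closed)
  then show ?thesis using norm_triangle[of y "cdiff A x y"] assms by simp
qed

sublocale metric: Metric_space "ccarrier A" "cdist A"
proof
  show "0 \<le> cdist A x y" for x y by (simp add: cdist_def norm_nonneg)
  show "cdist A x y = cdist A y x" for x y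
    by (simp add: cdist_def norm_diff_swap[of x y])
  show "cdist A x y = 0 \<longleftrightarrow> x = y" if "x \<in> ccarrier A" "y \<in> ccarrier A" for x y
    using that by (simp add: cdist_def norm_eq_zero diff_eq_zero_iff)
  show "cdist A x z \<le> cdist A x y + cdist A y z"
    if "x \<in> ccarrier A" "y \<in> ccarrier A" "z \<in> ccarrier A" for x y z
    using that by (simp add: cdist_def norm_diff_triangle)
qed

lemma topspace_ctopology [simp]: "topspace (ctopology A) = ccarrier A"
  by (simp add: ctopology_def)

lemma mult_zero_left: "x \<in> ccarrier A \<Longrightarrow> cmult A (czero A) x = czero A"
  using scale_mult_left[of "czero A" x 0] by (simp add: scale_zero_left)

lemma mult_zero_right: "x \<in> ccarrier A \<Longrightarrow> cmult A x (czero A) = czero A"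
  using scale_mult_right[of x "czero A" 0] by (simp add: scale_zero_left)

lemma star_zero: "cstar A (czero A) = czero A"
  using star_scale[of "czero A" 0] by (simp add: scale_zero_left)

lemma norm_star:
  assumes "x \<in> ccarrier A" shows "cnorm A (cstar A x) = cnorm A x"
proof -
  have le: "cnorm A y \<le> cnorm A (cstar A y)" if y: "y \<in> ccarrier A" for y
  proof (cases "cnorm A y = 0")
    case False
    then have pos: "0 < cnorm A y" using norm_nonneg[OF y] by simp
    have "cnorm A y * cnorm A y \<le> cnorm A (cstar A y) * cnorm A y"
      using norm_star_mult[OF y] norm_mult[of "cstar A y" y] y by (simp add: power2_eq_square)
    then show ?thesis using pos by simp
  qed (simp add: y norm_nonneg)
  show ?thesis
    using le[OF assms] le[of "cstar A x"] assms by (simp add: star_star)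
qed

lemma mult_binomials:
  assumes "p \<in> ccarrier A" "q \<in> ccarrier A" "p' \<in> ccarrier A" "q' \<in> ccarrier A"
  shows "cmult A (cadd A p (cscale A d q)) (cadd A p' (cscale A c q'))
    = cadd A (cadd A (cmult A p p') (cscale A c (cmult A p q')))
        (cadd A (cscale A d (cmult A q p')) (cscale A (d * c) (cmult A q q')))"
  using assms
  by (simp add: mult_add_left mult_add_right scale_mult_left scale_mult_right scale_add_right
      scale_scale add_ac mult.commute)

section \<open>Contractivity of morphisms\<close>

text \<open>
  The last two hypotheses say that \<open>u\<close> and \<open>v = 1 - w\<close> commute and satisfy \<open>u\<^sup>2 + v\<^sup>2 = 1\<close>.  So
  \<open>u \<plusminus> \<i>v\<close> are unitary, and \<open>u\<close> is their mean.  As there may be no unit, the unitaries are replaced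
  by the isometries \<open>y \<mapsto> u y \<plusminus> \<i>(y - w y)\<close>, and it is enough to apply these to \<open>y = u\<close>.
\<close>

lemma norm_real_part_of_unitary_le:
  assumes u: "u \<in> ccarrier A" "cstar A u = u" and w: "w \<in> ccarrier A" "cstar A w = w"
    and comm: "cmult A u w = cmult A w u"
    and sq: "cscale A 2 w = cadd A (cmult A u u) (cmult A w w)"
  shows "cnorm A u \<le> 1"
proof -
  \<comment> \<open>\<open>p = u y\<close> and \<open>q = y - w y\<close> for \<open>y = u\<close>; the goal is \<open>\<parallel>p \<plusminus> \<i>q\<parallel> = \<parallel>u\<parallel>\<close>.\<close>
  let ?p = "cmult A u u" and ?q = "cdiff A u (cmult A w u)"
  let ?P = "cmult A u (cmult A u (cmult A u u))" and ?Q = "cmult A u (cmult A w u)"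
  let ?R = "cmult A u (cmult A w (cmult A w u))" and ?S = "cmult A u u"
  have "cmult A (cscale A 2 w) u = cmult A (cadd A (cmult A u u) (cmult A w w)) u"
    using sq by simp
  then have "cscale A 2 (cmult A w u) = cadd A (cmult A u (cmult A u u)) (cmult A w (cmult A w u))"
    using u w by (simp add: scale_mult_left mult_add_left mult_assoc)
  then have "cmult A u (cscale A 2 (cmult A w u))
      = cmult A u (cadd A (cmult A u (cmult A u u)) (cmult A w (cmult A w u)))"
    by simp
  then have PR: "cadd A ?P ?R = cscale A 2 ?Q"
    using u w by (simp add: scale_mult_right mult_add_right)
  have ps: "cstar A ?p = ?p" and qs: "cstar A ?q = cdiff A u (cmult A u w)"
    using u w by (simp_all add: star_mult star_add star_scale)
  have pp: "cmult A ?p ?p = ?P"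
    using u by (simp add: mult_assoc)
  have qq: "cmult A (cdiff A u (cmult A u w)) ?q
      = cadd A (cdiff A ?S ?Q) (cadd A (cscale A (-1) ?Q) ?R)"
    using u w by (simp add: mult_add_left mult_add_right scale_mult_left scale_mult_right
        scale_add_right scale_scale scale_one mult_assoc)
  have uuwu: "cmult A u (cmult A w (cmult A u u)) = cmult A u (cmult A u (cmult A w u))"
    using u w comm by (metis mult_assoc mult_closed)
  have pq: "cmult A ?p ?q = cmult A (cdiff A u (cmult A u w)) ?p"
    using u w by (simp add: mult_add_left mult_add_right scale_mult_left scale_mult_right
        mult_assoc uuwu)
  \<comment> \<open>This is \<open>u\<^sup>2 + v\<^sup>2 = 1\<close>, applied to \<open>u\<close> and multiplied by \<open>u\<close> from the left.\<close>
  have sum: "cadd A (cmult A ?p ?p) (cmult A (cdiff A u (cmult A u w)) ?q) = ?S"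
  proof -
    have "cadd A ?P (cadd A (cdiff A ?S ?Q) (cadd A (cscale A (-1) ?Q) ?R))
       = cadd A ?S (cadd A (cadd A ?P ?R) (cadd A (cscale A (-1) ?Q) (cscale A (-1) ?Q)))"
      using u w by (simp add: add_ac)
    also have "cadd A (cscale A (-1) ?Q) (cscale A (-1) ?Q) = cscale A (-2) ?Q"
      using u w by (simp add: scale_add_left[symmetric])
    also have "cadd A (cadd A ?P ?R) (cscale A (-2) ?Q) = czero A"
      unfolding PR using u w by (simp add: scale_add_left[symmetric] scale_zero_left)
    finally show ?thesis using u w by (simp add: pp qq add_zero_right)
  qed
  have iso: "cnorm A (cadd A ?p (cscale A c ?q)) = cnorm A u"
    if c: "cnj c = - c" "c * c = -1" for c
  proof -
    let ?z = "cadd A ?p (cscale A c ?q)" and ?q' = "cdiff A u (cmult A u w)"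
    have cc: "- (c * c) = 1" using c by simp
    have [simp]: "?q \<in> ccarrier A" "?q' \<in> ccarrier A" "?p \<in> ccarrier A" using u w by auto
    have "cstar A ?z = cadd A ?p (cscale A (- c) ?q')"
      using c ps qs by (simp add: star_add star_scale)
    then have "cmult A (cstar A ?z) ?z
        = cmult A (cadd A ?p (cscale A (- c) ?q')) (cadd A ?p (cscale A c ?q))" by simp
    also have "\<dots> = cadd A (cadd A (cmult A ?p ?p) (cscale A c (cmult A ?p ?q)))
             (cadd A (cscale A (- c) (cmult A ?q' ?p)) (cscale A (- c * c) (cmult A ?q' ?q)))"
      by (rule mult_binomials) (use u w in auto)
    also have "\<dots> = cadd A (cadd A (cmult A ?p ?p) (cmult A ?q' ?q))
             (cadd A (cscale A c (cmult A ?p ?q)) (cscale A (- c) (cmult A ?p ?q)))"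
      unfolding pq using cc by (simp add: scale_one add_ac)
    also have "cadd A (cscale A c (cmult A ?p ?q)) (cscale A (- c) (cmult A ?p ?q)) = czero A"
      by (simp add: scale_add_left[symmetric] scale_zero_left)
    finally have "cmult A (cstar A ?z) ?z = ?S"
      unfolding sum using u by (simp add: add_zero_right)
    then have "(cnorm A ?z)\<^sup>2 = (cnorm A u)\<^sup>2"
      using norm_star_mult[of ?z] norm_star_mult[of u] u by simp
    then show ?thesis using norm_nonneg[of ?z] norm_nonneg[of u] u by simp
  qed
  have two: "cscale A 2 ?p = cadd A (cadd A ?p (cscale A \<i> ?q)) (cadd A ?p (cscale A (-\<i>) ?q))"
  proof -
    have "cadd A (cadd A ?p (cscale A \<i> ?q)) (cadd A ?p (cscale A (-\<i>) ?q))
        = cadd A (cadd A ?p ?p) (cadd A (cscale A \<i> ?q) (cscale A (-\<i>) ?q))"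
      using u w by (simp add: add_ac)
    also have "cadd A (cscale A \<i> ?q) (cscale A (-\<i>) ?q) = czero A"
      using u w by (subst scale_add_left[symmetric]) (auto simp: scale_zero_left)
    also have "cadd A ?p ?p = cscale A 2 ?p"
      using scale_add_left[of ?p 1 1] u by (simp add: scale_one)
    finally show ?thesis using u by (simp add: add_zero_right)
  qed
  have "2 * cnorm A ?p \<le> cnorm A u + cnorm A u"
    using norm_triangle[of "cadd A ?p (cscale A \<i> ?q)" "cadd A ?p (cscale A (-\<i>) ?q)"]
      iso[of \<i>] iso[of "-\<i>"] u w norm_scale[of ?p 2] two by simp
  moreover have "cnorm A ?p = cnorm A u * cnorm A u"
    using norm_star_mult[OF u(1)] u by (simp add: power2_eq_square)
  ultimately have "cnorm A u * cnorm A u \<le> cnorm A u * 1" by simp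
  then show ?thesis
    using norm_nonneg[OF u(1)] by (cases "cnorm A u = 0") (auto simp: mult_le_cancel_left)
qed

end

context cstar_algebra
begin

text \<open>
  The element \<open>w\<close> is \<open>1 - sqrt (1 - a\<^sup>2)\<close>, obtained as a fixed point of \<open>T x = (a\<^sup>2 + x\<^sup>2) / 2\<close>.
  For \<open>r = 1 - sqrt (1 - \<parallel>a\<parallel>\<^sup>2)\<close>, which is the analogous fixed point for numbers, \<open>T\<close> maps the
  ball of radius \<open>r\<close> to itself and contracts it with constant \<open>r < 1\<close>.  The set \<open>M\<close> of self-adjoint
  elements of this ball that commute with \<open>a\<close> is closed and stable under \<open>T\<close>.
\<close>

lemma ex_self_adjoint_quasi_sqrt:
  assumes a: "a \<in> ccarrier A" "cstar A a = a" "cnorm A a < 1"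
  shows "\<exists>w\<in>ccarrier A. cstar A w = w \<and> cmult A a w = cmult A w a \<and>
           cscale A 2 w = cadd A (cmult A a a) (cmult A w w)"
proof -
  define s where "s = sqrt (1 - (cnorm A a)\<^sup>2)"
  define r where "r = 1 - s"
  have n1: "(cnorm A a)\<^sup>2 < 1"
    using a norm_nonneg[OF a(1)] by (simp add: power_less_one_iff)
  have s2: "s\<^sup>2 = 1 - (cnorm A a)\<^sup>2" "0 < s" "s \<le> 1"
    using n1 by (simp_all add: s_def)
  then have r: "0 \<le> r" "r < 1" "(cnorm A a)\<^sup>2 + r\<^sup>2 = 2 * r"
    unfolding r_def by (simp_all add: power2_eq_square algebra_simps)
  define M where "M = {x \<in> ccarrier A. cstar A x = x \<and> cmult A a x = cmult A x a \<and> cnorm A x \<le> r}"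
  define T where "T x = cscale A (1/2) (cadd A (cmult A a a) (cmult A x x))" for x
  have T_diff: "cdiff A (T x) (T y) = cscale A (1/2) (cadd A (cmult A x (cdiff A x y)) (cmult A (cdiff A x y) y))"
    if "x \<in> ccarrier A" "y \<in> ccarrier A" for x y
  proof -
    have "cdiff A (T x) (T y) = cscale A (1/2) (cadd A (cadd A (cmult A a a) (cmult A x x)) (cscale A (-1) (cadd A (cmult A a a) (cmult A y y))))"
      using that a unfolding T_def by (simp add: scale_add_right scale_scale)
    also have "cadd A (cadd A (cmult A a a) (cmult A x x)) (cscale A (-1) (cadd A (cmult A a a) (cmult A y y)))
       = cadd A (cadd A (cmult A a a) (cscale A (-1) (cmult A a a))) (cdiff A (cmult A x x) (cmult A y y))"
      using that a by (simp add: scale_add_right add_ac)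
    also have "\<dots> = cdiff A (cmult A x x) (cmult A y y)"
      using that a by (simp add: add_inverse add_zero)
    also have "\<dots> = cadd A (cdiff A (cmult A x x) (cmult A x y)) (cdiff A (cmult A x y) (cmult A y y))"
      using that by (simp add: diff_add_diff)
    also have "\<dots> = cadd A (cmult A x (cdiff A x y)) (cmult A (cdiff A x y) y)"
      using that by (simp add: mult_add_left mult_add_right scale_mult_left scale_mult_right)
    finally show ?thesis .
  qed
  have M_sub: "M \<subseteq> ccarrier A" by (auto simp: M_def)
  have zM: "czero A \<in> M" using r a by (auto simp: M_def star_zero mult_zero_left mult_zero_right)
  have TM: "T x \<in> M" if "x \<in> M" for x
  proof -
    have x: "x \<in> ccarrier A" "cstar A x = x" "cmult A a x = cmult A x a" "cnorm A x \<le> r"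
      using that by (auto simp: M_def)
    have "cmult A a (cmult A x x) = cmult A (cmult A x x) a"
      using x a by (metis mult_assoc)
    then have 1: "cmult A a (T x) = cmult A (T x) a"
      using x a unfolding T_def
      by (simp add: scale_mult_left scale_mult_right mult_add_left mult_add_right mult_assoc)
    have 2: "cstar A (T x) = T x"
      using x a unfolding T_def by (simp add: star_scale star_add star_mult)
    have "cnorm A (T x) \<le> 1/2 * (cnorm A a * cnorm A a + cnorm A x * cnorm A x)"
      using norm_triangle[of "cmult A a a" "cmult A x x"] norm_mult[of a a] norm_mult[of x x] x a
      unfolding T_def by (simp add: norm_scale)
    also have "\<dots> \<le> 1/2 * ((cnorm A a)\<^sup>2 + r\<^sup>2)"
      using mult_mono[OF x(4) x(4)] r(1) norm_nonneg[OF x(1)] by (simp add: power2_eq_square)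
    finally have "cnorm A (T x) \<le> r" using r by simp
    then show ?thesis using 1 2 x a by (simp add: M_def T_def)
  qed
  interpret sub: Submetric "ccarrier A" "cdist A" M
    by unfold_locales (rule M_sub)
  have "sub.sub.mcomplete"
  proof (rule sub.sequentially_closedin_mcomplete_imp_mcomplete)
    show "metric.mcomplete" using complete .
    fix \<sigma> l assume *: "range \<sigma> \<subseteq> M \<and> limitin metric.mtopology \<sigma> l sequentially"
    have lim_ex: "\<exists>k. cnorm A (cdiff A (\<sigma> k) l) < e" if "0 < e" for e
    proof -
      have "eventually (\<lambda>k. \<sigma> k \<in> ccarrier A \<and> cdist A (\<sigma> k) l < e) sequentially" "l \<in> ccarrier A"
        using * that by (auto simp: metric.limitin_metric)
      then obtain k where "\<sigma> k \<in> ccarrier A" "cdist A (\<sigma> k) l < e"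
        using eventually_happens'[OF sequentially_bot] by blast
      then show ?thesis using \<open>l \<in> ccarrier A\<close> by (auto simp: cdist_def)
    qed
    from * have \<sigma>: "\<And>k. \<sigma> k \<in> M" and l: "l \<in> ccarrier A"
      and lim: "\<And>e. 0 < e \<Longrightarrow> \<exists>k. cnorm A (cdiff A (\<sigma> k) l) < e"
      using lim_ex by (auto simp: metric.limitin_metric)
    have \<sigma>': "\<sigma> k \<in> ccarrier A" "cstar A (\<sigma> k) = \<sigma> k" "cmult A a (\<sigma> k) = cmult A (\<sigma> k) a" "cnorm A (\<sigma> k) \<le> r" for k
      using \<sigma> by (auto simp: M_def)
    \<comment> \<open>The equations defining \<open>M\<close> pass to the limit \<open>l\<close>: the difference of their sides is Lipschitz in \<open>l\<close>.\<close>
    have zero: "x = y" if "x \<in> ccarrier A" "y \<in> ccarrier A" "0 \<le> c"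
      and le: "\<And>k. cnorm A (cdiff A x y) \<le> c * cnorm A (cdiff A (\<sigma> k) l)" for x y c
    proof -
      have "cnorm A (cdiff A x y) \<le> 0"
      proof (rule field_le_epsilon)
        fix e :: real assume "0 < e"
        then obtain k where "cnorm A (cdiff A (\<sigma> k) l) < e / (c + 1)"
          using lim[of "e / (c+1)"] \<open>0 \<le> c\<close> by auto
        then have "(c + 1) * cnorm A (cdiff A (\<sigma> k) l) \<le> e"
          using \<open>0 \<le> c\<close> by (simp add: field_simps)
        moreover have "c * cnorm A (cdiff A (\<sigma> k) l) \<le> (c + 1) * cnorm A (cdiff A (\<sigma> k) l)"
          using \<sigma>' l norm_nonneg by (simp add: mult_right_mono)
        ultimately show "cnorm A (cdiff A x y) \<le> 0 + e" using le[of k] by simp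
      qed
      then show ?thesis
        using that norm_nonneg[of "cdiff A x y"] norm_eq_zero[of "cdiff A x y"] diff_eq_zero_iff[of x y] by simp
    qed
    have "cstar A l = l"
    proof (rule zero[of _ _ 2])
      fix k
      have "cnorm A (cdiff A (cstar A l) (\<sigma> k)) = cnorm A (cdiff A l (\<sigma> k))"
        using norm_star[of "cdiff A l (\<sigma> k)"] l \<sigma>' by (simp add: star_add star_scale)
      then show "cnorm A (cdiff A (cstar A l) l) \<le> 2 * cnorm A (cdiff A (\<sigma> k) l)"
        using norm_diff_triangle[of "cstar A l" "\<sigma> k" l] l \<sigma>'(1) norm_diff_swap[of l "\<sigma> k"] by simp
    qed (use l in auto)
    moreover have "cmult A a l = cmult A l a"
    proof (rule zero[of _ _ "2 * cnorm A a"])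
      fix k
      have "cnorm A (cdiff A (cmult A a l) (cmult A a (\<sigma> k))) \<le> cnorm A a * cnorm A (cdiff A l (\<sigma> k))"
        using norm_mult[of a "cdiff A l (\<sigma> k)"] l a \<sigma>'(1) by (simp add: mult_add_right scale_mult_right)
      moreover have "cnorm A (cdiff A (cmult A (\<sigma> k) a) (cmult A l a)) \<le> cnorm A (cdiff A (\<sigma> k) l) * cnorm A a"
        using norm_mult[of "cdiff A (\<sigma> k) l" a] l a \<sigma>'(1) by (simp add: mult_add_left scale_mult_left)
      ultimately show "cnorm A (cdiff A (cmult A a l) (cmult A l a)) \<le> 2 * cnorm A a * cnorm A (cdiff A (\<sigma> k) l)"
        using norm_diff_triangle[of "cmult A a l" "cmult A a (\<sigma> k)" "cmult A l a"] l a \<sigma>'(1)[of k] \<sigma>'(3)[of k]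
          norm_diff_swap[of l "\<sigma> k"] by (simp add: mult.commute)
    qed (use l a norm_nonneg in auto)
    moreover have "cnorm A l \<le> r"
    proof (rule field_le_epsilon)
      fix e :: real assume "0 < e"
      then obtain k where "cnorm A (cdiff A (\<sigma> k) l) < e" using lim by blast
      then show "cnorm A l \<le> r + e"
        using norm_triangle_diff[of l "\<sigma> k"] l \<sigma>'[of k] norm_diff_swap[of l "\<sigma> k"] by simp
    qed
    ultimately show "l \<in> M" using l by (simp add: M_def)
  qed
  then obtain w where w: "w \<in> M" "T w = w"
  proof (rule sub.sub.Banach_fixedpoint_thm)
    show "M \<noteq> {}" using zM by blast
    show "T \<in> M \<rightarrow> M" using TM by blast
    show "r < 1" by fact
    fix x y assume xy: "x \<in> M" "y \<in> M"
    then have c: "x \<in> ccarrier A" "y \<in> ccarrier A" "cnorm A x \<le> r" "cnorm A y \<le> r"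
      by (auto simp: M_def)
    have Tc: "T x \<in> ccarrier A" "T y \<in> ccarrier A" using c a by (auto simp: T_def)
    have "cnorm A (cdiff A (T x) (T y))
      \<le> 1/2 * (cnorm A x * cnorm A (cdiff A x y) + cnorm A (cdiff A x y) * cnorm A y)"
      unfolding T_diff[OF c(1,2)] using c norm_triangle[of "cmult A x (cdiff A x y)" "cmult A (cdiff A x y) y"]
        norm_mult[of x "cdiff A x y"] norm_mult[of "cdiff A x y" y] by (simp add: norm_scale)
    also have "\<dots> \<le> 1/2 * (r * cnorm A (cdiff A x y) + cnorm A (cdiff A x y) * r)"
      using c norm_nonneg[of "cdiff A x y"] by (intro mult_left_mono add_mono mult_mono) (auto simp: r)
    finally show "cdist A (T x) (T y) \<le> r * cdist A x y"
      using c Tc by (simp add: cdist_def mult.commute)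
  qed blast
  have "cscale A 2 w = cscale A 2 (T w)" using w by simp
  also have "\<dots> = cadd A (cmult A a a) (cmult A w w)"
    unfolding T_def using a w M_sub by (subst scale_scale) (auto simp: scale_one)
  finally show ?thesis using w by (auto simp: M_def)
qed

end

lemma cstar_homI:
  assumes "\<And>x. x \<in> ccarrier A \<Longrightarrow> h x \<in> ccarrier B"
    and "\<And>x y. \<lbrakk>x \<in> ccarrier A; y \<in> ccarrier A\<rbrakk> \<Longrightarrow> h (cadd A x y) = cadd B (h x) (h y)"
    and "\<And>c x. x \<in> ccarrier A \<Longrightarrow> h (cscale A c x) = cscale B c (h x)"
    and "\<And>x y. \<lbrakk>x \<in> ccarrier A; y \<in> ccarrier A\<rbrakk> \<Longrightarrow> h (cmult A x y) = cmult B (h x) (h y)"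
    and "\<And>x. x \<in> ccarrier A \<Longrightarrow> h (cstar A x) = cstar B (h x)"
  shows "cstar_hom A B h"
  unfolding cstar_hom_def
proof (intro conjI ballI allI)
  show "h \<in> ccarrier A \<rightarrow> ccarrier B" using assms(1) by (rule Pi_I)
qed (fact assms)+

lemma cstar_homD:
  assumes "cstar_hom A B h"
  shows "x \<in> ccarrier A \<Longrightarrow> h x \<in> ccarrier B"
    and "\<lbrakk>x \<in> ccarrier A; y \<in> ccarrier A\<rbrakk> \<Longrightarrow> h (cadd A x y) = cadd B (h x) (h y)"
    and "x \<in> ccarrier A \<Longrightarrow> h (cscale A c x) = cscale B c (h x)"
    and "\<lbrakk>x \<in> ccarrier A; y \<in> ccarrier A\<rbrakk> \<Longrightarrow> h (cmult A x y) = cmult B (h x) (h y)"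
    and "x \<in> ccarrier A \<Longrightarrow> h (cstar A x) = cstar B (h x)"
  using assms unfolding cstar_hom_def by (simp_all add: Pi_iff)

lemma cstar_hom_zero:
  assumes "cstar_algebra A" "cstar_algebra B" "cstar_hom A B h"
  shows "h (czero A) = czero B"
proof -
  have "h (cscale A 0 (czero A)) = cscale B 0 (h (czero A))"
    using assms by (intro cstar_homD(3)) (auto intro: cstar_algebra.zero_closed)
  then show ?thesis
    using assms cstar_homD(1)[OF assms(3)]
    by (simp add: cstar_algebra.scale_zero_left cstar_algebra.zero_closed)
qed

lemma cstar_hom_diff:
  assumes "cstar_algebra A" "cstar_hom A B h" "x \<in> ccarrier A" "y \<in> ccarrier A"
  shows "h (cdiff A x y) = cdiff B (h x) (h y)"
  using assms(3,4) cstar_algebra.scale_closed[OF assms(1,4)]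
  by (simp add: cstar_homD(2,3)[OF assms(2)])

lemma cstar_hom_compose:
  assumes "cstar_hom A B h" "cstar_hom B C k"
  shows "cstar_hom A C (\<lambda>x. k (h x))"
  by (rule cstar_homI) (simp_all add: cstar_homD[OF assms(1)] cstar_homD[OF assms(2)])

lemma cstar_hom_zero_map:
  assumes "cstar_algebra B"
  shows "cstar_hom A B (\<lambda>_. czero B)"
proof -
  interpret B: cstar_algebra B by fact
  show ?thesis
    by (rule cstar_homI) (simp_all add: B.add_zero B.scale_zero_right B.mult_zero_left B.star_zero)
qed

text \<open>
  For a self-adjoint \<open>a\<close> with \<open>\<parallel>a\<parallel> < 1\<close> the equation \<open>2 w = a\<^sup>2 + w\<^sup>2\<close> is solved in the domain.  A
  morphism preserves this equation, and therefore the image of \<open>a\<close> has norm at most \<open>1\<close>.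
  The general case follows by scaling and the C*-identity.
\<close>

theorem cstar_hom_contractive:
  assumes A: "cstar_algebra A" and B: "cstar_algebra B" and h: "cstar_hom A B h"
    and x: "x \<in> ccarrier A"
  shows "cnorm B (h x) \<le> cnorm A x"
proof -
  interpret A: cstar_algebra A by fact
  interpret B: cstar_algebra B by fact
  have unit: "cnorm B (h a) \<le> 1" if a: "a \<in> ccarrier A" "cstar A a = a" "cnorm A a < 1" for a
  proof -
    obtain w where w: "w \<in> ccarrier A" "cstar A w = w" "cmult A a w = cmult A w a"
      "cscale A 2 w = cadd A (cmult A a a) (cmult A w w)"
      using A.ex_self_adjoint_quasi_sqrt[OF a] by blast
    show ?thesis
    proof (rule B.norm_real_part_of_unitary_le)
      show "cstar B (h a) = h a" "cstar B (h w) = h w"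
        using a w cstar_homD(5)[OF h] by metis+
      show "cmult B (h a) (h w) = cmult B (h w) (h a)"
        using a w cstar_homD(4)[OF h] by metis
      show "cscale B 2 (h w) = cadd B (cmult B (h a) (h a)) (cmult B (h w) (h w))"
        using a w cstar_homD[OF h] A.mult_closed by metis
    qed (use a w cstar_homD[OF h] in auto)
  qed
  have sa: "cnorm B (h a) \<le> cnorm A a" if a: "a \<in> ccarrier A" "cstar A a = a" for a
  proof (rule field_le_epsilon)
    fix e :: real assume "0 < e"
    define t where "t = cnorm A a + e"
    have t: "0 < t" "cnorm A a < t" using \<open>0 < e\<close> A.norm_nonneg[OF a(1)] by (auto simp: t_def)
    have "cnorm B (h (cscale A (complex_of_real (inverse t)) a)) \<le> 1"
      using a t by (intro unit) (auto simp: A.star_scale A.norm_scale norm_inverse norm_divide field_simps)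
    then have "inverse t * cnorm B (h a) \<le> 1"
      using a t cstar_homD[OF h] by (simp add: B.norm_scale norm_inverse)
    then have "cnorm B (h a) \<le> t" using t by (simp add: field_simps)
    then show "cnorm B (h a) \<le> cnorm A a + e" by (simp add: t_def)
  qed
  have "(cnorm B (h x))\<^sup>2 = cnorm B (h (cmult A (cstar A x) x))"
    using x cstar_homD[OF h] by (simp add: B.norm_star_mult)
  also have "\<dots> \<le> cnorm A (cmult A (cstar A x) x)"
    using x by (intro sa) (auto simp: A.star_mult A.star_star)
  also have "\<dots> = (cnorm A x)\<^sup>2" using x by (rule A.norm_star_mult)
  finally show ?thesis using A.norm_nonneg[OF x] by (rule power2_le_imp_le)
qed

section \<open>Continuous maps into a C*-algebra\<close>

context cstar_algebra
begin

lemma continuous_map_ctopology: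
  "continuous_map X (ctopology A) f \<longleftrightarrow>
     f \<in> topspace X \<rightarrow> ccarrier A \<and>
     (\<forall>x\<in>topspace X. \<forall>e>0. \<exists>U. openin X U \<and> x \<in> U \<and> (\<forall>y\<in>U. cnorm A (cdiff A (f y) (f x)) < e))"
  (is "?L \<longleftrightarrow> ?R")
proof
  assume L: ?L
  then have f: "f \<in> topspace X \<rightarrow> ccarrier A" by (auto simp: continuous_map_def)
  show ?R
  proof (intro conjI ballI allI impI f)
    fix x e assume x: "x \<in> topspace X" and "0 < (e::real)"
    then obtain U where U: "openin X U" "x \<in> U" "\<forall>y\<in>U. f y \<in> metric.mball (f x) e"
      using L unfolding ctopology_def metric.continuous_map_to_metric by blast
    then have "\<forall>y\<in>U. cnorm A (cdiff A (f y) (f x)) < e"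
      by (auto simp: cdist_def norm_diff_swap)
    with U show "\<exists>U. openin X U \<and> x \<in> U \<and> (\<forall>y\<in>U. cnorm A (cdiff A (f y) (f x)) < e)" by blast
  qed
next
  assume R: ?R
  show ?L unfolding ctopology_def metric.continuous_map_to_metric
  proof (intro ballI allI impI)
    fix x e assume x: "x \<in> topspace X" and "0 < (e::real)"
    then obtain U where U: "openin X U" "x \<in> U" "\<forall>y\<in>U. cnorm A (cdiff A (f y) (f x)) < e"
      using R by blast
    have "f y \<in> metric.mball (f x) e" if y: "y \<in> U" for y
    proof -
      have "f y \<in> ccarrier A" "f x \<in> ccarrier A"
        using R x y openin_subset[OF U(1)] by blast+
      then show ?thesis using U(3) y norm_diff_swap[of "f y" "f x"] by (simp add: cdist_def)
    qed
    with U show "\<exists>U. openin X U \<and> x \<in> U \<and> (\<forall>y\<in>U. f y \<in> metric.mball (f x) e)" by blast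
  qed
qed

lemma continuous_map_in_carrier:
  "\<lbrakk>continuous_map X (ctopology A) f; x \<in> topspace X\<rbrakk> \<Longrightarrow> f x \<in> ccarrier A"
  by (auto simp: continuous_map_ctopology)

text \<open>
  With suitable \<open>\<delta>\<close>, continuity of an algebraic expression is reduced to continuity of real functions.
\<close>

lemma continuous_map_dominated:
  assumes f: "\<And>x. x \<in> topspace X \<Longrightarrow> f x \<in> ccarrier A"
    and \<delta>: "\<And>x. x \<in> topspace X \<Longrightarrow> continuous_map X euclideanreal (\<delta> x)"
    and z: "\<And>x. x \<in> topspace X \<Longrightarrow> \<delta> x x = 0"
    and le: "\<And>x y. \<lbrakk>x \<in> topspace X; y \<in> topspace X\<rbrakk> \<Longrightarrow> cnorm A (cdiff A (f y) (f x)) \<le> \<delta> x y"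
  shows "continuous_map X (ctopology A) f"
  unfolding continuous_map_ctopology
proof (intro conjI ballI allI impI)
  fix x e assume x: "x \<in> topspace X" and e: "0 < (e::real)"
  have "openin X {y \<in> topspace X. \<delta> x y \<in> {..<e}}"
    using \<delta>[OF x] by (rule openin_continuous_map_preimage) auto
  moreover have "x \<in> {y \<in> topspace X. \<delta> x y \<in> {..<e}}" using x z e by simp
  moreover have "\<forall>y\<in>{y \<in> topspace X. \<delta> x y \<in> {..<e}}. cnorm A (cdiff A (f y) (f x)) < e"
    using le[OF x] by fastforce
  ultimately show "\<exists>U. openin X U \<and> x \<in> U \<and> (\<forall>y\<in>U. cnorm A (cdiff A (f y) (f x)) < e)"
    by blast
qed (use f in auto)

lemma continuous_map_norm:
  assumes "continuous_map X (ctopology A) f"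
  shows "continuous_map X euclideanreal (\<lambda>x. cnorm A (f x))"
  unfolding Met_TC.continuous_map_to_metric[of X, simplified]
proof (intro ballI allI impI)
  fix x e assume x: "x \<in> topspace X" and e: "0 < (e::real)"
  then obtain U where U: "openin X U" "x \<in> U" "\<forall>y\<in>U. cnorm A (cdiff A (f y) (f x)) < e"
    using assms unfolding continuous_map_ctopology by meson
  have "\<bar>cnorm A (f x) - cnorm A (f y)\<bar> < e" if "y \<in> U" for y
  proof -
    have "f x \<in> ccarrier A" "f y \<in> ccarrier A"
      using that U(1) openin_subset x continuous_map_in_carrier[OF assms] by blast+
    then show ?thesis
      using norm_triangle_diff[of "f x" "f y"] norm_triangle_diff[of "f y" "f x"]
        norm_diff_swap[of "f x" "f y"] U(3) that by fastforce
  qed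
  then show "\<exists>U. openin X U \<and> x \<in> U \<and> (\<forall>y\<in>U. dist (cnorm A (f x)) (cnorm A (f y)) < e)"
    using U by (auto simp: dist_real_def)
qed

lemma continuous_map_cadd:
  assumes f: "continuous_map X (ctopology A) f" and g: "continuous_map X (ctopology A) g"
  shows "continuous_map X (ctopology A) (\<lambda>x. cadd A (f x) (g x))"
proof -
  note c = continuous_map_in_carrier[OF f] continuous_map_in_carrier[OF g]
  show ?thesis
    unfolding continuous_map_ctopology
  proof (intro conjI ballI allI impI)
    fix x e assume x: "x \<in> topspace X" and e: "0 < (e::real)"
    then obtain U V where U: "openin X U" "x \<in> U" "\<forall>y\<in>U. cnorm A (cdiff A (f y) (f x)) < e/2"
      and V: "openin X V" "x \<in> V" "\<forall>y\<in>V. cnorm A (cdiff A (g y) (g x)) < e/2"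
      using f g unfolding continuous_map_ctopology by (metis half_gt_zero)
    have "cnorm A (cdiff A (cadd A (f y) (g y)) (cadd A (f x) (g x))) < e" if y: "y \<in> U \<inter> V" for y
    proof -
      have y': "y \<in> topspace X" using y U openin_subset by blast
      have "cdiff A (cadd A (f y) (g y)) (cadd A (f x) (g x))
          = cadd A (cdiff A (f y) (f x)) (cdiff A (g y) (g x))"
        using c x y' by (simp add: scale_add_right add_ac)
      also have "cnorm A \<dots> \<le> cnorm A (cdiff A (f y) (f x)) + cnorm A (cdiff A (g y) (g x))"
        using c x y' by (intro norm_triangle) auto
      also have "\<dots> < e" using U V y by force
      finally show ?thesis .
    qed
    then show "\<exists>U. openin X U \<and> x \<in> U \<and>
        (\<forall>y\<in>U. cnorm A (cdiff A (cadd A (f y) (g y)) (cadd A (f x) (g x))) < e)"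
      using U V by (intro exI[of _ "U \<inter> V"]) auto
  qed (use c in auto)
qed

lemma continuous_map_contraction:
  assumes B: "cstar_algebra B" and f: "continuous_map X (ctopology B) f"
    and g: "\<And>x. x \<in> topspace X \<Longrightarrow> g x \<in> ccarrier A"
    and le: "\<And>x y. \<lbrakk>x \<in> topspace X; y \<in> topspace X\<rbrakk> \<Longrightarrow>
      cnorm A (cdiff A (g y) (g x)) \<le> cnorm B (cdiff B (f y) (f x))"
  shows "continuous_map X (ctopology A) g"
  unfolding continuous_map_ctopology
proof (intro conjI ballI allI impI)
  fix x e assume x: "x \<in> topspace X" and e: "0 < (e::real)"
  then obtain U where U: "openin X U" "x \<in> U" "\<forall>y\<in>U. cnorm B (cdiff B (f y) (f x)) < e"
    using f cstar_algebra.continuous_map_ctopology[OF B] by metis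
  then have "\<forall>y\<in>U. cnorm A (cdiff A (g y) (g x)) < e"
    using le x openin_subset[OF U(1)] by (meson le_less_trans subsetD)
  then show "\<exists>U. openin X U \<and> x \<in> U \<and> (\<forall>y\<in>U. cnorm A (cdiff A (g y) (g x)) < e)"
    using U by blast
qed (use g in auto)

lemma continuous_map_const_diff:
  assumes f: "continuous_map X (ctopology A) f" and a: "a \<in> ccarrier A"
  shows "continuous_map X (ctopology A) (\<lambda>x. cdiff A (f x) a)"
  using continuous_map_cadd[OF f, of "\<lambda>_. cscale A (-1) a"] a by simp

lemma continuous_map_dist_const:
  assumes f: "continuous_map X (ctopology A) f" and a: "a \<in> ccarrier A"
  shows "continuous_map X euclideanreal (\<lambda>x. cnorm A (cdiff A (f x) a))"
  by (intro continuous_map_norm continuous_map_const_diff assms)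

lemma continuous_map_cscale:
  assumes r: "continuous_map X (euclidean :: complex topology) r" and f: "continuous_map X (ctopology A) f"
  shows "continuous_map X (ctopology A) (\<lambda>x. cscale A (r x) (f x))"
proof -
  note c = continuous_map_in_carrier[OF f]
  define \<delta> where "\<delta> x y = cmod (r y) * cnorm A (cdiff A (f y) (f x)) + cmod (r y - r x) * cnorm A (f x)" for x y
  show ?thesis
  proof (rule continuous_map_dominated[of _ _ \<delta>])
    fix x assume x: "x \<in> topspace X"
    show "cscale A (r x) (f x) \<in> ccarrier A" using c x by simp
    show "continuous_map X euclideanreal (\<delta> x)" unfolding \<delta>_def
      by (intro continuous_intros continuous_map_dist_const[OF f] r c[OF x])
    show "\<delta> x x = 0" using c x by (simp add: \<delta>_def diff_self)
    fix y assume y: "y \<in> topspace X"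
    have "cdiff A (cscale A (r y) (f y)) (cscale A (r x) (f x))
        = cadd A (cscale A (r y) (cdiff A (f y) (f x))) (cscale A (r y - r x) (f x))"
    proof -
      have "cscale A (r y - r x) (f x) = cadd A (cscale A (r y) (f x)) (cscale A (- r x) (f x))"
        using c x scale_add_left[of "f x" "r y" "- r x"] by simp
      moreover have "cscale A (r y) (cdiff A (f y) (f x)) = cadd A (cscale A (r y) (f y)) (cscale A (-1) (cscale A (r y) (f x)))"
        using c x y by (simp add: scale_add_right scale_scale)
      ultimately show ?thesis
        using c x y diff_add_diff[of "cscale A (r y) (f y)" "cscale A (r y) (f x)" "cscale A (r x) (f x)"]
        by (simp add: scale_scale)
    qed
    then show "cnorm A (cdiff A (cscale A (r y) (f y)) (cscale A (r x) (f x))) \<le> \<delta> x y"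
      using c x y norm_triangle[of "cscale A (r y) (cdiff A (f y) (f x))" "cscale A (r y - r x) (f x)"]
      by (simp add: \<delta>_def norm_scale)
  qed
qed

lemma continuous_map_cstar:
  assumes f: "continuous_map X (ctopology A) f"
  shows "continuous_map X (ctopology A) (\<lambda>x. cstar A (f x))"
proof (rule continuous_map_contraction[OF cstar_algebra_axioms f])
  note c = continuous_map_in_carrier[OF f]
  show "cstar A (f x) \<in> ccarrier A" if "x \<in> topspace X" for x using c that by simp
  show "cnorm A (cdiff A (cstar A (f y)) (cstar A (f x))) \<le> cnorm A (cdiff A (f y) (f x))"
    if "x \<in> topspace X" "y \<in> topspace X" for x y
    using c that norm_star[of "cdiff A (f y) (f x)"] by (simp add: star_add star_scale)
qed

lemma continuous_map_cmult:
  assumes f: "continuous_map X (ctopology A) f" and g: "continuous_map X (ctopology A) g"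
  shows "continuous_map X (ctopology A) (\<lambda>x. cmult A (f x) (g x))"
proof -
  note c = continuous_map_in_carrier[OF f] continuous_map_in_carrier[OF g]
  define \<delta> where "\<delta> x y = cnorm A (cdiff A (f y) (f x)) * cnorm A (g y)
    + cnorm A (f x) * cnorm A (cdiff A (g y) (g x))" for x y
  show ?thesis
  proof (rule continuous_map_dominated[of _ _ \<delta>])
    fix x assume x: "x \<in> topspace X"
    show "cmult A (f x) (g x) \<in> ccarrier A" using c x by simp
    show "continuous_map X euclideanreal (\<delta> x)" unfolding \<delta>_def
      by (intro continuous_intros continuous_map_dist_const[OF f] continuous_map_dist_const[OF g]
          continuous_map_norm[OF g] c[OF x])
    show "\<delta> x x = 0" using c x by (simp add: \<delta>_def diff_self)
    fix y assume y: "y \<in> topspace X"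
    have "cdiff A (cmult A (f y) (g y)) (cmult A (f x) (g x))
        = cadd A (cmult A (cdiff A (f y) (f x)) (g y)) (cmult A (f x) (cdiff A (g y) (g x)))"
      using c x y diff_add_diff[of "cmult A (f y) (g y)" "cmult A (f x) (g y)" "cmult A (f x) (g x)"]
      by (simp add: mult_add_left mult_add_right scale_mult_left scale_mult_right)
    then show "cnorm A (cdiff A (cmult A (f y) (g y)) (cmult A (f x) (g x))) \<le> \<delta> x y"
      using c x y norm_triangle[of "cmult A (cdiff A (f y) (f x)) (g y)" "cmult A (f x) (cdiff A (g y) (g x))"]
        norm_mult[of "cdiff A (f y) (f x)" "g y"] norm_mult[of "f x" "cdiff A (g y) (g x)"]
      by (simp add: \<delta>_def)
  qed
qed

end

lemma cstar_hom_continuous_map: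
  assumes A: "cstar_algebra A" and B: "cstar_algebra B" and h: "cstar_hom A B h"
    and f: "continuous_map X (ctopology A) f"
  shows "continuous_map X (ctopology B) (\<lambda>x. h (f x))"
proof (rule cstar_algebra.continuous_map_contraction[OF B A f])
  note c = cstar_algebra.continuous_map_in_carrier[OF A f]
  show "h (f x) \<in> ccarrier B" if "x \<in> topspace X" for x using c that cstar_homD(1)[OF h] by blast
  show "cnorm B (cdiff B (h (f y)) (h (f x))) \<le> cnorm A (cdiff A (f y) (f x))"
    if "x \<in> topspace X" "y \<in> topspace X" for x y
    using c that cstar_hom_contractive[OF A B h, of "cdiff A (f y) (f x)"]
      cstar_algebra.closed[OF A] cstar_hom_diff[OF A h] by simp
qed

section \<open>Algebras of continuous functions\<close>

lemma C_alg_simps: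
  "ccarrier (C_alg X F) = {f \<in> extensional (topspace X). continuous_map X (ctopology F) f}"
  "czero (C_alg X F) = (\<lambda>t\<in>topspace X. czero F)"
  "cadd (C_alg X F) f g = (\<lambda>t\<in>topspace X. cadd F (f t) (g t))"
  "cscale (C_alg X F) c f = (\<lambda>t\<in>topspace X. cscale F c (f t))"
  "cmult (C_alg X F) f g = (\<lambda>t\<in>topspace X. cmult F (f t) (g t))"
  "cstar (C_alg X F) f = (\<lambda>t\<in>topspace X. cstar F (f t))"
  "cnorm (C_alg X F) f = Sup (insert 0 ((\<lambda>t. cnorm F (f t)) ` topspace X))"
  by (simp_all add: C_alg_def)

lemma C_alg_cdiff: "t \<in> topspace X \<Longrightarrow> cdiff (C_alg X F) f g t = cdiff F (f t) (g t)"
  by (simp add: C_alg_simps)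

locale function_algebra = F: cstar_algebra F for F :: "'a cstar_alg" +
  fixes X :: "'x topology"
  assumes compact: "compact_space X"
begin

abbreviation C where "C \<equiv> C_alg X F"

lemma C_mem: "f \<in> ccarrier C \<Longrightarrow> t \<in> topspace X \<Longrightarrow> f t \<in> ccarrier F"
  by (auto simp: C_alg_simps F.continuous_map_in_carrier)

lemma C_eqI: "\<lbrakk>f \<in> ccarrier C; g \<in> ccarrier C; \<And>t. t \<in> topspace X \<Longrightarrow> f t = g t\<rbrakk> \<Longrightarrow> f = g"
  by (auto simp: C_alg_simps intro: extensionalityI)

lemma C_bdd:
  assumes "f \<in> ccarrier C"
  shows "bdd_above (insert 0 ((\<lambda>t. cnorm F (f t)) ` topspace X))"
proof -
  have "compactin euclideanreal ((\<lambda>t. cnorm F (f t)) ` topspace X)"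
    using assms compact by (intro image_compactin[of X] F.continuous_map_norm) (auto simp: C_alg_simps compact_space_def)
  then show ?thesis
    by (simp add: compact_imp_bounded bounded_imp_bdd_above)
qed

lemma C_norm_upper:
  assumes "f \<in> ccarrier C" "t \<in> topspace X"
  shows "cnorm F (f t) \<le> cnorm C f"
  unfolding C_alg_simps using assms by (intro cSup_upper C_bdd) auto

lemma C_norm_nonneg:
  assumes "f \<in> ccarrier C"
  shows "0 \<le> cnorm C f"
  unfolding C_alg_simps using assms by (intro cSup_upper C_bdd) auto

lemma C_norm_least:
  assumes "0 \<le> c" "\<And>t. t \<in> topspace X \<Longrightarrow> cnorm F (f t) \<le> c"
  shows "cnorm C f \<le> c"
  unfolding C_alg_simps using assms by (intro cSup_least) auto

lemma C_closed:
  shows "czero C \<in> ccarrier C"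
    and "\<lbrakk>f \<in> ccarrier C; g \<in> ccarrier C\<rbrakk> \<Longrightarrow> cadd C f g \<in> ccarrier C"
    and "f \<in> ccarrier C \<Longrightarrow> cscale C c f \<in> ccarrier C"
    and "\<lbrakk>f \<in> ccarrier C; g \<in> ccarrier C\<rbrakk> \<Longrightarrow> cmult C f g \<in> ccarrier C"
    and "f \<in> ccarrier C \<Longrightarrow> cstar C f \<in> ccarrier C"
  by (auto simp: C_alg_simps F.continuous_map_cadd F.continuous_map_cmult F.continuous_map_cstar
      intro!: F.continuous_map_cscale)

lemma C_norm_scale: "f \<in> ccarrier C \<Longrightarrow> cnorm C (cscale C c f) = cmod c * cnorm C f"
proof -
  have le: "cnorm C (cscale C c f) \<le> cmod c * cnorm C f" if f: "f \<in> ccarrier C" for c f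
  proof (rule C_norm_least)
    show "0 \<le> cmod c * cnorm C f" using C_norm_nonneg[OF f] by simp
    show "cnorm F (cscale C c f t) \<le> cmod c * cnorm C f" if t: "t \<in> topspace X" for t
      using t C_mem[OF f t] C_norm_upper[OF f t]
      by (simp add: C_alg_simps(1-6) F.norm_scale mult_left_mono)
  qed
  assume f: "f \<in> ccarrier C"
  show ?thesis
  proof (cases "c = 0")
    case True
    then show ?thesis using le[OF f, of 0] C_norm_nonneg[OF C_closed(3)[OF f, of 0]] by simp
  next
    case False
    have "cscale C (inverse c) (cscale C c f) = f"
      using f False by (intro C_eqI C_closed) (auto simp: C_alg_simps(1-6) F.scale_scale F.scale_one C_mem F.continuous_map_in_carrier)
    then have "cnorm C f \<le> cmod (inverse c) * cnorm C (cscale C c f)"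
      using le[OF C_closed(3)[OF f, of c], of "inverse c"] by simp
    then show ?thesis using le[OF f, of c] False
      by (simp add: norm_inverse norm_divide field_simps)
  qed
qed

lemma mcomplete_C_alg:
  assumes M: "Metric_space (ccarrier C) (cdist C)"
  shows "Metric_space.mcomplete (ccarrier C) (cdist C)"
proof -
  interpret M: Metric_space "ccarrier C" "cdist C" by fact
  show ?thesis
    unfolding M.mcomplete_def
  proof (intro allI impI)
    fix \<sigma> assume cau: "M.MCauchy \<sigma>"
    then have \<sigma>: "\<sigma> n \<in> ccarrier C" for n by (auto simp: M.MCauchy_def)
    then have cont: "continuous_map X (ctopology F) (\<sigma> n)" for n by (auto simp: C_alg_simps)
    have pt: "cdist F (\<sigma> i x) (\<sigma> j x) \<le> cdist C (\<sigma> i) (\<sigma> j)" if "x \<in> topspace X" for i j x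
      using that \<sigma> C_mem[OF \<sigma> that] C_closed
        C_norm_upper[of "cdiff C (\<sigma> i) (\<sigma> j)" x] by (simp add: cdist_def C_alg_cdiff)
    have unif: "\<exists>N. \<forall>m n x. N \<le> m \<longrightarrow> N \<le> n \<longrightarrow> x \<in> topspace X \<longrightarrow> cdist F (\<sigma> m x) (\<sigma> n x) < e"
      if "0 < e" for e
      using cau that pt unfolding M.MCauchy_def by (meson le_less_trans)
    obtain g where g: "continuous_map X F.metric.mtopology g"
      and conv: "\<And>e. 0 < e \<Longrightarrow> \<forall>\<^sub>F n in sequentially. \<forall>x\<in>topspace X. cdist F (\<sigma> n x) (g x) < e"
      using F.metric.continuous_map_uniformly_Cauchy_limit[OF F.complete, of X \<sigma>] cont unif
      unfolding ctopology_def by (auto simp: eventually_sequentially)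
    define f where "f = restrict g (topspace X)"
    have f: "f \<in> ccarrier C" using g by (auto simp: f_def C_alg_simps ctopology_def)
    have "limitin M.mtopology \<sigma> f sequentially"
      unfolding M.limitin_metric
    proof (intro conjI allI impI f)
      fix e :: real assume "0 < e"
      then have "0 < e/2" by simp
      from conv[OF this]
      show "\<forall>\<^sub>F n in sequentially. \<sigma> n \<in> ccarrier C \<and> cdist C (\<sigma> n) f < e"
      proof (rule eventually_mono)
        fix n assume n: "\<forall>x\<in>topspace X. cdist F (\<sigma> n x) (g x) < e/2"
        have "cnorm C (cdiff C (\<sigma> n) f) \<le> e/2"
        proof (rule C_norm_least)
          fix t assume t: "t \<in> topspace X"
          have "f t \<in> ccarrier F" "\<sigma> n t \<in> ccarrier F" using C_mem[OF _ t] f \<sigma> by auto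
          then show "cnorm F (cdiff C (\<sigma> n) f t) \<le> e/2"
            using n t by (force simp: C_alg_cdiff cdist_def f_def split: if_splits)
        qed (use \<open>0 < e\<close> in simp)
        then show "\<sigma> n \<in> ccarrier C \<and> cdist C (\<sigma> n) f < e"
          using \<sigma> f \<open>0 < e\<close> by (simp add: cdist_def)
      qed
    qed
    then show "\<exists>x. limitin M.mtopology \<sigma> x sequentially" by blast
  qed
qed

theorem cstar_algebra_C_alg: "cstar_algebra C"
proof -
  have tri: "cnorm C (cadd C f g) \<le> cnorm C f + cnorm C g"
    if fg: "f \<in> ccarrier C" "g \<in> ccarrier C" for f g
  proof (rule C_norm_least)
    show "0 \<le> cnorm C f + cnorm C g" using fg C_norm_nonneg by simp
    show "cnorm F (cadd C f g t) \<le> cnorm C f + cnorm C g" if t: "t \<in> topspace X" for t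
      using F.norm_triangle[OF C_mem[OF fg(1) t] C_mem[OF fg(2) t]]
        C_norm_upper[OF fg(1) t] C_norm_upper[OF fg(2) t] t by (simp add: C_alg_simps(3))
  qed
  have mul: "cnorm C (cmult C f g) \<le> cnorm C f * cnorm C g"
    if "f \<in> ccarrier C" "g \<in> ccarrier C" for f g
  proof (rule C_norm_least)
    show "0 \<le> cnorm C f * cnorm C g" using that C_norm_nonneg by simp
    show "cnorm F (cmult C f g t) \<le> cnorm C f * cnorm C g" if t: "t \<in> topspace X" for t
    proof -
      have m: "f t \<in> ccarrier F" "g t \<in> ccarrier F"
        using C_mem[OF _ t] \<open>f \<in> ccarrier C\<close> \<open>g \<in> ccarrier C\<close> by auto
      have "cnorm F (cmult C f g t) \<le> cnorm F (f t) * cnorm F (g t)"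
        using F.norm_mult m t by (simp add: C_alg_simps(5))
      also have "\<dots> \<le> cnorm C f * cnorm C g"
        using C_norm_upper[OF _ t] C_norm_nonneg F.norm_nonneg m
          \<open>f \<in> ccarrier C\<close> \<open>g \<in> ccarrier C\<close> by (intro mult_mono) auto
      finally show ?thesis .
    qed
  qed
  have zero: "cnorm C f = 0 \<longleftrightarrow> f = czero C" if f: "f \<in> ccarrier C" for f
  proof
    assume 0: "cnorm C f = 0"
    show "f = czero C"
    proof (rule C_eqI[OF f C_closed(1)])
      fix t assume t: "t \<in> topspace X"
      have "cnorm F (f t) = 0"
        using C_norm_upper[OF f t] F.norm_nonneg[OF C_mem[OF f t]] 0 by simp
      then show "f t = czero C t"
        using F.norm_eq_zero[OF C_mem[OF f t]] t by (simp add: C_alg_simps(2))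
    qed
  next
    assume "f = czero C"
    then have "cnorm C f \<le> 0" by (intro C_norm_least) (auto simp: C_alg_simps(2))
    then show "cnorm C f = 0" using C_norm_nonneg[OF f] by simp
  qed
  have square: "cnorm C (cmult C (cstar C f) f) = (cnorm C f)\<^sup>2" if f: "f \<in> ccarrier C" for f
  proof (rule antisym)
    have pt: "cnorm F (cmult C (cstar C f) f t) = (cnorm F (f t))\<^sup>2" if "t \<in> topspace X" for t
      using that F.norm_star_mult[OF C_mem[OF f that]] by (simp add: C_alg_simps(5,6))
    show "cnorm C (cmult C (cstar C f) f) \<le> (cnorm C f)\<^sup>2"
      by (rule C_norm_least)
         (use C_norm_upper[OF f] F.norm_nonneg C_mem[OF f] in \<open>auto simp: pt intro: power_mono\<close>)
    let ?s = "cnorm C (cmult C (cstar C f) f)"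
    have s: "0 \<le> ?s" by (intro C_norm_nonneg C_closed f)
    have "cnorm C f \<le> sqrt ?s"
    proof (rule C_norm_least)
      fix t assume t: "t \<in> topspace X"
      have "(cnorm F (f t))\<^sup>2 \<le> ?s"
        unfolding pt[OF t, symmetric] by (intro C_norm_upper C_closed f t)
      then show "cnorm F (f t) \<le> sqrt ?s" by (rule real_le_rsqrt)
    qed (use s in simp)
    then have "(cnorm C f)\<^sup>2 \<le> (sqrt ?s)\<^sup>2"
      using C_norm_nonneg[OF f] by (intro power_mono)
    then show "(cnorm C f)\<^sup>2 \<le> ?s" using s by simp
  qed
  note S = C_alg_simps(2-6)
  have "Metric_space (ccarrier C) (cdist C)"
  proof
    have diff: "cdiff C f g \<in> ccarrier C" if "f \<in> ccarrier C" "g \<in> ccarrier C" for f g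
      using that C_closed by blast
    show "0 \<le> cdist C f g" for f g
      using diff C_norm_nonneg by (simp add: cdist_def)
    have "cnorm C (cdiff C g f) = cnorm C (cdiff C f g)"
      if fg: "f \<in> ccarrier C" "g \<in> ccarrier C" for f g
    proof -
      have "cdiff C g f = cscale C (-1) (cdiff C f g)"
        using fg by (intro C_eqI C_closed) (auto simp: S C_mem F.diff_swap[symmetric])
      then show ?thesis using C_norm_scale[OF diff[OF fg], of "-1"] by simp
    qed
    then show "cdist C f g = cdist C g f" for f g
      by (simp add: cdist_def)
    show "cdist C f g = 0 \<longleftrightarrow> f = g" if fg: "f \<in> ccarrier C" "g \<in> ccarrier C" for f g
    proof -
      have "cdiff C f g = czero C \<longleftrightarrow> (\<forall>t\<in>topspace X. cdiff C f g t = czero C t)"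
        using C_eqI[OF diff[OF fg] C_closed(1)] by metis
      also have "\<dots> \<longleftrightarrow> (\<forall>t\<in>topspace X. f t = g t)"
        by (intro ball_cong refl) (simp add: C_alg_cdiff S(1) F.diff_eq_zero_iff C_mem fg)
      also have "\<dots> \<longleftrightarrow> f = g" using C_eqI[OF fg] by metis
      finally show ?thesis using fg zero[OF diff[OF fg]] by (simp add: cdist_def)
    qed
    show "cdist C f h \<le> cdist C f g + cdist C g h"
      if fgh: "f \<in> ccarrier C" "g \<in> ccarrier C" "h \<in> ccarrier C" for f g h
    proof -
      have "cadd C (cdiff C f g) (cdiff C g h) = cdiff C f h"
        using fgh by (intro C_eqI C_closed) (auto simp: S C_mem F.diff_add_diff)
      then show ?thesis
        using tri[of "cdiff C f g" "cdiff C g h"] diff fgh by (simp add: cdist_def)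
    qed
  qed
  from mcomplete_C_alg[OF this] have complete: "Metric_space.mcomplete (ccarrier C) (cdist C)" .
  show ?thesis
    by unfold_locales
      (simp_all add: C_closed C_norm_nonneg zero tri C_norm_scale mul square complete,
       (intro C_eqI C_closed; simp add: S C_mem F.add_ac F.add_zero_right F.add_inverse F.scale_one
         F.scale_scale F.scale_add_left F.scale_add_right F.mult_assoc F.mult_add_left
         F.mult_add_right F.scale_mult_left F.scale_mult_right F.star_star F.star_add F.star_scale
         F.star_mult)+)
qed

end

text \<open>
  The estimate is \<open>\<parallel>g z' x' - g z x\<parallel> \<le> \<parallel>g z' - g z\<parallel> + \<parallel>g z x' - g z x\<parallel>\<close>.
\<close>

lemma continuous_map_uncurry:
  assumes F: "cstar_algebra F" and X: "compact_space X"
    and g: "continuous_map Z (ctopology (C_alg X F)) g"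
  shows "continuous_map (prod_topology Z X) (ctopology F) (\<lambda>(z, x). g z x)"
proof -
  interpret function_algebra F X by (intro function_algebra.intro function_algebra_axioms.intro F X)
  interpret C: cstar_algebra "C_alg X F" by (rule cstar_algebra_C_alg)
  note gC = C.continuous_map_in_carrier[OF g]
  define \<delta> where "\<delta> p0 p = cnorm C (cdiff C (g (fst p)) (g (fst p0))) + cnorm F (cdiff F (g (fst p0) (snd p)) (g (fst p0) (snd p0)))"
    for p0 p
  show ?thesis
  proof (rule F.continuous_map_dominated[of _ _ \<delta>])
    fix p assume "p \<in> topspace (prod_topology Z X)"
    then obtain z x where p: "p = (z, x)" "z \<in> topspace Z" "x \<in> topspace X" by auto
    show "(case p of (z, x) \<Rightarrow> g z x) \<in> ccarrier F" using p gC C_mem by simp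
    have gz: "continuous_map X (ctopology F) (g z)" using gC[OF p(2)] by (simp add: C_alg_simps)
    show "continuous_map (prod_topology Z X) euclideanreal (\<delta> p)"
      unfolding \<delta>_def p fst_conv snd_conv
      using continuous_map_compose[OF continuous_map_fst C.continuous_map_dist_const[OF g gC[OF p(2)]]]
        continuous_map_compose[OF continuous_map_snd F.continuous_map_dist_const[OF gz C_mem[OF gC[OF p(2)] p(3)]]]
      by (intro continuous_map_add) (auto simp: o_def)
    show "\<delta> p p = 0" using p gC C_mem by (simp add: \<delta>_def C.diff_self F.diff_self)
    fix q assume "q \<in> topspace (prod_topology Z X)"
    then obtain z' x' where q: "q = (z', x')" "z' \<in> topspace Z" "x' \<in> topspace X" by auto
    have "cnorm F (cdiff F (g z' x') (g z x)) \<le> cnorm F (cdiff F (g z' x') (g z x')) + cnorm F (cdiff F (g z x') (g z x))"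
      using p q gC C_mem by (intro F.norm_diff_triangle) auto
    also have "cnorm F (cdiff F (g z' x') (g z x')) \<le> cnorm C (cdiff C (g z') (g z))"
      using C_norm_upper[of "cdiff C (g z') (g z)" x'] gC p q by (simp add: C_alg_cdiff)
    finally show "cnorm F (cdiff F (case q of (z, x) \<Rightarrow> g z x) (case p of (z, x) \<Rightarrow> g z x)) \<le> \<delta> p q"
      using p q by (simp add: \<delta>_def)
  qed
qed

text \<open>
  By compactness of \<open>X\<close> and the tube lemma, \<open>h (z, x)\<close> is close to \<open>h (z\<^sub>0, x)\<close> uniformly in \<open>x\<close>.
\<close>

lemma continuous_map_curry:
  assumes F: "cstar_algebra F" and X: "compact_space X"
    and h: "continuous_map (prod_topology Z X) (ctopology F) h"
  shows "continuous_map Z (ctopology (C_alg X F)) (\<lambda>z. \<lambda>x\<in>topspace X. h (z, x))"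
proof -
  interpret function_algebra F X by (intro function_algebra.intro function_algebra_axioms.intro F X)
  interpret C: cstar_algebra "C_alg X F" by (rule cstar_algebra_C_alg)
  let ?g = "\<lambda>z. \<lambda>x\<in>topspace X. h (z, x)"
  have hF: "h (z, x) \<in> ccarrier F" if "z \<in> topspace Z" "x \<in> topspace X" for z x
    using F.continuous_map_in_carrier[OF h] that by simp
  have slice: "continuous_map Y (ctopology F) (\<lambda>y. h (z, u y))"
    if "z \<in> topspace Z" "continuous_map Y X u" for z u and Y :: "'d topology"
  proof -
    have "continuous_map Y (prod_topology Z X) (\<lambda>y. (z, u y))"
      using that by (intro continuous_map_pairedI) auto
    from continuous_map_compose[OF this h] show ?thesis by (simp add: o_def)
  qed
  have gC: "?g z \<in> ccarrier C" if "z \<in> topspace Z" for z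
    using slice[OF that, of X id] by (auto simp: C_alg_simps)
  show ?thesis
    unfolding C.continuous_map_ctopology
  proof (intro conjI ballI allI impI)
    fix z0 and e :: real assume z0: "z0 \<in> topspace Z" and e: "0 < e"
    let ?n = "\<lambda>p. cnorm F (cdiff F (h p) (h (z0, snd p)))"
    have "continuous_map (prod_topology Z X) (ctopology F) (\<lambda>p. h (z0, snd p))"
      using slice[OF z0 continuous_map_snd] .
    then have "continuous_map (prod_topology Z X) (ctopology F) (\<lambda>p. cscale F (-1) (h (z0, snd p)))"
      by (intro F.continuous_map_cscale) auto
    then have "continuous_map (prod_topology Z X) euclideanreal ?n"
      using h by (intro F.continuous_map_norm F.continuous_map_cadd)
    then have W: "openin (prod_topology Z X) {p \<in> topspace (prod_topology Z X). ?n p \<in> {..<e/2}}"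
      (is "openin _ ?W") by (rule openin_continuous_map_preimage) auto
    have sub: "{z0} \<times> topspace X \<subseteq> ?W"
      using z0 hF e by (auto simp: F.diff_self)
    obtain U V where U: "openin Z U" "z0 \<in> U" "topspace X \<subseteq> V" and UV: "U \<times> V \<subseteq> ?W"
      using tube_lemma_right[OF W X[unfolded compact_space_def] z0 sub] by (elim exE conjE) (rule that)
    have "cnorm C (cdiff C (?g z) (?g z0)) < e" if z: "z \<in> U" for z
    proof -
      have "cnorm C (cdiff C (?g z) (?g z0)) \<le> e/2"
      proof (rule C_norm_least)
        fix t assume t: "t \<in> topspace X"
        then have "(z, t) \<in> U \<times> V" using z U by auto
        then have "?n (z, t) < e/2" using UV by blast
        then show "cnorm F (cdiff C (?g z) (?g z0) t) \<le> e/2" using t by (simp add: C_alg_cdiff)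
      qed (use e in simp)
      then show ?thesis using e by simp
    qed
    then show "\<exists>U. openin Z U \<and> z0 \<in> U \<and> (\<forall>z\<in>U. cnorm C (cdiff C (?g z) (?g z0)) < e)"
      using U by blast
  qed (use gC in auto)
qed

lemma function_algebraI: "cstar_algebra F \<Longrightarrow> compact_space X \<Longrightarrow> function_algebra F X"
  by (intro function_algebra.intro function_algebra_axioms.intro)

lemmas cstar_algebra_C_algI = function_algebra.cstar_algebra_C_alg[OF function_algebraI]

lemma cstar_hom_eval: "t \<in> topspace X \<Longrightarrow> cstar_algebra F \<Longrightarrow> cstar_hom (C_alg X F) F (\<lambda>f. f t)"
  by (rule cstar_homI) (auto simp: C_alg_simps cstar_algebra.continuous_map_in_carrier)

lemma cstar_hom_into_C_alg:
  assumes h: "\<And>a. a \<in> ccarrier A \<Longrightarrow> (\<lambda>t\<in>topspace X. h a t) \<in> ccarrier (C_alg X F)"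
    and t: "\<And>t. t \<in> topspace X \<Longrightarrow> cstar_hom A F (\<lambda>a. h a t)"
  shows "cstar_hom A (C_alg X F) (\<lambda>a. \<lambda>t\<in>topspace X. h a t)"
  by (rule cstar_homI) (use h cstar_homD[OF t] in \<open>auto simp: C_alg_simps(2-6)\<close>)

lemma cstar_hom_restrict:
  assumes "cstar_algebra F" "S \<subseteq> topspace X"
  shows "cstar_hom (C_alg X F) (C_alg (subtopology X S) F) (\<lambda>f. restrict f S)"
proof -
  have eq: "topspace X \<inter> S = S" using assms by auto
  have "cstar_hom (C_alg X F) (C_alg (subtopology X S) F) (\<lambda>f. \<lambda>t\<in>topspace (subtopology X S). f t)"
  proof (rule cstar_hom_into_C_alg)
    show "(\<lambda>t\<in>topspace (subtopology X S). f t) \<in> ccarrier (C_alg (subtopology X S) F)"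
      if "f \<in> ccarrier (C_alg X F)" for f
    proof -
      have "continuous_map (subtopology X S) (ctopology F) f"
        using that by (auto simp: C_alg_simps continuous_map_from_subtopology)
      then show ?thesis by (simp add: C_alg_simps)
    qed
    show "cstar_hom (C_alg X F) F (\<lambda>f. f t)" if "t \<in> topspace (subtopology X S)" for t
      using that cstar_hom_eval[of t X F] assms by simp
  qed
  then show ?thesis by (simp add: eq)
qed

section \<open>Pullbacks and transport of structure\<close>

lemma pullback_simps:
  "ccarrier (pullback A B p q) = {x. fst x \<in> ccarrier A \<and> snd x \<in> ccarrier B \<and> p (fst x) = q (snd x)}"
  "czero (pullback A B p q) = (czero A, czero B)"
  "cadd (pullback A B p q) x y = (cadd A (fst x) (fst y), cadd B (snd x) (snd y))"
  "cscale (pullback A B p q) c x = (cscale A c (fst x), cscale B c (snd x))"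
  "cmult (pullback A B p q) x y = (cmult A (fst x) (fst y), cmult B (snd x) (snd y))"
  "cstar (pullback A B p q) x = (cstar A (fst x), cstar B (snd x))"
  "cnorm (pullback A B p q) x = max (cnorm A (fst x)) (cnorm B (snd x))"
  by (auto simp: pullback_def case_prod_beta)

text \<open>
  Completeness is the point: \<open>p\<close> and \<open>q\<close> are continuous by \<open>cstar_hom_contractive\<close>, so the
  equation \<open>p x = q y\<close> passes to limits.
\<close>

lemma cstar_algebra_pullback:
  assumes A: "cstar_algebra A" and B: "cstar_algebra B" and D: "cstar_algebra D"
    and p: "cstar_hom A D p" and q: "cstar_hom B D q"
  shows "cstar_algebra (pullback A B p q)"
proof -
  interpret A: cstar_algebra A by fact
  interpret B: cstar_algebra B by fact
  interpret D: cstar_algebra D by fact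
  let ?P = "pullback A B p q"
  note ph = cstar_homD[OF p] cstar_hom_zero[OF A D p] and qh = cstar_homD[OF q] cstar_hom_zero[OF B D q]
  have dist: "cdist ?P x y = max (cdist A (fst x) (fst y)) (cdist B (snd x) (snd y))"
    if "x \<in> ccarrier ?P" "y \<in> ccarrier ?P" for x y
    using that by (simp add: cdist_def pullback_simps ph qh)
  have dist0: "cdist ?P x y = 0" if "x \<notin> ccarrier ?P \<or> y \<notin> ccarrier ?P" for x y
    using that by (auto simp: cdist_def)
  interpret P: Metric_space "ccarrier ?P" "cdist ?P"
  proof
    show "0 \<le> cdist ?P x y" for x y
      by (cases "x \<in> ccarrier ?P \<and> y \<in> ccarrier ?P") (auto simp: dist dist0 le_max_iff_disj)
    show "cdist ?P x y = cdist ?P y x" for x y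
      using A.metric.commute B.metric.commute
      by (cases "x \<in> ccarrier ?P \<and> y \<in> ccarrier ?P") (auto simp: dist dist0)
    show "cdist ?P x y = 0 \<longleftrightarrow> x = y" if "x \<in> ccarrier ?P" "y \<in> ccarrier ?P" for x y
    proof -
      have "fst x \<in> ccarrier A" "fst y \<in> ccarrier A" "snd x \<in> ccarrier B" "snd y \<in> ccarrier B"
        using that by (auto simp: pullback_simps)
      then have "max (cdist A (fst x) (fst y)) (cdist B (snd x) (snd y)) = 0 \<longleftrightarrow> fst x = fst y \<and> snd x = snd y"
        using A.metric.nonneg[of "fst x" "fst y"] B.metric.nonneg[of "snd x" "snd y"]
          A.metric.zero[of "fst x" "fst y"] B.metric.zero[of "snd x" "snd y"]
        by (smt (verit))
      then show ?thesis using dist[OF that] by (simp add: prod_eq_iff)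
    qed
    show "cdist ?P x z \<le> cdist ?P x y + cdist ?P y z"
      if "x \<in> ccarrier ?P" "y \<in> ccarrier ?P" "z \<in> ccarrier ?P" for x y z
      using that A.metric.triangle[of "fst x" "fst y" "fst z"] B.metric.triangle[of "snd x" "snd y" "snd z"]
      by (simp add: dist pullback_simps(1)) (intro conjI; linarith)
  qed
  have complete: "P.mcomplete"
    unfolding P.mcomplete_def
  proof (intro allI impI)
    fix \<sigma> assume cau: "P.MCauchy \<sigma>"
    then have \<sigma>: "\<sigma> n \<in> ccarrier ?P" for n by (auto simp: P.MCauchy_def)
    have "A.metric.MCauchy (fst \<circ> \<sigma>)" "B.metric.MCauchy (snd \<circ> \<sigma>)"
      using cau \<sigma> unfolding P.MCauchy_def A.metric.MCauchy_def B.metric.MCauchy_def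
      by (auto simp: dist pullback_simps(1)) (metis max_less_iff_conj)+
    then obtain a b where a: "limitin (ctopology A) (fst \<circ> \<sigma>) a sequentially"
      and b: "limitin (ctopology B) (snd \<circ> \<sigma>) b sequentially"
      using A.complete B.complete unfolding A.metric.mcomplete_def B.metric.mcomplete_def ctopology_def by blast
    have "limitin (ctopology D) (p \<circ> (fst \<circ> \<sigma>)) (p a) sequentially"
      by (rule continuous_map_limit[OF _ a]) (use cstar_hom_continuous_map[OF A D p, of _ id] in auto)
    moreover have "limitin (ctopology D) (q \<circ> (snd \<circ> \<sigma>)) (q b) sequentially"
      by (rule continuous_map_limit[OF _ b]) (use cstar_hom_continuous_map[OF B D q, of _ id] in auto)
    moreover have "p \<circ> (fst \<circ> \<sigma>) = q \<circ> (snd \<circ> \<sigma>)"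
      using \<sigma> by (auto simp: pullback_simps(1))
    ultimately have "p a = q b"
      using D.metric.limitin_metric_unique[of _ "p a" sequentially "q b"] by (simp add: ctopology_def)
    moreover have ab: "a \<in> ccarrier A" "b \<in> ccarrier B"
      using limitin_topspace[OF a] limitin_topspace[OF b] by auto
    ultimately have abP: "(a, b) \<in> ccarrier ?P" by (simp add: pullback_simps(1))
    have "limitin P.mtopology \<sigma> (a, b) sequentially"
      unfolding P.limitin_metric
    proof (intro conjI allI impI abP)
      fix e :: real assume "0 < e"
      have "\<forall>\<^sub>F n in sequentially. (fst \<circ> \<sigma>) n \<in> ccarrier A \<and> cdist A ((fst \<circ> \<sigma>) n) a < e"
        using a \<open>0 < e\<close> unfolding ctopology_def A.metric.limitin_metric by blast
      moreover have "\<forall>\<^sub>F n in sequentially. (snd \<circ> \<sigma>) n \<in> ccarrier B \<and> cdist B ((snd \<circ> \<sigma>) n) b < e"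
        using b \<open>0 < e\<close> unfolding ctopology_def B.metric.limitin_metric by blast
      ultimately have "\<forall>\<^sub>F n in sequentially. cdist A ((fst \<circ> \<sigma>) n) a < e \<and> cdist B ((snd \<circ> \<sigma>) n) b < e"
        by eventually_elim simp
      then show "\<forall>\<^sub>F n in sequentially. \<sigma> n \<in> ccarrier ?P \<and> cdist ?P (\<sigma> n) (a, b) < e"
        by (rule eventually_mono) (use \<sigma> abP in \<open>simp add: dist\<close>)
    qed
    then show "\<exists>x. limitin P.mtopology \<sigma> x sequentially" by blast
  qed
  have nn: "0 \<le> cnorm A a" "0 \<le> cnorm B b" if "a \<in> ccarrier A" "b \<in> ccarrier B" for a b
    using that A.norm_nonneg B.norm_nonneg by auto
  show ?thesis
  proof (unfold_locales, goal_cases)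
    case (24 x)
    then have "0 \<le> cnorm A (fst x)" "0 \<le> cnorm B (snd x)" "fst x \<in> ccarrier A" "snd x \<in> ccarrier B"
      by (auto simp: nn pullback_simps)
    then have "max (cnorm A (fst x)) (cnorm B (snd x)) = 0 \<longleftrightarrow> fst x = czero A \<and> snd x = czero B"
      using A.norm_eq_zero[of "fst x"] B.norm_eq_zero[of "snd x"] by (smt (verit))
    then show ?case by (simp add: pullback_simps prod_eq_iff)
  next
    case (25 x y)
    then show ?case using A.norm_triangle[of "fst x" "fst y"] B.norm_triangle[of "snd x" "snd y"]
      by (simp add: pullback_simps) (intro conjI; linarith)
  next
    case (26 x c)
    then show ?case by (simp add: pullback_simps A.norm_scale B.norm_scale max_mult_distrib_left)
  next
    case (27 x y)
    then have c: "fst x \<in> ccarrier A" "fst y \<in> ccarrier A" "snd x \<in> ccarrier B" "snd y \<in> ccarrier B"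
      by (auto simp: pullback_simps)
    have "cnorm A (fst x) * cnorm A (fst y) \<le> cnorm ?P x * cnorm ?P y"
      using c by (intro mult_mono) (auto simp: pullback_simps nn le_max_iff_disj)
    moreover have "cnorm B (snd x) * cnorm B (snd y) \<le> cnorm ?P x * cnorm ?P y"
      using c by (intro mult_mono) (auto simp: pullback_simps nn le_max_iff_disj)
    ultimately show ?case using A.norm_mult[OF c(1,2)] B.norm_mult[OF c(3,4)]
      by (simp add: pullback_simps(5,7))
  next
    case (28 x)
    then have c: "fst x \<in> ccarrier A" "snd x \<in> ccarrier B" by (auto simp: pullback_simps)
    have "max (a\<^sup>2) (b\<^sup>2) = (max a b)\<^sup>2" if "0 \<le> a" "0 \<le> b" for a b :: real
      using that by (auto simp: max_def power_mono dest: power2_le_imp_le)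
    then show ?case using c by (simp add: pullback_simps A.norm_star_mult B.norm_star_mult nn)
  qed (auto simp: pullback_simps ph qh A.add_assoc B.add_assoc A.add_zero B.add_zero
      A.add_inverse B.add_inverse A.scale_one B.scale_one A.scale_scale B.scale_scale
      A.scale_add_left B.scale_add_left A.scale_add_right B.scale_add_right A.mult_assoc B.mult_assoc
      A.mult_add_left B.mult_add_left A.mult_add_right B.mult_add_right A.scale_mult_left B.scale_mult_left
      A.scale_mult_right B.scale_mult_right A.star_star B.star_star A.star_add B.star_add
      A.star_scale B.star_scale A.star_mult B.star_mult
      A.add_left_commute B.add_left_commute A.add_commute B.add_commute
      complete[unfolded pullback_simps] complete le_max_iff_disj nn)
qed

lemma cstar_hom_pullback_fst: "cstar_hom (pullback A B p q) A fst"
  and cstar_hom_pullback_snd: "cstar_hom (pullback A B p q) B snd"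
  by (auto intro!: cstar_homI simp: pullback_simps)

lemma cstar_hom_into_pullback:
  assumes f: "cstar_hom Z A f" and g: "cstar_hom Z B g"
    and eq: "\<And>z. z \<in> ccarrier Z \<Longrightarrow> p (f z) = q (g z)"
  shows "cstar_hom Z (pullback A B p q) (\<lambda>z. (f z, g z))"
  by (rule cstar_homI) (simp_all add: pullback_simps cstar_homD[OF f] cstar_homD[OF g] eq)

lemma continuous_map_into_pullback:
  assumes A: "cstar_algebra A" and B: "cstar_algebra B" and P: "cstar_algebra (pullback A B p q)"
    and f: "continuous_map Z (ctopology A) f" and g: "continuous_map Z (ctopology B) g"
    and eq: "\<And>z. z \<in> topspace Z \<Longrightarrow> p (f z) = q (g z)"
  shows "continuous_map Z (ctopology (pullback A B p q)) (\<lambda>z. (f z, g z))"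
proof -
  interpret P: cstar_algebra "pullback A B p q" by fact
  note c = cstar_algebra.continuous_map_in_carrier[OF A f] cstar_algebra.continuous_map_in_carrier[OF B g]
  show ?thesis
    unfolding P.continuous_map_ctopology
  proof (intro conjI ballI allI impI)
    fix z and e :: real assume z: "z \<in> topspace Z" and e: "0 < e"
    obtain U where U: "openin Z U" "z \<in> U" "\<forall>y\<in>U. cnorm A (cdiff A (f y) (f z)) < e"
      using f z e cstar_algebra.continuous_map_ctopology[OF A] by metis
    obtain V where V: "openin Z V" "z \<in> V" "\<forall>y\<in>V. cnorm B (cdiff B (g y) (g z)) < e"
      using g z e cstar_algebra.continuous_map_ctopology[OF B] by metis
    show "\<exists>U. openin Z U \<and> z \<in> U \<and> (\<forall>y\<in>U. cnorm (pullback A B p q)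
        (cdiff (pullback A B p q) (f y, g y) (f z, g z)) < e)"
      using U V by (intro exI[of _ "U \<inter> V"]) (auto simp: pullback_simps)
  qed (use c eq in \<open>auto simp: pullback_simps\<close>)
qed

lemma transport_simps:
  assumes "inj_on h (ccarrier A)"
  shows "ccarrier (transport h A) = h ` ccarrier A"
    and "czero (transport h A) = h (czero A)"
    and "\<lbrakk>x \<in> ccarrier A; y \<in> ccarrier A\<rbrakk> \<Longrightarrow> cadd (transport h A) (h x) (h y) = h (cadd A x y)"
    and "x \<in> ccarrier A \<Longrightarrow> cscale (transport h A) c (h x) = h (cscale A c x)"
    and "\<lbrakk>x \<in> ccarrier A; y \<in> ccarrier A\<rbrakk> \<Longrightarrow> cmult (transport h A) (h x) (h y) = h (cmult A x y)"
    and "x \<in> ccarrier A \<Longrightarrow> cstar (transport h A) (h x) = h (cstar A x)"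
    and "x \<in> ccarrier A \<Longrightarrow> cnorm (transport h A) (h x) = cnorm A x"
  using assms by (simp_all add: transport_def Let_def)

lemma cstar_algebra_transport:
  assumes A: "cstar_algebra A" and inj: "inj_on h (ccarrier A)"
  shows "cstar_algebra (transport h A)"
proof -
  interpret A: cstar_algebra A by fact
  let ?T = "transport h A"
  note S = transport_simps[OF inj]
  have dist: "cdist ?T (h x) (h y) = cdist A x y" if "x \<in> ccarrier A" "y \<in> ccarrier A" for x y
    using that by (simp add: cdist_def S)
  have dist0: "cdist ?T x y = 0" if "x \<notin> ccarrier ?T \<or> y \<notin> ccarrier ?T" for x y
    using that by (auto simp: cdist_def)
  interpret T: Metric_space "ccarrier ?T" "cdist ?T"
  proof
    show "0 \<le> cdist ?T x y" for x y
      by (cases "x \<in> ccarrier ?T \<and> y \<in> ccarrier ?T") (auto simp: dist dist0 S(1))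
    show "cdist ?T x y = cdist ?T y x" for x y
      using A.metric.commute
      by (cases "x \<in> ccarrier ?T \<and> y \<in> ccarrier ?T") (auto simp: dist dist0 S(1))
    show "cdist ?T x y = 0 \<longleftrightarrow> x = y" if "x \<in> ccarrier ?T" "y \<in> ccarrier ?T" for x y
      using that by (auto simp: S(1) dist)
    show "cdist ?T x z \<le> cdist ?T x y + cdist ?T y z"
      if "x \<in> ccarrier ?T" "y \<in> ccarrier ?T" "z \<in> ccarrier ?T" for x y z
      using that by (auto simp: S(1) dist A.metric.triangle)
  qed
  have complete: "T.mcomplete"
    unfolding T.mcomplete_def
  proof (intro allI impI)
    fix \<sigma> assume cau: "T.MCauchy \<sigma>"
    then have "\<forall>n. \<sigma> n \<in> ccarrier ?T" by (auto simp: T.MCauchy_def)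
    then have "\<forall>n. \<exists>x\<in>ccarrier A. \<sigma> n = h x" by (auto simp: S(1))
    then obtain \<tau> where \<tau>: "\<And>n. \<tau> n \<in> ccarrier A" "\<sigma> = (\<lambda>n. h (\<tau> n))" by metis
    have "A.metric.MCauchy \<tau>"
      using cau \<tau> unfolding T.MCauchy_def A.metric.MCauchy_def by (auto simp: dist)
    then obtain a where a: "a \<in> ccarrier A"
      "\<And>e. 0 < e \<Longrightarrow> \<forall>\<^sub>F n in sequentially. \<tau> n \<in> ccarrier A \<and> cdist A (\<tau> n) a < e"
      using A.complete unfolding A.metric.mcomplete_def A.metric.limitin_metric by blast
    have "limitin T.mtopology \<sigma> (h a) sequentially"
      unfolding T.limitin_metric
    proof (intro conjI allI impI)
      fix e :: real assume "0 < e"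
      from a(2)[OF this] show "\<forall>\<^sub>F n in sequentially. \<sigma> n \<in> ccarrier ?T \<and> cdist ?T (\<sigma> n) (h a) < e"
        by eventually_elim (simp add: \<tau> dist a S(1))
    qed (simp add: S(1) a)
    then show "\<exists>x. limitin T.mtopology \<sigma> x sequentially" by blast
  qed
  show ?thesis
  proof (unfold_locales, goal_cases)
    case (24 x)
    then obtain y where y: "y \<in> ccarrier A" "x = h y" by (auto simp: S(1))
    then have "h y = h (czero A) \<longleftrightarrow> y = czero A" using inj by (auto dest: inj_onD)
    then show ?case using y by (simp add: S A.norm_eq_zero)
  next
    case (25 x y) then show ?case using A.norm_triangle by (auto simp: S)
  next
    case (27 x y) then show ?case using A.norm_mult by (auto simp: S)
  qed (auto simp: S A.norm_nonneg A.add_zero A.add_inverse A.scale_one A.scale_scale A.scale_add_left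
      A.scale_add_right A.mult_assoc A.mult_add_left A.mult_add_right A.scale_mult_left
      A.scale_mult_right A.star_star A.star_add A.star_scale A.star_mult A.norm_scale
      A.norm_star_mult complete[unfolded S(1)] complete A.add_ac A.add_zero_right)
qed

lemma cstar_hom_transport: "inj_on h (ccarrier A) \<Longrightarrow> cstar_hom A (transport h A) h"
  by (rule cstar_homI) (simp_all add: transport_simps)

lemma cstar_hom_transport_inverse:
  assumes "\<And>x. g (h x) = x"
  shows "cstar_hom (transport h A) A g"
proof -
  have inj: "inj_on h S" for S by (rule inj_on_inverseI[of S g]) (rule assms)
  show ?thesis
    by (rule cstar_homI) (use assms in \<open>auto simp: transport_simps[OF inj]\<close>)
qed

lemma cstar_hom_inv:
  assumes A: "cstar_algebra A" and h: "cstar_hom A B h" and bij: "bij_betw h (ccarrier A) (ccarrier B)"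
  shows "cstar_hom B A (inv_into (ccarrier A) h)"
proof -
  interpret A: cstar_algebra A by fact
  have inj: "inj_on h (ccarrier A)" and im: "h ` ccarrier A = ccarrier B"
    using bij by (auto simp: bij_betw_def)
  let ?g = "inv_into (ccarrier A) h"
  have c: "?g y \<in> ccarrier A" "h (?g y) = y" if "y \<in> ccarrier B" for y
    using that im by (auto intro: inv_into_into f_inv_into_f)
  have eq: "?g y = x" if "x \<in> ccarrier A" "h x = y" for x y
    using that inj by (metis inv_into_f_f)
  show ?thesis
    by (rule cstar_homI) (auto intro!: eq simp: c cstar_homD[OF h])
qed

lemma cstar_isomorphic_sym:
  assumes "cstar_algebra A" "cstar_isomorphic A B"
  shows "cstar_isomorphic B A"
  using assms cstar_hom_inv bij_betw_inv_into unfolding cstar_isomorphic_def by blast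

lemma cstar_isomorphic_trans:
  assumes "cstar_isomorphic A B" "cstar_isomorphic B C"
  shows "cstar_isomorphic A C"
proof -
  obtain h k where "cstar_hom A B h" "bij_betw h (ccarrier A) (ccarrier B)"
    "cstar_hom B C k" "bij_betw k (ccarrier B) (ccarrier C)"
    using assms unfolding cstar_isomorphic_def by blast
  then have "cstar_hom A C (k \<circ> h) \<and> bij_betw (k \<circ> h) (ccarrier A) (ccarrier C)"
    using cstar_hom_compose[of A B h C k] bij_betw_trans by (auto simp: o_def)
  then show ?thesis unfolding cstar_isomorphic_def by blast
qed

section \<open>Direct sums and zero algebras\<close>

text \<open>
  The zero subalgebra of \<open>A\<close>.  It has the type of \<open>A\<close>, so it can replace a missing fibre.
\<close>

definition zero_alg :: "'a cstar_alg \<Rightarrow> 'a cstar_alg" where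
  "zero_alg A = A\<lparr>ccarrier := {czero A}\<rparr>"

definition direct_sum :: "'a cstar_alg \<Rightarrow> 'b cstar_alg \<Rightarrow> ('a \<times> 'b) cstar_alg" where
  "direct_sum A B = pullback A B (\<lambda>_. ()) (\<lambda>_. ())"

text \<open>
  The zero algebra on the one-point type, over which the pullback is the direct sum.
\<close>

definition unit_alg :: "unit cstar_alg" where
  "unit_alg = \<lparr>ccarrier = UNIV, czero = (), cadd = (\<lambda>_ _. ()), cscale = (\<lambda>_ _. ()),
     cmult = (\<lambda>_ _. ()), cstar = (\<lambda>_. ()), cnorm = (\<lambda>_. 0)\<rparr>"

lemma mcomplete_singleton:
  assumes "Metric_space {a} d"
  shows "Metric_space.mcomplete {a} d"
proof -
  interpret Metric_space "{a}" d by fact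
  show ?thesis
    unfolding mcomplete_def
  proof (intro allI impI exI[of _ a])
    fix \<sigma> assume "MCauchy \<sigma>"
    then have "\<sigma> = (\<lambda>_. a)" by (auto simp: MCauchy_def)
    then show "limitin mtopology \<sigma> a sequentially" by simp
  qed
qed

lemma cstar_algebra_unit_alg: "cstar_algebra unit_alg"
proof -
  have "UNIV = {()}" by auto
  moreover have "Metric_space {()} (cdist unit_alg)"
    by unfold_locales (auto simp: cdist_def unit_alg_def)
  ultimately have "Metric_space.mcomplete (ccarrier unit_alg) (cdist unit_alg)"
    using mcomplete_singleton[of "()"] by (simp add: unit_alg_def)
  then show ?thesis
    by unfold_locales (auto simp: unit_alg_def)
qed

lemma zero_alg_simps [simp]:
  "ccarrier (zero_alg A) = {czero A}" "czero (zero_alg A) = czero A" "cadd (zero_alg A) = cadd A"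
  "cscale (zero_alg A) = cscale A" "cmult (zero_alg A) = cmult A" "cstar (zero_alg A) = cstar A"
  "cnorm (zero_alg A) = cnorm A"
  by (simp_all add: zero_alg_def)

lemma fd_zero_alg:
  assumes "cstar_algebra A"
  shows "fd_cstar_algebra (zero_alg A)"
proof -
  interpret A: cstar_algebra A by fact
  have "Metric_space {czero A} (cdist (zero_alg A))"
    by unfold_locales (auto simp: cdist_def A.diff_self)
  then have "Metric_space.mcomplete (ccarrier (zero_alg A)) (cdist (zero_alg A))"
    using mcomplete_singleton by simp
  then have "cstar_algebra (zero_alg A)"
    by unfold_locales (auto simp: A.add_zero A.scale_zero_right A.mult_zero_left A.star_zero)
  moreover have "czero A \<in> cspan (zero_alg A) {}"
    using cspan.cspan_zero[of "zero_alg A" "{}"] by simp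
  ultimately show ?thesis
    unfolding fd_cstar_algebra_def by (intro conjI exI[of _ "{}"]) auto
qed

lemma cstar_algebra_direct_sum:
  assumes "cstar_algebra A" "cstar_algebra B"
  shows "cstar_algebra (direct_sum A B)"
  unfolding direct_sum_def
  by (rule cstar_algebra_pullback[OF assms cstar_algebra_unit_alg])
     (auto intro!: cstar_homI simp: unit_alg_def)

lemma direct_sum_simps:
  "ccarrier (direct_sum A B) = ccarrier A \<times> ccarrier B"
  "czero (direct_sum A B) = (czero A, czero B)"
  "cadd (direct_sum A B) x y = (cadd A (fst x) (fst y), cadd B (snd x) (snd y))"
  "cscale (direct_sum A B) c x = (cscale A c (fst x), cscale B c (snd x))"
  by (auto simp: direct_sum_def pullback_simps)

lemma fd_direct_sum:
  assumes "fd_cstar_algebra A" "fd_cstar_algebra B"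
  shows "fd_cstar_algebra (direct_sum A B)"
proof -
  obtain S T where S: "finite S" "S \<subseteq> ccarrier A" "ccarrier A \<subseteq> cspan A S"
    and T: "finite T" "T \<subseteq> ccarrier B" "ccarrier B \<subseteq> cspan B T"
    and A: "cstar_algebra A" and B: "cstar_algebra B"
    using assms unfolding fd_cstar_algebra_def by blast
  interpret A: cstar_algebra A by fact
  interpret B: cstar_algebra B by fact
  let ?D = "direct_sum A B"
  let ?U = "(\<lambda>a. (a, czero B)) ` S \<union> (\<lambda>b. (czero A, b)) ` T"
  have 2: "(czero A, y) \<in> cspan ?D ?U" if "y \<in> cspan B T" for y
    using that
  proof induction
    case cspan_zero
    then show ?case using cspan.cspan_zero[of ?D ?U] by (simp add: direct_sum_simps)
  next
    case (cspan_step b x c)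
    have "cadd ?D (cscale ?D c (czero A, b)) (czero A, x) \<in> cspan ?D ?U"
      using cspan_step by (intro cspan.cspan_step) auto
    then show ?case by (simp add: direct_sum_simps A.scale_zero_right A.add_zero)
  qed
  have 1: "(x, y) \<in> cspan ?D ?U" if "x \<in> cspan A S" "y \<in> ccarrier B" for x y
    using that(1)
  proof induction
    case cspan_zero
    then show ?case using 2 that T by blast
  next
    case (cspan_step b x c)
    have "cadd ?D (cscale ?D c (b, czero B)) (x, y) \<in> cspan ?D ?U"
      using cspan_step by (intro cspan.cspan_step) auto
    then show ?case using that by (simp add: direct_sum_simps B.scale_zero_right B.add_zero)
  qed
  have "finite ?U" "?U \<subseteq> ccarrier ?D" "ccarrier ?D \<subseteq> cspan ?D ?U"
    using S T 1 by (auto simp: direct_sum_simps)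
  then show ?thesis
    unfolding fd_cstar_algebra_def using cstar_algebra_direct_sum[OF A B] by blast
qed

lemma cstar_hom_direct_sum_fst: "cstar_hom (direct_sum A B) A fst"
  and cstar_hom_direct_sum_snd: "cstar_hom (direct_sum A B) B snd"
  unfolding direct_sum_def by (rule cstar_hom_pullback_fst cstar_hom_pullback_snd)+

lemma cstar_hom_into_direct_sum:
  "cstar_hom Z A f \<Longrightarrow> cstar_hom Z B g \<Longrightarrow> cstar_hom Z (direct_sum A B) (\<lambda>z. (f z, g z))"
  unfolding direct_sum_def by (rule cstar_hom_into_pullback) simp_all

lemma continuous_map_into_direct_sum:
  assumes "cstar_algebra A" "cstar_algebra B"
    and "continuous_map Z (ctopology A) f" "continuous_map Z (ctopology B) g"
  shows "continuous_map Z (ctopology (direct_sum A B)) (\<lambda>z. (f z, g z))"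
  using cstar_algebra_direct_sum[OF assms(1,2)] unfolding direct_sum_def
  by (rule continuous_map_into_pullback[OF assms(1,2) _ assms(3,4)]) simp

section \<open>Cubes\<close>

lemma topspace_cube: "topspace (cube k) = {..<k} \<rightarrow>\<^sub>E {0..1}"
  by (simp add: cube_def)

lemma compact_space_cube: "compact_space (cube k)"
proof -
  have "compact_space (top_of_set {0..1::real})"
    by (rule compact_space_subtopology) simp
  then show ?thesis by (simp add: cube_def compact_space_product_topology)
qed

lemma continuous_map_into_cube:
  "continuous_map Z (cube k) f \<longleftrightarrow>
     (\<forall>z\<in>topspace Z. f z \<in> topspace (cube k)) \<and> (\<forall>i<k. continuous_map Z euclideanreal (\<lambda>z. f z i))"
  by (auto simp: cube_def continuous_map_componentwise continuous_map_in_subtopology PiE_iff image_subset_iff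
      Pi_iff)

lemma continuous_map_cube_coordinate:
  "i < k \<Longrightarrow> continuous_map (cube k) euclideanreal (\<lambda>s. s i)"
  using continuous_map_into_cube[of "cube k" k id] by (simp add: id_def)

lemma mem_cube_boundary:
  "s \<in> cube_boundary k \<longleftrightarrow> s \<in> topspace (cube k) \<and> (\<exists>i<k. s i = 0 \<or> s i = 1)"
proof (cases "s \<in> topspace (cube k)")
  case True
  then have s: "s \<in> extensional {..<k}" "\<And>i. i < k \<Longrightarrow> 0 \<le> s i \<and> s i \<le> 1"
    by (auto simp: topspace_cube PiE_iff)
  have "s \<in> open_cube k \<longleftrightarrow> (\<forall>i<k. 0 < s i \<and> s i < 1)"
    using s by (auto simp: open_cube_def PiE_iff)
  also have "\<dots> \<longleftrightarrow> \<not> (\<exists>i<k. s i = 0 \<or> s i = 1)"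
    using s(2) by (metis less_eq_real_def order_less_irrefl)
  finally show ?thesis using True by (auto simp: cube_boundary_def)
qed (simp add: cube_boundary_def)

lemma cube_boundary_subset: "cube_boundary k \<subseteq> topspace (cube k)"
  by (auto simp: cube_boundary_def)

lemma topspace_sphere_top [simp]: "topspace (sphere_top k) = cube_boundary k"
  using cube_boundary_subset by (auto simp: sphere_top_def)

lemma closedin_cube_face:
  assumes "i < k"
  shows "closedin (cube k) {s \<in> topspace (cube k). s i \<in> {c}}"
  by (rule closedin_continuous_map_preimage[OF continuous_map_cube_coordinate[OF assms]]) auto

lemma closedin_cube_boundary: "closedin (cube k) (cube_boundary k)"
proof -
  have "cube_boundary k = \<Union> ((\<lambda>(i, c). {s \<in> topspace (cube k). s i \<in> {c}}) ` ({..<k} \<times> {0, 1}))"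
    by (auto simp: mem_cube_boundary)
  then show ?thesis
    using closedin_cube_face by (auto intro!: closedin_Union)
qed

lemma compact_space_sphere_top: "compact_space (sphere_top k)"
  unfolding sphere_top_def
  by (rule compact_space_subtopology[OF closedin_compact_space[OF compact_space_cube closedin_cube_boundary]])

lemma cube_upd: "s \<in> topspace (cube k) \<Longrightarrow> 0 \<le> c \<Longrightarrow> c \<le> 1 \<Longrightarrow> i < k \<Longrightarrow> s(i := c) \<in> topspace (cube k)"
  by (auto simp: topspace_cube PiE_iff extensional_def)

lemma cube_upd_last: "s \<in> topspace (cube k) \<Longrightarrow> t \<in> {0..1} \<Longrightarrow> s(k := t) \<in> topspace (cube (Suc k))"
  by (auto simp: topspace_cube PiE_iff extensional_def less_Suc_eq)

lemma cube_restrict: "s \<in> topspace (cube (Suc k)) \<Longrightarrow> restrict s {..<k} \<in> topspace (cube k)"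
  by (auto simp: topspace_cube PiE_iff)

lemma cube_last: "s \<in> topspace (cube (Suc k)) \<Longrightarrow> s k \<in> {0..1}"
  by (auto simp: topspace_cube PiE_iff)

lemma cube_restrict_self: "s \<in> topspace (cube k) \<Longrightarrow> restrict s {..<k} = s"
  by (auto simp: topspace_cube PiE_iff extensional_def restrict_def)

lemma cube_upd_restrict: "s \<in> topspace (cube (Suc k)) \<Longrightarrow> (restrict s {..<k})(k := s k) = s"
  by (auto simp: topspace_cube PiE_iff extensional_def restrict_def)

lemma cube_boundary_upd_last:
  assumes "s \<in> topspace (cube k)" "t \<in> {0..1}"
  shows "s(k := t) \<in> cube_boundary (Suc k) \<longleftrightarrow> t = 0 \<or> t = 1 \<or> s \<in> cube_boundary k"
  using assms by (auto simp: mem_cube_boundary cube_upd_last less_Suc_eq)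

lemma cube_boundary_restrict:
  assumes "s \<in> cube_boundary (Suc k)" "s k \<noteq> 0" "s k \<noteq> 1"
  shows "restrict s {..<k} \<in> cube_boundary k"
  using assms by (auto simp: mem_cube_boundary cube_restrict less_Suc_eq)

lemma continuous_map_upd_last:
  "continuous_map (prod_topology (top_of_set {0..1}) (cube k)) (cube (Suc k)) (\<lambda>(t, s). s(k := t))"
  unfolding continuous_map_into_cube
proof (intro conjI ballI allI impI)
  fix z assume "z \<in> topspace (prod_topology (top_of_set {0..1::real}) (cube k))"
  then show "(case z of (t, s) \<Rightarrow> s(k := t)) \<in> topspace (cube (Suc k))"
    by (auto simp del: fun_upd_apply intro!: cube_upd_last)
next
  fix i assume "i < Suc k"
  have 1: "continuous_map (prod_topology (top_of_set {0..1::real}) (cube k)) euclideanreal fst"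
    using continuous_map_fst[of "top_of_set {0..1::real}" "cube k"] by (simp add: continuous_map_in_subtopology)
  have 2: "i < k \<Longrightarrow> continuous_map (prod_topology (top_of_set {0..1::real}) (cube k)) euclideanreal (\<lambda>z. snd z i)"
    using continuous_map_compose[OF continuous_map_snd continuous_map_cube_coordinate] by (auto simp: o_def)
  show "continuous_map (prod_topology (top_of_set {0..1::real}) (cube k)) euclideanreal
      (\<lambda>z. (case z of (t, s) \<Rightarrow> s(k := t)) i)"
    using 1 2 \<open>i < Suc k\<close> by (cases "i = k") (auto simp: case_prod_beta)
qed

lemma continuous_map_cube_upd:
  assumes "0 \<le> c" "c \<le> 1" "i < k"
  shows "continuous_map (cube k) (cube k) (\<lambda>s. s(i := c))"
  unfolding continuous_map_into_cube
proof (intro conjI ballI allI impI)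
  show "continuous_map (cube k) euclideanreal (\<lambda>s. (s(i := c)) j)" if "j < k" for j
    using that continuous_map_cube_coordinate[OF that] by (cases "j = i") auto
qed (use assms cube_upd in auto)

lemma continuous_map_cube_restrict:
  "continuous_map (cube (Suc k)) (cube k) (\<lambda>s. restrict s {..<k})"
  unfolding continuous_map_into_cube
proof (intro conjI ballI allI impI)
  show "continuous_map (cube (Suc k)) euclideanreal (\<lambda>s. restrict s {..<k} i)" if "i < k" for i
    using that continuous_map_cube_coordinate[of i "Suc k"] by simp
qed (rule cube_restrict)

lemma continuous_map_cube_last:
  "continuous_map (cube (Suc k)) (top_of_set {0..1}) (\<lambda>s. s k)"
  using continuous_map_cube_coordinate[of k "Suc k"] cube_last
  by (simp add: continuous_map_in_subtopology image_subset_iff)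

text \<open>
  The extension is built one coordinate at a time.  If \<open>g\<close> agrees with \<open>f\<close> on the faces in the
  directions \<open>i < j\<close>, the error \<open>f - g\<close> on the two faces in direction \<open>j\<close> is interpolated linearly
  in the coordinate \<open>s j\<close> and added to \<open>g\<close>.  This corrects \<open>g\<close> on these two faces, and it does not
  spoil the earlier ones: the correction at a point of an earlier face only involves points of
  that same face, where the error is zero.
\<close>

lemma extend_from_cube_faces:
  assumes "cstar_algebra F" and f: "continuous_map (sphere_top k) (ctopology F) f"
    and "j \<le> k"
  shows "\<exists>g. continuous_map (cube k) (ctopology F) g \<and>
    (\<forall>s\<in>topspace (cube k). \<forall>i<j. s i = 0 \<or> s i = 1 \<longrightarrow> g s = f s)"
  using \<open>j \<le> k\<close>
proof (induction j)
  interpret F: cstar_algebra F by fact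
  case 0
  show ?case by (rule exI[of _ "\<lambda>_. czero F"]) auto
next
  interpret F: cstar_algebra F by fact
  case (Suc j)
  then obtain g where g: "continuous_map (cube k) (ctopology F) g"
    and gf: "\<And>s i. \<lbrakk>s \<in> topspace (cube k); i < j; s i = 0 \<or> s i = 1\<rbrakk> \<Longrightarrow> g s = f s"
    by auto
  have j: "j < k" using Suc by simp
  define D where "D c s = cdiff F (f (s(j := c))) (g (s(j := c)))" for c s
  define g' where "g' s = cadd F (g s) (cadd F (cscale F (complex_of_real (1 - s j)) (D 0 s))
      (cscale F (complex_of_real (s j)) (D 1 s)))" for s
  have bd: "s(j := c) \<in> cube_boundary k" if "s \<in> topspace (cube k)" "c = 0 \<or> c = 1" for s c
    using that j by (auto simp: mem_cube_boundary cube_upd)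
  note fF = F.continuous_map_in_carrier[OF f, simplified] and gF = F.continuous_map_in_carrier[OF g]
  have DF: "D c s \<in> ccarrier F" if "s \<in> topspace (cube k)" "c = 0 \<or> c = 1" for s c
  proof -
    have b: "s(j := c) \<in> cube_boundary k" using bd that by blast
    then have "s(j := c) \<in> topspace (cube k)" using cube_boundary_subset by blast
    then show ?thesis unfolding D_def using fF[OF b] gF by simp
  qed
  have D: "continuous_map (cube k) (ctopology F) (D c)" if c: "c = 0 \<or> c = 1" for c
  proof -
    have u: "continuous_map (cube k) (cube k) (\<lambda>s. s(j := c))"
      using c j by (intro continuous_map_cube_upd) auto
    then have "continuous_map (cube k) (sphere_top k) (\<lambda>s. s(j := c))"
      unfolding sphere_top_def using bd c by (intro continuous_map_into_subtopology) auto
    from continuous_map_compose[OF this f] continuous_map_compose[OF u g]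
    show ?thesis unfolding D_def
      by (intro F.continuous_map_cadd F.continuous_map_cscale) (auto simp: o_def)
  qed
  have r: "continuous_map (cube k) (euclidean :: complex topology) (\<lambda>s. complex_of_real (h (s j)))"
    if "continuous_on UNIV h" for h
  proof -
    have "continuous_map euclideanreal (euclidean :: complex topology) (\<lambda>x. complex_of_real (h x))"
      using that by (auto intro!: continuous_intros)
    from continuous_map_compose[OF continuous_map_cube_coordinate[OF j] this] show ?thesis
      by (simp add: o_def)
  qed
  have "continuous_map (cube k) (ctopology F) g'"
    unfolding g'_def using g D r[of "\<lambda>x. 1 - x"] r[of "\<lambda>x. x"]
    by (intro F.continuous_map_cadd F.continuous_map_cscale) (auto intro!: continuous_intros)
  moreover have "g' s = f s" if s: "s \<in> topspace (cube k)" and i: "i < Suc j" "s i = 0 \<or> s i = 1" for s i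
  proof (cases "i = j")
    case True
    have b: "s \<in> cube_boundary k" using s i True j by (auto simp: mem_cube_boundary)
    have upd: "s(j := s j) = s" by simp
    have mem: "f s \<in> ccarrier F" "g s \<in> ccarrier F" using fF[OF b] gF[OF s] by auto
    have zero: "cscale F 0 (D c s) = czero F" if "c = 0 \<or> c = 1" for c
      using DF[OF s that] by (simp add: F.scale_zero_left)
    have "cadd F (g s) (cdiff F (f s) (g s)) = f s"
      using mem by (simp add: F.add_left_commute F.add_inverse F.add_zero_right)
    moreover have "D (s j) s = cdiff F (f s) (g s)" by (simp add: D_def)
    ultimately show ?thesis
      using i True mem zero[of 0] zero[of 1] DF[OF s, of 0] DF[OF s, of 1]
      by (auto simp: g'_def F.scale_one F.add_zero F.add_zero_right)
  next
    case False
    then have ij: "i < j" using i by simp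
    have "D c s = czero F" if c: "c = 0 \<or> c = 1" for c
    proof -
      have "g (s(j := c)) = f (s(j := c))"
        using c ij i s j by (intro gf[of _ i]) (auto intro!: cube_upd)
      then show ?thesis using fF[OF bd[OF s c]] by (simp add: D_def F.diff_self)
    qed
    then show ?thesis
      using gF[OF s] gf[OF s ij i(2)] by (simp add: g'_def F.scale_zero_right F.add_zero_right)
  qed
  ultimately show ?case by blast
qed

lemma extend_from_cube_boundary:
  assumes F: "cstar_algebra F" and f: "f \<in> ccarrier (C_alg (sphere_top k) F)"
  shows "\<exists>g\<in>ccarrier (C_alg (cube k) F). restrict g (cube_boundary k) = f"
proof -
  have "continuous_map (sphere_top k) (ctopology F) f" and ext: "f \<in> extensional (cube_boundary k)"
    using f by (auto simp: C_alg_simps)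
  from extend_from_cube_faces[OF F this(1), of k] obtain g where
    g: "continuous_map (cube k) (ctopology F) g"
    and gf: "\<And>s i. \<lbrakk>s \<in> topspace (cube k); i < k; s i = 0 \<or> s i = 1\<rbrakk> \<Longrightarrow> g s = f s" by auto
  have "restrict g (topspace (cube k)) \<in> ccarrier (C_alg (cube k) F)"
    using g by (auto simp: C_alg_simps)
  moreover have "restrict (restrict g (topspace (cube k))) (cube_boundary k) = f"
  proof (rule extensionalityI[OF _ ext])
    fix s assume "s \<in> cube_boundary k"
    then show "restrict (restrict g (topspace (cube k))) (cube_boundary k) s = f s"
      using gf by (auto simp: mem_cube_boundary)
  qed (rule restrict_extensional)
  ultimately show ?thesis by blast
qed

section \<open>Skeleta\<close>

declare skeleton.simps [simp del]

abbreviation skel :: "'f nccw \<Rightarrow> nat \<Rightarrow> 'f tower set" where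
  "skel X k \<equiv> ccarrier (skeleton X k)"

abbreviation cell_alg :: "'f nccw \<Rightarrow> nat \<Rightarrow> ((nat \<Rightarrow> real) \<Rightarrow> 'f) cstar_alg" where
  "cell_alg X k \<equiv> C_alg (cube k) (fibre X k)"

lemma inj_Base: "inj_on Base S" by (simp add: inj_on_def)
lemma inj_Glue: "inj_on (\<lambda>(f, a). Glue f a) S" by (auto simp: inj_on_def)

lemma skeleton_0_carrier: "skel X 0 = Base ` ccarrier (fibre X 0)"
  by (simp add: skeleton.simps transport_simps[OF inj_Base])

lemma Base_mem: "Base x \<in> skel X 0 \<longleftrightarrow> x \<in> ccarrier (fibre X 0)"
  by (auto simp: skeleton_0_carrier)

lemma Glue_mem: "Glue f a \<in> skel X (Suc k) \<longleftrightarrow>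
    f \<in> ccarrier (cell_alg X (Suc k)) \<and> a \<in> skel X k \<and>
    restrict f (cube_boundary (Suc k)) = attach X (Suc k) a"
  by (auto simp: skeleton.simps transport_simps[OF inj_Glue] pullback_simps)

lemma skeleton_SucE:
  assumes "x \<in> skel X (Suc k)"
  obtains f a where "x = Glue f a" "f \<in> ccarrier (cell_alg X (Suc k))"
    "a \<in> skel X k" "restrict f (cube_boundary (Suc k)) = attach X (Suc k) a"
  using assms by (auto simp: skeleton.simps transport_simps[OF inj_Glue] pullback_simps)

lemma tower_tail_mem: "x \<in> skel X (Suc k) \<Longrightarrow> tower_tail x \<in> skel X k"
  by (erule skeleton_SucE) simp

lemma tower_head_boundary:
  assumes "x \<in> skel X (Suc k)" "s \<in> cube_boundary (Suc k)"
  shows "tower_head x s = attach X (Suc k) (tower_tail x) s"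
  using assms(1)
proof (rule skeleton_SucE)
  fix f a assume x: "x = Glue f a" and eq: "restrict f (cube_boundary (Suc k)) = attach X (Suc k) a"
  have "f s = restrict f (cube_boundary (Suc k)) s" using assms(2) by simp
  also have "\<dots> = attach X (Suc k) a s" unfolding eq ..
  finally show ?thesis using x by simp
qed

lemma tower_eqI_Suc:
  assumes x: "x \<in> skel X (Suc k)" and y: "y \<in> skel X (Suc k)"
    and "\<And>s. s \<in> topspace (cube (Suc k)) \<Longrightarrow> tower_head x s = tower_head y s"
    and "tower_tail x = tower_tail y"
  shows "x = y"
proof -
  obtain f a where f: "x = Glue f a" "f \<in> ccarrier (cell_alg X (Suc k))"
    using skeleton_SucE[OF x] by metis
  obtain g b where g: "y = Glue g b" "g \<in> ccarrier (cell_alg X (Suc k))"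
    using skeleton_SucE[OF y] by metis
  have "f = g"
    using f g assms by (intro extensionalityI[of f "topspace (cube (Suc k))"]) (auto simp: C_alg_simps)
  then show ?thesis using f g assms by simp
qed

lemma hom_pair: "cstar_hom (skeleton X (Suc k)) (pullback (cell_alg X (Suc k)) (skeleton X k)
          (\<lambda>f. restrict f (cube_boundary (Suc k))) (attach X (Suc k))) (\<lambda>x. (tower_head x, tower_tail x))"
  unfolding skeleton.simps by (rule cstar_hom_transport_inverse) auto

lemma hom_tail: "cstar_hom (skeleton X (Suc k)) (skeleton X k) tower_tail"
  using cstar_hom_compose[OF hom_pair cstar_hom_pullback_snd] by simp

lemma hom_head: "cstar_hom (skeleton X (Suc k)) (cell_alg X (Suc k)) tower_head"
  using cstar_hom_compose[OF hom_pair cstar_hom_pullback_fst] by simp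

lemma hom_head_0: "cstar_hom (skeleton X 0) (fibre X 0) (\<lambda>x. tower_head x s)"
  unfolding skeleton.simps by (rule cstar_hom_transport_inverse) simp

lemma hom_head_at:
  assumes "cstar_algebra (fibre X k)" "s \<in> topspace (cube k)"
  shows "cstar_hom (skeleton X k) (fibre X k) (\<lambda>x. tower_head x s)"
proof (cases k)
  case 0
  then show ?thesis using hom_head_0 by simp
next
  case (Suc j)
  then show ?thesis
    using cstar_hom_compose[OF hom_head[of X j] cstar_hom_eval[of s]] assms by simp
qed

lemma head_continuous:
  assumes "cstar_algebra (fibre X k)" "x \<in> skel X k"
  shows "continuous_map (cube k) (ctopology (fibre X k)) (tower_head x)"
proof (cases k)
  case 0
  then obtain y where "y \<in> ccarrier (fibre X 0)" "x = Base y"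
    using assms(2) unfolding 0 skeleton_0_carrier by blast
  then show ?thesis using 0 cstar_algebra.topspace_ctopology[OF assms(1)] by simp
next
  case (Suc j)
  show ?thesis using cstar_homD(1)[OF hom_head assms(2)[unfolded Suc]] unfolding Suc by (simp add: C_alg_simps)
qed

text \<open>
  The data of a complex, continued to all dimensions.
\<close>

locale cell_tower =
  fixes X :: "'f nccw"
  assumes fibre: "\<And>k. cstar_algebra (fibre X k)"
    and attach: "\<And>k. cstar_hom (skeleton X k) (C_alg (sphere_top (Suc k)) (fibre X (Suc k))) (attach X (Suc k))"
begin

lemma cstar_cell: "cstar_algebra (cell_alg X k)"
  and cstar_sphere: "cstar_algebra (C_alg (sphere_top k) (fibre X k))"
  by (intro cstar_algebra_C_algI fibre compact_space_cube compact_space_sphere_top)+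

lemma hom_restrict_boundary:
  "cstar_hom (cell_alg X k) (C_alg (sphere_top k) (fibre X k)) (\<lambda>f. restrict f (cube_boundary k))"
  unfolding sphere_top_def
  by (intro cstar_hom_restrict fibre cube_boundary_subset)

lemma cstar_pullback:
  assumes "cstar_algebra (skeleton X k)"
  shows "cstar_algebra (pullback (cell_alg X (Suc k)) (skeleton X k)
          (\<lambda>f. restrict f (cube_boundary (Suc k))) (attach X (Suc k)))"
  by (rule cstar_algebra_pullback[OF cstar_cell assms cstar_sphere hom_restrict_boundary attach])

lemma cstar_skeleton: "cstar_algebra (skeleton X k)"
proof (induction k)
  case 0
  show ?case unfolding skeleton.simps by (intro cstar_algebra_transport fibre inj_Base)
next
  case (Suc k)
  show ?case unfolding skeleton.simps by (intro cstar_algebra_transport cstar_pullback Suc inj_Glue)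
qed

lemma hom_Base:
  assumes "cstar_hom Z (fibre X 0) h"
  shows "cstar_hom Z (skeleton X 0) (\<lambda>z. Base (h z))"
  unfolding skeleton.simps by (rule cstar_hom_compose[OF assms cstar_hom_transport[OF inj_Base]])

lemma hom_Glue:
  assumes h: "cstar_hom Z (cell_alg X (Suc k)) h" and g: "cstar_hom Z (skeleton X k) g"
    and eq: "\<And>z. z \<in> ccarrier Z \<Longrightarrow> restrict (h z) (cube_boundary (Suc k)) = attach X (Suc k) (g z)"
  shows "cstar_hom Z (skeleton X (Suc k)) (\<lambda>z. Glue (h z) (g z))"
  using cstar_hom_compose[OF cstar_hom_into_pullback[where p="\<lambda>f. restrict f (cube_boundary (Suc k))"
      and q="attach X (Suc k)", OF h g eq] cstar_hom_transport[OF inj_Glue]]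
  by (simp add: skeleton.simps)

lemma continuous_map_tail:
  "continuous_map Z (ctopology (skeleton X (Suc k))) g \<Longrightarrow>
    continuous_map Z (ctopology (skeleton X k)) (\<lambda>z. tower_tail (g z))"
  by (rule cstar_hom_continuous_map[OF cstar_skeleton cstar_skeleton hom_tail])

lemma continuous_map_head_joint:
  assumes g: "continuous_map Z (ctopology (skeleton X k)) g"
  shows "continuous_map (prod_topology Z (cube k)) (ctopology (fibre X k)) (\<lambda>(z, s). tower_head (g z) s)"
proof (cases k)
  case 0
  have "continuous_map Z (ctopology (fibre X 0)) (\<lambda>z. tower_head (g z) s)" for s
    by (rule cstar_hom_continuous_map[OF cstar_skeleton fibre hom_head_0 g[unfolded 0]])
  from continuous_map_compose[OF continuous_map_fst this]
  have *: "continuous_map (prod_topology Z (cube k)) (ctopology (fibre X 0)) (\<lambda>p. tower_head (g (fst p)) undefined)"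
    by (simp add: o_def)
  have const: "tower_head (g z) undefined = tower_head (g z) s" if "z \<in> topspace Z" for z s
  proof -
    have "g z \<in> skel X 0"
      using cstar_algebra.continuous_map_in_carrier[OF cstar_skeleton g that] 0 by simp
    then show ?thesis unfolding skeleton_0_carrier by auto
  qed
  show ?thesis unfolding 0
  proof (rule continuous_map_eq[OF *[unfolded 0]])
    fix p assume "p \<in> topspace (prod_topology Z (cube 0))"
    then show "tower_head (g (fst p)) undefined = (case p of (z, s) \<Rightarrow> tower_head (g z) s)"
      using const[of "fst p" "snd p"] by (simp add: case_prod_beta topspace_prod_topology mem_Times_iff)
  qed
next
  case (Suc j)
  show ?thesis unfolding Suc
    by (rule continuous_map_uncurry[OF fibre compact_space_cube
          cstar_hom_continuous_map[OF cstar_skeleton cstar_cell hom_head g[unfolded Suc]]])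
qed

lemma continuous_map_Base:
  assumes "continuous_map Z (ctopology (fibre X 0)) h"
  shows "continuous_map Z (ctopology (skeleton X 0)) (\<lambda>z. Base (h z))"
  by (rule cstar_hom_continuous_map[OF fibre cstar_skeleton _ assms])
     (simp add: skeleton.simps cstar_hom_transport[OF inj_Base])

lemma continuous_map_Glue:
  assumes h: "continuous_map Z (ctopology (cell_alg X (Suc k))) h"
    and g: "continuous_map Z (ctopology (skeleton X k)) g"
    and eq: "\<And>z. z \<in> topspace Z \<Longrightarrow> restrict (h z) (cube_boundary (Suc k)) = attach X (Suc k) (g z)"
  shows "continuous_map Z (ctopology (skeleton X (Suc k))) (\<lambda>z. Glue (h z) (g z))"
proof -
  note P = cstar_pullback[OF cstar_skeleton]
  have "continuous_map Z (ctopology (skeleton X (Suc k))) (\<lambda>z. (\<lambda>(f, a). Glue f a) (h z, g z))"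
    by (rule cstar_hom_continuous_map[OF P cstar_skeleton _
        continuous_map_into_pullback[where p="\<lambda>f. restrict f (cube_boundary (Suc k))" and q="attach X (Suc k)", OF cstar_cell cstar_skeleton P h g eq]])
       (simp_all add: skeleton.simps cstar_hom_transport[OF inj_Glue])
  then show ?thesis by simp
qed

text \<open>
  A cell with the boundary values prescribed by \<open>a\<close> exists by \<open>extend_from_cube_boundary\<close>.
\<close>

lemma tail_surj: "tower_tail ` skel X (Suc k) = skel X k"
proof
  show "tower_tail ` skel X (Suc k) \<subseteq> skel X k"
    using tower_tail_mem by blast
  show "skel X k \<subseteq> tower_tail ` skel X (Suc k)"
  proof
    fix a assume a: "a \<in> skel X k"
    obtain f where "f \<in> ccarrier (cell_alg X (Suc k))"
      "restrict f (cube_boundary (Suc k)) = attach X (Suc k) a"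
      using extend_from_cube_boundary[OF fibre cstar_homD(1)[OF attach a]] by blast
    then have "Glue f a \<in> skel X (Suc k)" using a Glue_mem by blast
    then show "a \<in> tower_tail ` skel X (Suc k)" by (intro image_eqI) auto
  qed
qed

end

section \<open>The cylinder complex of a map of skeleta\<close>

text \<open>
  Applies a map of fibres to every cell.  Functions are restricted to the cube, since elements of
  the function algebras are \<^const>\<open>undefined\<close> elsewhere.  An element of the \<open>0\<close>-skeleton has a
  constant head, so that any argument serves in the first equation.
\<close>

primrec map_tower :: "('h \<Rightarrow> 'f) \<Rightarrow> nat \<Rightarrow> 'h tower \<Rightarrow> 'f tower" where
  "map_tower p 0 c = Base (p (tower_head c undefined))"
| "map_tower p (Suc k) c =
     Glue (\<lambda>s\<in>topspace (cube (Suc k)). p (tower_head c s)) (map_tower p k (tower_tail c))"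

text \<open>
  The components \<open>x\<close> and \<open>y\<close> of an element \<open>(x, y, g)\<close> of the cylinder complex.
\<close>

abbreviation "bottom_part \<equiv> map_tower (\<lambda>z. fst (snd z))"
abbreviation "top_part \<equiv> map_tower fst"

text \<open>
  The value \<open>g t\<close>, for an element of the \<open>(k + 1)\<close>-skeleton.  The cylinder parameter \<open>t\<close> is the last
  coordinate of a cell, so a point \<open>s\<close> of the \<open>k\<close>-cube becomes \<open>s(k := t)\<close>.  In the first
  equation \<open>s = (\<lambda>_. undefined)\<close> is the only point of the \<open>0\<close>-cube.
\<close>

primrec slice :: "nat \<Rightarrow> real \<Rightarrow> ('f \<times> 'g \<times> 'g) tower \<Rightarrow> 'g tower" where
  "slice 0 t c = Base (snd (snd (tower_head c ((\<lambda>_. undefined)(0 := t)))))"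
| "slice (Suc k) t c =
     Glue (\<lambda>s\<in>topspace (cube (Suc k)). snd (snd (tower_head c (s(Suc k := t))))) (slice k t (tower_tail c))"

text \<open>
  A side cell of dimension \<open>k\<close> is an interval times a cell of dimension \<open>k - 1\<close>, and there is
  none for \<open>k = 0\<close>.
\<close>

primrec side_fibre :: "'g nccw \<Rightarrow> nat \<Rightarrow> 'g cstar_alg" where
  "side_fibre Y 0 = zero_alg (fibre Y 0)"
| "side_fibre Y (Suc k) = fibre Y k"

text \<open>
  The boundary values of the third component of a \<open>(k + 1)\<close>-cell.  In the last case \<open>s'\<close> lies on the
  boundary of the \<open>k\<close>-cube, hence \<open>k \<ge> 1\<close> there, and \<open>k - 1\<close> is the dimension of the slice.
\<close>

definition side_boundary ::
    "'g nccw \<Rightarrow> (nat \<Rightarrow> 'f tower \<Rightarrow> 'g tower) \<Rightarrow> nat \<Rightarrow> ('f \<times> 'g \<times> 'g) tower \<Rightarrow> (nat \<Rightarrow> real) \<Rightarrow> 'g"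
  where "side_boundary Y \<beta> k c s =
    (let s' = restrict s {..<k} in
     if s k = 0 then tower_head (bottom_part k c) s'
     else if s k = 1 then tower_head (\<beta> k (top_part k c)) s'
     else attach Y k (slice (k - 1) (s k) c) s')"

definition cyl_nccw ::
    "'f nccw \<Rightarrow> 'g nccw \<Rightarrow> (nat \<Rightarrow> 'f tower \<Rightarrow> 'g tower) \<Rightarrow> nat \<Rightarrow> ('f \<times> 'g \<times> 'g) nccw"
  where "cyl_nccw X Y \<beta> N =
    \<lparr> nc_dim = N,
      fibre = (\<lambda>k. direct_sum (fibre X k) (direct_sum (fibre Y k) (side_fibre Y k))),
      attach = (\<lambda>k c. \<lambda>s\<in>cube_boundary k.
        (attach X k (top_part (k - 1) c) s, attach Y k (bottom_part (k - 1) c) s,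
         side_boundary Y \<beta> (k - 1) c s)) \<rparr>"

text \<open>
  A family of morphisms of skeleta that is compatible with the projections; these play the role of
  the maps induced by \<open>\<alpha>\<close>.
\<close>

locale skeletal_map = X: cell_tower X + Y: cell_tower Y
  for X :: "'f nccw" and Y :: "'g nccw" +
  fixes \<beta> :: "nat \<Rightarrow> 'f tower \<Rightarrow> 'g tower"
  assumes hom_\<beta>: "\<And>k. cstar_hom (skeleton X k) (skeleton Y k) (\<beta> k)"
    and tail_\<beta>: "\<And>k x. x \<in> skel X (Suc k) \<Longrightarrow> tower_tail (\<beta> (Suc k) x) = \<beta> k (tower_tail x)"
begin

context
  fixes N :: nat
begin

abbreviation "Z \<equiv> cyl_nccw X Y \<beta> N"

lemma fibre_Z: "fibre Z k = direct_sum (fibre X k) (direct_sum (fibre Y k) (side_fibre Y k))"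
  by (simp add: cyl_nccw_def)

lemma attach_Z: "s \<in> cube_boundary (Suc k) \<Longrightarrow> attach Z (Suc k) c s =
    (attach X (Suc k) (top_part k c) s, attach Y (Suc k) (bottom_part k c) s, side_boundary Y \<beta> k c s)"
  by (simp add: cyl_nccw_def)

lemma cstar_side_fibre: "cstar_algebra (side_fibre Y k)"
  using fd_zero_alg[OF Y.fibre[of 0]] by (cases k) (auto simp: fd_cstar_algebra_def Y.fibre)

lemma cstar_fibre_Z: "cstar_algebra (fibre Z k)"
  unfolding fibre_Z by (intro cstar_algebra_direct_sum X.fibre Y.fibre cstar_side_fibre)

lemma hom_component:
  shows "cstar_hom (fibre Z k) (fibre X k) fst"
    and "cstar_hom (fibre Z k) (fibre Y k) (\<lambda>z. fst (snd z))"
    and "cstar_hom (fibre Z k) (side_fibre Y k) (\<lambda>z. snd (snd z))"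
  unfolding fibre_Z
  by (rule cstar_hom_direct_sum_fst
      cstar_hom_compose[OF cstar_hom_direct_sum_snd cstar_hom_direct_sum_fst]
      cstar_hom_compose[OF cstar_hom_direct_sum_snd cstar_hom_direct_sum_snd])+

lemma component_continuous:
  assumes "cstar_algebra F" "cstar_hom (fibre Z k) F p" "c \<in> skel Z k"
  shows "continuous_map (cube k) (ctopology F) (\<lambda>s. p (tower_head c s))"
  using cstar_hom_continuous_map[OF cstar_fibre_Z assms(1,2) head_continuous[OF cstar_fibre_Z assms(3)]] .

lemma component_hom:
  assumes "cstar_hom (fibre Z k) F p" "s \<in> topspace (cube k)"
  shows "cstar_hom (skeleton Z k) F (\<lambda>c. p (tower_head c s))"
  using cstar_hom_compose[OF hom_head_at[OF cstar_fibre_Z assms(2)] assms(1)] .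

lemma component_hom_0:
  assumes "cstar_hom (fibre Z 0) F p"
  shows "cstar_hom (skeleton Z 0) F (\<lambda>c. p (tower_head c s))"
  using cstar_hom_compose[OF hom_head_0 assms] .

text \<open>
  The premise \<open>bd\<close> makes the boundary values of the new cells match, which is what \<open>hom_Glue\<close> asks for.
\<close>

lemma hom_map_tower:
  fixes W :: "'w nccw" and p :: "'f \<times> 'g \<times> 'g \<Rightarrow> 'w"
  assumes W: "cell_tower W"
    and p: "\<And>k. cstar_hom (fibre Z k) (fibre W k) p"
    and bd: "\<And>k c s. \<lbrakk>c \<in> skel Z k; s \<in> cube_boundary (Suc k)\<rbrakk> \<Longrightarrow>
       p (attach Z (Suc k) c s) = attach W (Suc k) (map_tower p k c) s"
  shows "cstar_hom (skeleton Z k) (skeleton W k) (map_tower p k)"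
proof (induction k)
  interpret W: cell_tower W by fact
  case 0
  show ?case unfolding map_tower.simps
    by (intro W.hom_Base component_hom_0 p)
next
  interpret W: cell_tower W by fact
  case (Suc k)
  show ?case unfolding map_tower.simps
  proof (intro W.hom_Glue cstar_hom_into_C_alg)
    show "(\<lambda>t\<in>topspace (cube (Suc k)). p (tower_head c t)) \<in> ccarrier (cell_alg W (Suc k))"
      if "c \<in> skel Z (Suc k)" for c
      using component_continuous[OF W.fibre p that] by (simp add: C_alg_simps)
    show "cstar_hom (skeleton Z (Suc k)) (fibre W (Suc k)) (\<lambda>a. p (tower_head a t))"
      if "t \<in> topspace (cube (Suc k))" for t
      using component_hom[OF p that] .
    show "cstar_hom (skeleton Z (Suc k)) (skeleton W k) (\<lambda>c. map_tower p k (tower_tail c))"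
      by (rule cstar_hom_compose[OF hom_tail Suc])
    show "restrict (\<lambda>t\<in>topspace (cube (Suc k)). p (tower_head c t)) (cube_boundary (Suc k)) =
        attach W (Suc k) (map_tower p k (tower_tail c))" if c: "c \<in> skel Z (Suc k)" for c
    proof (rule extensionalityI[of _ "cube_boundary (Suc k)"])
      have t: "tower_tail c \<in> skel Z k" using tower_tail_mem[OF c] .
      have "map_tower p k (tower_tail c) \<in> skel W k"
        using cstar_homD(1)[OF Suc t] .
      then show "attach W (Suc k) (map_tower p k (tower_tail c)) \<in> extensional (cube_boundary (Suc k))"
        using cstar_homD(1)[OF W.attach] by (simp add: C_alg_simps)
      fix s assume s: "s \<in> cube_boundary (Suc k)"
      then have "s \<in> topspace (cube (Suc k))" using cube_boundary_subset by blast
      then show "restrict (\<lambda>t\<in>topspace (cube (Suc k)). p (tower_head c t)) (cube_boundary (Suc k)) s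
          = attach W (Suc k) (map_tower p k (tower_tail c)) s"
        using s bd[OF t s] tower_head_boundary[OF c s] by simp
    qed (rule restrict_extensional)
  qed
qed

lemma hom_top_part: "cstar_hom (skeleton Z k) (skeleton X k) (top_part k)"
  by (rule hom_map_tower[OF X.cell_tower_axioms hom_component(1)]) (simp add: attach_Z)

lemma hom_bottom_part: "cstar_hom (skeleton Z k) (skeleton Y k) (bottom_part k)"
  by (rule hom_map_tower[OF Y.cell_tower_axioms hom_component(2)]) (simp add: attach_Z)

lemmas top_part_mem = cstar_homD(1)[OF hom_top_part]
  and bottom_part_mem = cstar_homD(1)[OF hom_bottom_part]
  and \<beta>_mem = cstar_homD(1)[OF hom_\<beta>]

lemma side_component_boundary:
  assumes "c \<in> skel Z (Suc k)" "s \<in> cube_boundary (Suc k)"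
  shows "snd (snd (tower_head c s)) = side_boundary Y \<beta> k (tower_tail c) s"
  using tower_head_boundary[OF assms] attach_Z[OF assms(2)] by simp

lemma side_boundary_upd_0:
  "s \<in> topspace (cube k) \<Longrightarrow> side_boundary Y \<beta> k c (s(k := 0)) = tower_head (bottom_part k c) s"
  by (simp add: side_boundary_def cube_restrict_self)

lemma side_boundary_upd_1:
  "s \<in> topspace (cube k) \<Longrightarrow> side_boundary Y \<beta> k c (s(k := 1)) = tower_head (\<beta> k (top_part k c)) s"
  by (simp add: side_boundary_def cube_restrict_self)

lemma side_boundary_upd:
  "s \<in> topspace (cube (Suc k)) \<Longrightarrow> t \<noteq> 0 \<Longrightarrow> t \<noteq> 1 \<Longrightarrow>
    side_boundary Y \<beta> (Suc k) c (s(Suc k := t)) = attach Y (Suc k) (slice k t c) s"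
  by (simp add: side_boundary_def cube_restrict_self)

lemma point_cube_0: "(\<lambda>_. undefined) \<in> topspace (cube 0)" "topspace (cube 0) = {\<lambda>_. undefined}"
  by (simp_all add: topspace_cube)

lemma side_component_continuous:
  assumes c: "c \<in> skel Z (Suc k)"
  shows "continuous_map (cube (Suc k)) (ctopology (fibre Y k)) (\<lambda>s. snd (snd (tower_head c s)))"
  using component_continuous[OF cstar_side_fibre hom_component(3) c] by simp

lemma side_component_upd_continuous:
  assumes c: "c \<in> skel Z (Suc k)"
  shows "continuous_map (prod_topology (top_of_set {0..1}) (cube k)) (ctopology (fibre Y k))
    (\<lambda>(t, s). snd (snd (tower_head c (s(k := t)))))"
  using continuous_map_compose[OF continuous_map_upd_last side_component_continuous[OF c]]
  by (simp add: o_def case_prod_unfold)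

lemma side_component_hom:
  assumes "s \<in> topspace (cube (Suc k))"
  shows "cstar_hom (skeleton Z (Suc k)) (fibre Y k) (\<lambda>c. snd (snd (tower_head c s)))"
  using component_hom[OF hom_component(3) assms] by simp

lemma skeleton_Y_0: "y \<in> skel Y 0 \<Longrightarrow> Base (tower_head y s) = y"
  by (auto simp: skeleton_0_carrier)

text \<open>
  The statements are proved together: a slice lies in the skeleton if its top cell has the right
  boundary values, and at \<open>t = 0\<close> and \<open>t = 1\<close> these are known only because the lower-dimensional
  slices are the ones prescribed by the bottom and the top.
\<close>

lemma slice_faces:
  assumes "c \<in> skel Z (Suc k)"
  shows "(\<forall>t\<in>{0..1}. slice k t c \<in> skel Y k) \<and>
    slice k 0 c = bottom_part k (tower_tail c) \<and> slice k 1 c = \<beta> k (top_part k (tower_tail c))"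
  using assms
proof (induction k arbitrary: c)
  case 0
  have t: "tower_tail c \<in> skel Z 0" using tower_tail_mem[OF 0] .
  let ?o = "\<lambda>_::nat. undefined :: real"
  have bd: "?o(0 := t) \<in> cube_boundary (Suc 0)" if "t = 0 \<or> t = 1" for t
    using that cube_boundary_upd_last[OF point_cube_0(1), of t] by auto
  have "slice 0 t c \<in> skel Y 0" if "t \<in> {0..1}" for t
    using cstar_homD(1)[OF side_component_hom 0] cube_upd_last[OF point_cube_0(1) that]
    by (simp add: Base_mem)
  moreover have "slice 0 0 c = Base (tower_head (bottom_part 0 (tower_tail c)) ?o)"
    using side_component_boundary[OF 0 bd[of 0]] side_boundary_upd_0[OF point_cube_0(1)] by simp
  moreover have "slice 0 1 c = Base (tower_head (\<beta> 0 (top_part 0 (tower_tail c))) ?o)"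
    using side_component_boundary[OF 0 bd[of 1]] side_boundary_upd_1[OF point_cube_0(1)] by simp
  ultimately show ?case
    using skeleton_Y_0 bottom_part_mem[OF t] \<beta>_mem[OF top_part_mem[OF t]] by metis
next
  case (Suc k)
  define d where "d = tower_tail c"
  have d: "d \<in> skel Z (Suc k)" unfolding d_def using tower_tail_mem[OF Suc.prems] .
  note IH = Suc.IH[OF d]
  have bm: "bottom_part (Suc k) d \<in> skel Y (Suc k)" using bottom_part_mem[OF d] .
  have tm: "\<beta> (Suc k) (top_part (Suc k) d) \<in> skel Y (Suc k)"
    using \<beta>_mem[OF top_part_mem[OF d]] .
  have head0: "snd (snd (tower_head c (s(Suc k := 0)))) = tower_head (bottom_part (Suc k) d) s"
    if s: "s \<in> topspace (cube (Suc k))" for s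
    using side_component_boundary[OF Suc.prems, of "s(Suc k := 0)"] cube_boundary_upd_last[OF s, of 0]
      side_boundary_upd_0[OF s] by (simp add: d_def)
  have head1: "snd (snd (tower_head c (s(Suc k := 1)))) = tower_head (\<beta> (Suc k) (top_part (Suc k) d)) s"
    if s: "s \<in> topspace (cube (Suc k))" for s
    using side_component_boundary[OF Suc.prems, of "s(Suc k := 1)"] cube_boundary_upd_last[OF s, of 1]
      side_boundary_upd_1[OF s] by (simp add: d_def)
  have tail0: "tower_tail (bottom_part (Suc k) d) = slice k 0 d" using IH by simp
  have tail1: "tower_tail (\<beta> (Suc k) (top_part (Suc k) d)) = slice k 1 d"
    using IH tail_\<beta>[OF top_part_mem[OF d]] by simp
  have mem: "slice (Suc k) t c \<in> skel Y (Suc k)" if t: "t \<in> {0..1}" for t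
    unfolding slice.simps Glue_mem
  proof (intro conjI)
    have "continuous_map (cube (Suc k)) (prod_topology (top_of_set {0..1}) (cube (Suc k))) (\<lambda>s. (t, s))"
      using t by (intro continuous_map_pairedI) auto
    from continuous_map_compose[OF this side_component_upd_continuous[OF Suc.prems]]
    show "(\<lambda>s\<in>topspace (cube (Suc k)). snd (snd (tower_head c (s(Suc k := t)))))
        \<in> ccarrier (cell_alg Y (Suc k))"
      by (simp add: C_alg_simps o_def)
    show m: "slice k t (tower_tail c) \<in> skel Y k" using IH t by (simp add: d_def)
    show "restrict (\<lambda>s\<in>topspace (cube (Suc k)). snd (snd (tower_head c (s(Suc k := t))))) (cube_boundary (Suc k)) =
        attach Y (Suc k) (slice k t (tower_tail c))"
    proof (rule extensionalityI[of _ "cube_boundary (Suc k)"])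
      show "attach Y (Suc k) (slice k t (tower_tail c)) \<in> extensional (cube_boundary (Suc k))"
        using cstar_homD(1)[OF Y.attach m] by (simp add: C_alg_simps)
      fix s assume s: "s \<in> cube_boundary (Suc k)"
      then have sc: "s \<in> topspace (cube (Suc k))" using cube_boundary_subset by blast
      have "snd (snd (tower_head c (s(Suc k := t)))) = attach Y (Suc k) (slice k t d) s"
      proof -
        consider "t = 0" | "t = 1" | "t \<noteq> 0" "t \<noteq> 1" by blast
        then show ?thesis
        proof cases
          case 1
          then show ?thesis using head0[OF sc] tower_head_boundary[OF bm s] tail0 by simp
        next
          case 2
          then show ?thesis using head1[OF sc] tower_head_boundary[OF tm s] tail1 by simp
        next
          case 3
          have "s(Suc k := t) \<in> cube_boundary (Suc (Suc k))"
            using cube_boundary_upd_last[OF sc t] s by simp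
          then show ?thesis
            using side_component_boundary[OF Suc.prems] side_boundary_upd[OF sc 3] by (simp add: d_def)
        qed
      qed
      then show "restrict (\<lambda>s\<in>topspace (cube (Suc k)). snd (snd (tower_head c (s(Suc k := t))))) (cube_boundary (Suc k)) s =
        attach Y (Suc k) (slice k t (tower_tail c)) s" using s sc by (simp add: d_def)
    qed (rule restrict_extensional)
  qed
  have "slice (Suc k) 0 c = bottom_part (Suc k) d"
  proof (rule tower_eqI_Suc[OF mem bm])
    show "tower_head (slice (Suc k) 0 c) s = tower_head (bottom_part (Suc k) d) s"
      if "s \<in> topspace (cube (Suc k))" for s using head0[OF that] that by simp
    show "tower_tail (slice (Suc k) 0 c) = tower_tail (bottom_part (Suc k) d)"
      unfolding tail0 by (simp add: d_def)
  qed simp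
  moreover have "slice (Suc k) 1 c = \<beta> (Suc k) (top_part (Suc k) d)"
  proof (rule tower_eqI_Suc[OF mem tm])
    show "tower_head (slice (Suc k) 1 c) s = tower_head (\<beta> (Suc k) (top_part (Suc k) d)) s"
      if "s \<in> topspace (cube (Suc k))" for s using head1[OF that] that by simp
    show "tower_tail (slice (Suc k) 1 c) = tower_tail (\<beta> (Suc k) (top_part (Suc k) d))"
      unfolding tail1 by (simp add: d_def)
  qed simp
  ultimately show ?case using mem by (auto simp: d_def)
qed

lemma slice_mem: "c \<in> skel Z (Suc k) \<Longrightarrow> t \<in> {0..1} \<Longrightarrow> slice k t c \<in> skel Y k"
  and slice_0: "c \<in> skel Z (Suc k) \<Longrightarrow> slice k 0 c = bottom_part k (tower_tail c)"
  and slice_1: "c \<in> skel Z (Suc k) \<Longrightarrow> slice k 1 c = \<beta> k (top_part k (tower_tail c))"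
  using slice_faces by blast+

lemma slice_Suc_boundary:
  assumes "c \<in> skel Z (Suc (Suc k))" "t \<in> {0..1}"
  shows "restrict (\<lambda>s\<in>topspace (cube (Suc k)). snd (snd (tower_head c (s(Suc k := t))))) (cube_boundary (Suc k)) =
        attach Y (Suc k) (slice k t (tower_tail c))"
  using slice_mem[OF assms] by (simp add: Glue_mem)

lemma hom_slice:
  assumes t: "t \<in> {0..1}"
  shows "cstar_hom (skeleton Z (Suc k)) (skeleton Y k) (slice k t)"
proof (induction k)
  case 0
  show ?case unfolding slice.simps
    by (intro Y.hom_Base side_component_hom) (rule cube_upd_last[OF point_cube_0(1) t])
next
  case (Suc k)
  show ?case unfolding slice.simps
  proof (intro Y.hom_Glue cstar_hom_into_C_alg)
    show "(\<lambda>s\<in>topspace (cube (Suc k)). snd (snd (tower_head c (s(Suc k := t)))))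
        \<in> ccarrier (cell_alg Y (Suc k))"
      if "c \<in> skel Z (Suc (Suc k))" for c
      using slice_mem[OF that t] by (simp add: Glue_mem)
    show "cstar_hom (skeleton Z (Suc (Suc k))) (fibre Y (Suc k)) (\<lambda>c. snd (snd (tower_head c (s(Suc k := t)))))"
      if "s \<in> topspace (cube (Suc k))" for s
      by (rule side_component_hom[OF cube_upd_last[OF that t]])
    show "cstar_hom (skeleton Z (Suc (Suc k))) (skeleton Y k) (\<lambda>c. slice k t (tower_tail c))"
      by (rule cstar_hom_compose[OF hom_tail Suc])
  qed (rule slice_Suc_boundary[OF _ t])
qed

lemma slice_continuous:
  assumes "c \<in> skel Z (Suc k)"
  shows "continuous_map (top_of_set {0..1}) (ctopology (skeleton Y k)) (\<lambda>t. slice k t c)"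
  using assms
proof (induction k arbitrary: c)
  case 0
  have "continuous_map (top_of_set {0..1::real}) (prod_topology (top_of_set {0..1}) (cube 0)) (\<lambda>t. (t, \<lambda>_. undefined))"
    using point_cube_0 by (intro continuous_map_pairedI) auto
  from continuous_map_compose[OF this side_component_upd_continuous[OF 0]]
  show ?case unfolding slice.simps by (intro Y.continuous_map_Base) (simp add: o_def)
next
  case (Suc k)
  show ?case unfolding slice.simps
  proof (rule Y.continuous_map_Glue)
    show "continuous_map (top_of_set {0..1}) (ctopology (cell_alg Y (Suc k)))
       (\<lambda>t. \<lambda>s\<in>topspace (cube (Suc k)). snd (snd (tower_head c (s(Suc k := t)))))"
      using continuous_map_curry[OF Y.fibre compact_space_cube side_component_upd_continuous[OF Suc.prems]] by simp
    show "continuous_map (top_of_set {0..1}) (ctopology (skeleton Y k)) (\<lambda>t. slice k t (tower_tail c))"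
      by (rule Suc.IH[OF tower_tail_mem[OF Suc.prems]])
  qed (rule slice_Suc_boundary[OF Suc.prems], simp)
qed

text \<open>
  The bottom face, the top face and the side are closed and cover the boundary, and the three
  formulas agree where the side meets a face.  On the side, \<open>t \<mapsto> \<sigma>(g t)\<close> is continuous into the
  function algebra of the sphere, where \<open>\<sigma>\<close> is the attaching map, and uncurrying gives joint continuity.
\<close>

lemma side_boundary_continuous:
  assumes c: "c \<in> skel Z k"
  shows "continuous_map (sphere_top (Suc k)) (ctopology (fibre Y k)) (side_boundary Y \<beta> k c)"
proof -
  let ?S = "sphere_top (Suc k)" and ?F = "ctopology (fibre Y k)"
  define T :: "nat \<Rightarrow> (nat \<Rightarrow> real) set" where
    "T i = (if i = 0 then {s \<in> cube_boundary (Suc k). s k \<in> {0}}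
      else if i = 1 then {s \<in> cube_boundary (Suc k). s k \<in> {1}}
      else {s \<in> cube_boundary (Suc k). restrict s {..<k} \<in> cube_boundary k})" for i
  define f :: "nat \<Rightarrow> (nat \<Rightarrow> real) \<Rightarrow> 'g" where
    "f i s = (if i = 0 then tower_head (bottom_part k c) (restrict s {..<k})
      else if i = 1 then tower_head (\<beta> k (top_part k c)) (restrict s {..<k})
      else attach Y k (slice (k - 1) (s k) c) (restrict s {..<k}))" for i s
  note bm = bottom_part_mem[OF c] and tm = \<beta>_mem[OF top_part_mem[OF c]]
  have last: "continuous_map ?S (top_of_set {0..1}) (\<lambda>s. s k)"
    unfolding sphere_top_def by (rule continuous_map_from_subtopology[OF continuous_map_cube_last])
  then have last': "continuous_map ?S euclideanreal (\<lambda>s. s k)"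
    by (simp add: continuous_map_in_subtopology)
  have restr: "continuous_map ?S (cube k) (\<lambda>s. restrict s {..<k})"
    unfolding sphere_top_def by (rule continuous_map_from_subtopology[OF continuous_map_cube_restrict])
  show ?thesis
  proof (rule pasting_lemma_closed[where I = "{0, 1, 2}" and T = T and f = f])
    show "closedin ?S (T i)" if "i \<in> {0, 1, 2}" for i
      using closedin_continuous_map_preimage[OF last', of "{0}"] closedin_continuous_map_preimage[OF last', of "{1}"]
        closedin_continuous_map_preimage[OF restr closedin_cube_boundary]
      by (auto simp: T_def)
    show "continuous_map (subtopology ?S (T i)) ?F (f i)" if i: "i \<in> {0, 1, 2}" for i
    proof -
      consider "i = 0" | "i = 1" | "i = 2" using i by blast
      then show ?thesis
      proof cases
        case 1
        have "continuous_map ?S ?F (f 0)"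
          using continuous_map_compose[OF restr head_continuous[OF Y.fibre bm]] by (simp add: f_def[abs_def] o_def)
        then show ?thesis unfolding 1 by (rule continuous_map_from_subtopology)
      next
        case 2
        have "continuous_map ?S ?F (f 1)"
          using continuous_map_compose[OF restr head_continuous[OF Y.fibre tm]] by (simp add: f_def[abs_def] o_def)
        then show ?thesis unfolding 2 by (rule continuous_map_from_subtopology)
      next
        case 3
        show ?thesis
        proof (cases k)
          case 0
          then have "T 2 = {}" by (auto simp: T_def mem_cube_boundary)
          then show ?thesis unfolding 3 by simp
        next
          case (Suc j)
          have "continuous_map (subtopology ?S (T 2)) (sphere_top k) (\<lambda>s. restrict s {..<k})"
            unfolding sphere_top_def[of k]
            by (intro continuous_map_into_subtopology continuous_map_from_subtopology[OF restr])
               (auto simp: T_def)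
          then have pair: "continuous_map (subtopology ?S (T 2)) (prod_topology (top_of_set {0..1}) (sphere_top k))
              (\<lambda>s. (s k, restrict s {..<k}))"
            by (intro continuous_map_pairedI continuous_map_from_subtopology[OF last])
          have "continuous_map (top_of_set {0..1}) (ctopology (C_alg (sphere_top k) (fibre Y k)))
              (\<lambda>t. attach Y k (slice j t c))"
            using cstar_hom_continuous_map[OF Y.cstar_skeleton Y.cstar_sphere Y.attach slice_continuous] c
            unfolding Suc by blast
          from continuous_map_compose[OF pair continuous_map_uncurry[OF Y.fibre compact_space_sphere_top this]]
          show ?thesis unfolding 3 by (simp add: f_def[abs_def] o_def Suc)
        qed
      qed
    qed
    have agree: "attach Y k (slice (k - 1) 0 c) s = tower_head (bottom_part k c) s"
      "attach Y k (slice (k - 1) 1 c) s = tower_head (\<beta> k (top_part k c)) s"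
      if s: "s \<in> cube_boundary k" for s
    proof -
      obtain j where k: "k = Suc j" using s by (cases k) (auto simp: mem_cube_boundary)
      have c': "c \<in> skel Z (Suc j)" using c k by simp
      show "attach Y k (slice (k - 1) 0 c) s = tower_head (bottom_part k c) s"
        using tower_head_boundary[OF bm[unfolded k] s[unfolded k]] slice_0[OF c'] by (simp add: k)
      show "attach Y k (slice (k - 1) 1 c) s = tower_head (\<beta> k (top_part k c)) s"
        using tower_head_boundary[OF tm[unfolded k] s[unfolded k]] slice_1[OF c'] tail_\<beta>[OF top_part_mem[OF c']]
        by (simp add: k)
    qed
    show "f i s = f j s" if "i \<in> {0, 1, 2}" "j \<in> {0, 1, 2}" "s \<in> topspace ?S \<inter> T i \<inter> T j" for i j s
      using that agree by (auto simp: T_def f_def)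
    show "\<exists>j. j \<in> {0, 1, 2} \<and> s \<in> T j \<and> side_boundary Y \<beta> k c s = f j s" if s: "s \<in> topspace ?S" for s
    proof -
      consider "s k = 0" | "s k = 1" | "s k \<noteq> 0" "s k \<noteq> 1" by blast
      then show ?thesis
      proof cases
        case 1
        then show ?thesis using s by (intro exI[of _ 0]) (simp add: T_def f_def side_boundary_def)
      next
        case 2
        then show ?thesis using s by (intro exI[of _ 1]) (simp add: T_def f_def side_boundary_def)
      next
        case 3
        then show ?thesis using s cube_boundary_restrict[of s k]
          by (intro exI[of _ 2]) (simp add: T_def f_def side_boundary_def)
      qed
    qed
  qed simp
qed

lemma hom_side_boundary:
  assumes s: "s \<in> cube_boundary (Suc k)"
  shows "cstar_hom (skeleton Z k) (fibre Y k) (\<lambda>c. side_boundary Y \<beta> k c s)"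
proof -
  let ?s = "restrict s {..<k}"
  have s': "?s \<in> topspace (cube k)" and t: "s k \<in> {0..1}"
    using s cube_boundary_subset cube_restrict cube_last by blast+
  consider "s k = 0" | "s k = 1" | "s k \<noteq> 0" "s k \<noteq> 1" by blast
  then show ?thesis
  proof cases
    case 1
    then show ?thesis
      using cstar_hom_compose[OF hom_bottom_part hom_head_at[OF Y.fibre s']] by (simp add: side_boundary_def)
  next
    case 2
    then show ?thesis
      using cstar_hom_compose[OF cstar_hom_compose[OF hom_top_part hom_\<beta>] hom_head_at[OF Y.fibre s']]
      by (simp add: side_boundary_def)
  next
    case 3
    then have bd: "?s \<in> cube_boundary k" using cube_boundary_restrict s by blast
    then obtain j where k: "k = Suc j" by (cases k) (auto simp: mem_cube_boundary)
    have "cstar_hom (C_alg (sphere_top k) (fibre Y k)) (fibre Y k) (\<lambda>f. f ?s)"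
      using bd by (intro cstar_hom_eval Y.fibre) simp
    from cstar_hom_compose[OF cstar_hom_compose[OF hom_slice[OF t, of j] Y.attach] this[unfolded k]]
    show ?thesis using 3 by (simp add: side_boundary_def k)
  qed
qed

lemma attach_Z_eq: "attach Z (Suc k) c = (\<lambda>s\<in>topspace (sphere_top (Suc k)).
    (attach X (Suc k) (top_part k c) s, attach Y (Suc k) (bottom_part k c) s, side_boundary Y \<beta> k c s))"
  by (simp add: cyl_nccw_def)

lemma hom_attach_Z:
  "cstar_hom (skeleton Z k) (C_alg (sphere_top (Suc k)) (fibre Z (Suc k))) (attach Z (Suc k))"
  unfolding attach_Z_eq[abs_def]
proof (rule cstar_hom_into_C_alg)
  fix c assume c: "c \<in> skel Z k"
  have "continuous_map (sphere_top (Suc k)) (ctopology (fibre X (Suc k))) (attach X (Suc k) (top_part k c))"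
    using cstar_homD(1)[OF X.attach top_part_mem[OF c]] by (simp add: C_alg_simps)
  moreover have "continuous_map (sphere_top (Suc k)) (ctopology (fibre Y (Suc k))) (attach Y (Suc k) (bottom_part k c))"
    using cstar_homD(1)[OF Y.attach bottom_part_mem[OF c]] by (simp add: C_alg_simps)
  ultimately show "(\<lambda>s\<in>topspace (sphere_top (Suc k)).
      (attach X (Suc k) (top_part k c) s, attach Y (Suc k) (bottom_part k c) s, side_boundary Y \<beta> k c s))
    \<in> ccarrier (C_alg (sphere_top (Suc k)) (fibre Z (Suc k)))"
    using continuous_map_into_direct_sum[OF X.fibre cstar_algebra_direct_sum[OF Y.fibre Y.fibre] _
        continuous_map_into_direct_sum[OF Y.fibre Y.fibre _ side_boundary_continuous[OF c]]]
    by (simp add: C_alg_simps fibre_Z)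
next
  fix s assume s: "s \<in> topspace (sphere_top (Suc k))"
  have "cstar_hom (skeleton Z k) (fibre X (Suc k)) (\<lambda>c. attach X (Suc k) (top_part k c) s)"
    by (rule cstar_hom_compose[OF cstar_hom_compose[OF hom_top_part X.attach] cstar_hom_eval[OF s X.fibre]])
  moreover have "cstar_hom (skeleton Z k) (fibre Y (Suc k)) (\<lambda>c. attach Y (Suc k) (bottom_part k c) s)"
    by (rule cstar_hom_compose[OF cstar_hom_compose[OF hom_bottom_part Y.attach] cstar_hom_eval[OF s Y.fibre]])
  ultimately show "cstar_hom (skeleton Z k) (fibre Z (Suc k)) (\<lambda>c. (attach X (Suc k) (top_part k c) s,
      attach Y (Suc k) (bottom_part k c) s, side_boundary Y \<beta> k c s))"
    using hom_side_boundary s unfolding fibre_Z by (intro cstar_hom_into_direct_sum) simp_all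
qed

lemma cell_tower_Z: "cell_tower Z"
  by (rule cell_tower.intro[OF cstar_fibre_Z hom_attach_Z])

end

end

section \<open>The skeleta of the cylinder complex\<close>

abbreviation "unit_interval \<equiv> top_of_set {0..1::real}"

context skeletal_map
begin

text \<open>
  The algebra of triples \<open>(x, y, g)\<close>, in which both ends of the path \<open>g\<close> are prescribed.
\<close>

definition double_cyl :: "nat \<Rightarrow> ('f tower \<times> 'g tower \<times> (real \<Rightarrow> 'g tower)) cstar_alg" where
  "double_cyl k = pullback (skeleton X (Suc k))
     (pullback (skeleton Y (Suc k)) (C_alg unit_interval (skeleton Y k)) tower_tail (\<lambda>g. g 0))
     (\<lambda>x. \<beta> k (tower_tail x)) (\<lambda>p. snd p 1)"

lemma double_cyl_mem: "(x, y, g) \<in> ccarrier (double_cyl k) \<longleftrightarrow>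
    x \<in> skel X (Suc k) \<and> y \<in> skel Y (Suc k) \<and>
    g \<in> ccarrier (C_alg unit_interval (skeleton Y k)) \<and> tower_tail y = g 0 \<and> g 1 = \<beta> k (tower_tail x)"
  by (auto simp: double_cyl_def pullback_simps)

definition decompose :: "nat \<Rightarrow> ('f \<times> 'g \<times> 'g) tower \<Rightarrow> 'f tower \<times> 'g tower \<times> (real \<Rightarrow> 'g tower)" where
  "decompose k c = (top_part (Suc k) c, bottom_part (Suc k) c, \<lambda>t\<in>topspace unit_interval. slice k t c)"

context
  fixes N :: nat
begin

lemma hom_decompose: "cstar_hom (skeleton (Z N) (Suc k)) (double_cyl k) (decompose k)"
  unfolding decompose_def[abs_def] double_cyl_def
proof (intro cstar_hom_into_pullback hom_top_part hom_bottom_part cstar_hom_into_C_alg)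
  fix c assume c: "c \<in> skel (Z N) (Suc k)"
  show "(\<lambda>t\<in>topspace unit_interval. slice k t c) \<in> ccarrier (C_alg unit_interval (skeleton Y k))"
    using slice_continuous[OF c] by (simp add: C_alg_simps)
  show "tower_tail (bottom_part (Suc k) c) = (\<lambda>t\<in>topspace unit_interval. slice k t c) 0"
    using slice_0[OF c] by simp
  show "\<beta> k (tower_tail (top_part (Suc k) c)) =
      snd (bottom_part (Suc k) c, \<lambda>t\<in>topspace unit_interval. slice k t c) 1"
    using slice_1[OF c] by simp
next
  show "cstar_hom (skeleton (Z N) (Suc k)) (skeleton Y k) (slice k t)" if "t \<in> topspace unit_interval" for t
    using that hom_slice by simp
qed

lemma head_eqD:
  assumes "map_tower p k c = map_tower p k d" "s \<in> topspace (cube k)"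
    and "c \<in> skel (Z N) k" "d \<in> skel (Z N) k"
  shows "p (tower_head c s) = p (tower_head d s)"
proof (cases k)
  case 0
  then show ?thesis using assms by (auto simp: skeleton_0_carrier)
next
  case (Suc j)
  then have "(\<lambda>s\<in>topspace (cube k). p (tower_head c s)) = (\<lambda>s\<in>topspace (cube k). p (tower_head d s))"
    using assms by simp
  from fun_cong[OF this, of s] show ?thesis using assms(2) by simp
qed

lemma skeleton_0_eqI:
  assumes c: "c \<in> skel (Z N) 0" and d: "d \<in> skel (Z N) 0"
    and eq: "top_part 0 c = top_part 0 d" "bottom_part 0 c = bottom_part 0 d"
  shows "c = d"
proof -
  obtain x where x: "c = Base x" "x \<in> ccarrier (fibre (Z N) 0)" using c by (auto simp: skeleton_0_carrier)
  obtain y where y: "d = Base y" "y \<in> ccarrier (fibre (Z N) 0)" using d by (auto simp: skeleton_0_carrier)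
  have "snd (snd x) = snd (snd y)"
    using x(2) y(2) by (auto simp: fibre_Z direct_sum_simps)
  then show ?thesis using eq x y by (auto simp: prod_eq_iff)
qed

lemma slice_eqD:
  assumes "s \<in> topspace (cube (Suc k))" "slice k (s k) c = slice k (s k) d"
  shows "snd (snd (tower_head c s)) = snd (snd (tower_head d s))"
proof (cases k)
  case 0
  have "restrict s {..<0} = (\<lambda>_. undefined)" by auto
  then have "(\<lambda>_. undefined)(0 := s 0) = s"
    using cube_upd_restrict[of s 0] assms(1) 0 by simp
  then show ?thesis using assms(2) 0 by simp
next
  case (Suc j)
  let ?s = "restrict s {..<k}"
  have s: "?s \<in> topspace (cube k)" using cube_restrict assms(1) by blast
  have "(\<lambda>r\<in>topspace (cube k). snd (snd (tower_head c (r(k := s k)))))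
      = (\<lambda>r\<in>topspace (cube k). snd (snd (tower_head d (r(k := s k)))))"
    using assms(2) unfolding Suc by simp
  from fun_cong[OF this, of ?s] show ?thesis
    using s cube_upd_restrict[OF assms(1)] by simp
qed

text \<open>
  The value of the third component at a point \<open>s\<close> of the cube is seen by the slice at \<open>t = s k\<close>.
\<close>

lemma decompose_inj:
  assumes "c \<in> skel (Z N) (Suc k)" "d \<in> skel (Z N) (Suc k)"
    and "top_part (Suc k) c = top_part (Suc k) d" "bottom_part (Suc k) c = bottom_part (Suc k) d"
    and "\<And>t. t \<in> {0..1} \<Longrightarrow> slice k t c = slice k t d"
  shows "c = d"
  using assms
proof (induction k arbitrary: c d)
  case 0
  show ?case
  proof (rule tower_eqI_Suc[OF 0(1,2)])
    show "tower_head c s = tower_head d s" if s: "s \<in> topspace (cube (Suc 0))" for s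
      using head_eqD[OF 0(3) s 0(1,2)] head_eqD[OF 0(4) s 0(1,2)]
        slice_eqD[OF s 0(5)[OF cube_last[OF s]]] by (simp add: prod_eq_iff)
    show "tower_tail c = tower_tail d"
      using 0(3,4) by (intro skeleton_0_eqI tower_tail_mem 0(1,2)) auto
  qed
next
  case (Suc k)
  note p = Suc.prems
  show ?case
  proof (rule tower_eqI_Suc[OF p(1,2)])
    show "tower_head c s = tower_head d s" if s: "s \<in> topspace (cube (Suc (Suc k)))" for s
      using head_eqD[OF p(3) s p(1,2)] head_eqD[OF p(4) s p(1,2)]
        slice_eqD[OF s p(5)[OF cube_last[OF s]]] by (simp add: prod_eq_iff)
    show "tower_tail c = tower_tail d"
    proof (rule Suc.IH[OF tower_tail_mem[OF p(1)] tower_tail_mem[OF p(2)]])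
      show "slice k t (tower_tail c) = slice k t (tower_tail d)" if "t \<in> {0..1}" for t
        using p(5)[OF that] by simp
    qed (use p(3,4) in auto)
  qed
qed

text \<open>
  If \<open>c'\<close> decomposes into the images of \<open>x\<close>, \<open>y\<close> and \<open>g\<close> in the lower skeleta, a cell with the
  top cells of \<open>x\<close>, \<open>y\<close> and \<open>g\<close> as its components can be glued to it.  For \<open>k = 0\<close> there are no
  lower slices, which is why the premise \<open>sl\<close> is conditional.
\<close>

lemma assemble_step:
  assumes xyg: "(x, y, g) \<in> ccarrier (double_cyl k)" and c': "c' \<in> skel (Z N) k"
    and eq: "top_part k c' = tower_tail x" "bottom_part k c' = tower_tail y"
    and sl: "\<And>j t. k = Suc j \<Longrightarrow> t \<in> {0..1} \<Longrightarrow> slice j t c' = tower_tail (g t)"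
  shows "\<exists>c\<in>skel (Z N) (Suc k). top_part (Suc k) c = x \<and> bottom_part (Suc k) c = y \<and>
    (\<forall>t\<in>{0..1}. slice k t c = g t)"
proof -
  have x: "x \<in> skel X (Suc k)" and y: "y \<in> skel Y (Suc k)"
    and g: "continuous_map unit_interval (ctopology (skeleton Y k)) g"
    and g0: "g 0 = tower_tail y" and g1: "g 1 = \<beta> k (tower_tail x)"
    using xyg by (auto simp: double_cyl_mem C_alg_simps)
  have gm: "g t \<in> skel Y k" if "t \<in> {0..1}" for t
    using cstar_algebra.continuous_map_in_carrier[OF Y.cstar_skeleton g] that by simp
  define h where "h = (\<lambda>s\<in>topspace (cube (Suc k)).
    (tower_head x s, tower_head y s, tower_head (g (s k)) (restrict s {..<k})))"
  define c where "c = Glue h c'"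
  have pair: "continuous_map (cube (Suc k)) (prod_topology unit_interval (cube k)) (\<lambda>s. (s k, restrict s {..<k}))"
    by (intro continuous_map_pairedI continuous_map_cube_last continuous_map_cube_restrict)
  have "continuous_map (cube (Suc k)) (ctopology (fibre Y k)) (\<lambda>s. tower_head (g (s k)) (restrict s {..<k}))"
    using continuous_map_compose[OF pair Y.continuous_map_head_joint[OF g]] by (simp add: o_def)
  then have hc: "h \<in> ccarrier (cell_alg (Z N) (Suc k))"
    unfolding h_def
    using continuous_map_into_direct_sum[OF X.fibre cstar_algebra_direct_sum[OF Y.fibre Y.fibre]
        head_continuous[OF X.fibre x]
        continuous_map_into_direct_sum[OF Y.fibre Y.fibre head_continuous[OF Y.fibre y]]]
    by (simp add: C_alg_simps fibre_Z)
  have "restrict h (cube_boundary (Suc k)) = attach (Z N) (Suc k) c'"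
  proof (rule extensionalityI[of _ "cube_boundary (Suc k)"])
    show "attach (Z N) (Suc k) c' \<in> extensional (cube_boundary (Suc k))"
      by (simp add: cyl_nccw_def)
    fix s assume s: "s \<in> cube_boundary (Suc k)"
    then have sc: "s \<in> topspace (cube (Suc k))" using cube_boundary_subset by blast
    have "tower_head (g (s k)) (restrict s {..<k}) = side_boundary Y \<beta> k c' s"
    proof -
      consider "s k = 0" | "s k = 1" | "s k \<noteq> 0" "s k \<noteq> 1" by blast
      then show ?thesis
      proof cases
        case 1
        then show ?thesis by (simp add: side_boundary_def g0 eq)
      next
        case 2
        then show ?thesis by (simp add: side_boundary_def g1 eq)
      next
        case 3
        then have bd: "restrict s {..<k} \<in> cube_boundary k" using cube_boundary_restrict s by blast
        then obtain j where k: "k = Suc j" by (cases k) (auto simp: mem_cube_boundary)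
        have "g (s k) \<in> skel Y (Suc j)" using gm[OF cube_last[OF sc]] k by simp
        from tower_head_boundary[OF this bd[unfolded k]] show ?thesis
          using 3 sl[OF k cube_last[OF sc]] by (simp add: side_boundary_def k)
      qed
    qed
    then show "restrict h (cube_boundary (Suc k)) s = attach (Z N) (Suc k) c' s"
      using s sc by (simp add: attach_Z h_def eq tower_head_boundary[OF x s] tower_head_boundary[OF y s])
  qed (rule restrict_extensional)
  then have c: "c \<in> skel (Z N) (Suc k)"
    unfolding c_def Glue_mem using hc c' by blast
  moreover have "top_part (Suc k) c = x"
    by (rule tower_eqI_Suc[OF top_part_mem[OF c] x]) (simp_all add: c_def h_def eq)
  moreover have "bottom_part (Suc k) c = y"
    by (rule tower_eqI_Suc[OF bottom_part_mem[OF c] y]) (simp_all add: c_def h_def eq)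
  moreover have "slice k t c = g t" if t: "t \<in> {0..1}" for t
  proof -
    have head: "snd (snd (tower_head c (s(k := t)))) = tower_head (g t) s" if s: "s \<in> topspace (cube k)" for s
      using cube_upd_last[OF s t] s by (simp add: c_def h_def cube_restrict_self)
    show ?thesis
    proof (cases k)
      case 0
      show ?thesis
        using head[unfolded 0, OF point_cube_0(1)] skeleton_Y_0[of "g t"] gm[OF t]
          skeleton_0_carrier[of Y] 0 by auto
    next
      case (Suc j)
      show ?thesis unfolding Suc
      proof (rule tower_eqI_Suc)
        show "slice (Suc j) t c \<in> skel Y (Suc j)"
          using slice_mem[OF c t] Suc by simp
        show "g t \<in> skel Y (Suc j)" using gm[OF t] Suc by simp
        show "tower_head (slice (Suc j) t c) s = tower_head (g t) s" if "s \<in> topspace (cube (Suc j))" for s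
          using head[of s] that Suc by simp
        show "tower_tail (slice (Suc j) t c) = tower_tail (g t)"
          using sl[OF Suc t] by (simp add: c_def)
      qed
    qed
  qed
  ultimately show ?thesis by blast
qed

lemma tail_double_cyl:
  assumes "(x, y, g) \<in> ccarrier (double_cyl (Suc k))"
  shows "(tower_tail x, tower_tail y, \<lambda>t\<in>{0..1}. tower_tail (g t)) \<in> ccarrier (double_cyl k)"
proof -
  have x: "x \<in> skel X (Suc (Suc k))" and y: "y \<in> skel Y (Suc (Suc k))"
    and g: "continuous_map unit_interval (ctopology (skeleton Y (Suc k))) g"
    and g0: "g 0 = tower_tail y" and g1: "g 1 = \<beta> (Suc k) (tower_tail x)"
    using assms by (auto simp: double_cyl_mem C_alg_simps)
  have "continuous_map unit_interval (ctopology (skeleton Y k)) (\<lambda>t\<in>topspace unit_interval. tower_tail (g t))"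
    using Y.continuous_map_tail[OF g] by simp
  then show ?thesis
    using g0 g1 tail_\<beta>[OF tower_tail_mem[OF x]] tower_tail_mem[OF x] tower_tail_mem[OF y]
    by (simp add: double_cyl_mem C_alg_simps)
qed

lemma decompose_surj:
  assumes "(x, y, g) \<in> ccarrier (double_cyl k)"
  shows "\<exists>c\<in>skel (Z N) (Suc k). top_part (Suc k) c = x \<and> bottom_part (Suc k) c = y \<and>
    (\<forall>t\<in>{0..1}. slice k t c = g t)"
  using assms
proof (induction k arbitrary: x y g)
  case 0
  have "x \<in> skel X (Suc 0)" "y \<in> skel Y (Suc 0)"
    using 0 unfolding double_cyl_mem by blast+
  then have x: "tower_tail x \<in> skel X 0" and y: "tower_tail y \<in> skel Y 0"
    by (simp_all add: tower_tail_mem)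
  obtain u where u: "tower_tail x = Base u" "u \<in> ccarrier (fibre X 0)"
    using x by (auto simp: skeleton_0_carrier)
  obtain v where v: "tower_tail y = Base v" "v \<in> ccarrier (fibre Y 0)"
    using y by (auto simp: skeleton_0_carrier)
  let ?c = "Base (u, v, czero (fibre Y 0))"
  have "?c \<in> skel (Z N) 0"
    using u v by (simp add: Base_mem fibre_Z direct_sum_simps)
  then show ?case using u v by (intro assemble_step[OF 0]) auto
next
  case (Suc k)
  obtain c' where "c' \<in> skel (Z N) (Suc k)" "top_part (Suc k) c' = tower_tail x"
    "bottom_part (Suc k) c' = tower_tail y" "\<forall>t\<in>{0..1}. slice k t c' = (\<lambda>t\<in>{0..1}. tower_tail (g t)) t"
    using Suc.IH[OF tail_double_cyl[OF Suc.prems]] by blast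
  then show ?case by (intro assemble_step[OF Suc.prems]) auto
qed

theorem skeleton_Z_isomorphic: "cstar_isomorphic (skeleton (Z N) (Suc k)) (double_cyl k)"
  unfolding cstar_isomorphic_def
proof (intro exI conjI)
  show "cstar_hom (skeleton (Z N) (Suc k)) (double_cyl k) (decompose k)" by (rule hom_decompose)
  show "bij_betw (decompose k) (skel (Z N) (Suc k)) (ccarrier (double_cyl k))"
    unfolding bij_betw_def
  proof (intro conjI inj_onI)
    fix c d assume c: "c \<in> skel (Z N) (Suc k)" and d: "d \<in> skel (Z N) (Suc k)"
      and eq: "decompose k c = decompose k d"
    have "(\<lambda>t\<in>{0..1}. slice k t c) = (\<lambda>t\<in>{0..1}. slice k t d)"
      using eq by (simp add: decompose_def)
    from fun_cong[OF this] have "slice k t c = slice k t d" if "t \<in> {0..1}" for t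
      using that by (metis restrict_apply')
    then show "c = d" using eq by (intro decompose_inj[OF c d]) (simp_all add: decompose_def)
  next
    show "decompose k ` skel (Z N) (Suc k) = ccarrier (double_cyl k)"
    proof
      show "decompose k ` skel (Z N) (Suc k) \<subseteq> ccarrier (double_cyl k)"
        using cstar_homD(1)[OF hom_decompose] by blast
      show "ccarrier (double_cyl k) \<subseteq> decompose k ` skel (Z N) (Suc k)"
      proof
        fix p assume p: "p \<in> ccarrier (double_cyl k)"
        obtain x y g where xyg: "p = (x, y, g)" by (cases p)
        from decompose_surj[OF p[unfolded xyg]] obtain c where c: "c \<in> skel (Z N) (Suc k)"
          "top_part (Suc k) c = x" "bottom_part (Suc k) c = y" "\<forall>t\<in>{0..1}. slice k t c = g t" by blast
        have "g \<in> extensional {0..1}" using p by (simp add: xyg double_cyl_mem C_alg_simps)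
        then have "(\<lambda>t\<in>{0..1}. slice k t c) = g"
          using c(4) by (intro extensionalityI[of _ "{0..1}"]) auto
        then have "decompose k c = p" using c by (simp add: decompose_def xyg)
        then show "p \<in> decompose k ` skel (Z N) (Suc k)" using c(1) by blast
      qed
    qed
  qed
qed

end

end

section \<open>Padding by zero cells\<close>

text \<open>
  Zero fibres above the dimension make skeleta of all dimensions available, so that two complexes
  of different dimensions can be compared level by level.
\<close>

definition pad :: "'f nccw \<Rightarrow> 'f nccw" where
  "pad X = \<lparr> nc_dim = nc_dim X,
     fibre = (\<lambda>k. if k \<le> nc_dim X then fibre X k else zero_alg (fibre X 0)),
     attach = (\<lambda>k. if k \<le> nc_dim X then attach X k else (\<lambda>a. \<lambda>s\<in>cube_boundary k. czero (fibre X 0))) \<rparr>"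

primrec add_zero_cells :: "'f nccw \<Rightarrow> nat \<Rightarrow> 'f tower \<Rightarrow> 'f tower" where
  "add_zero_cells X 0 a = a"
| "add_zero_cells X (Suc d) a =
     Glue (\<lambda>s\<in>topspace (cube (nc_dim X + Suc d)). czero (fibre X 0)) (add_zero_cells X d a)"

text \<open>
  The canonical map from the algebra of \<open>X\<close> to the \<open>k\<close>-th skeleton of the padded complex: a projection
  up to the dimension of \<open>X\<close>, and an isomorphism from there on.
\<close>

definition to_level :: "'f nccw \<Rightarrow> nat \<Rightarrow> 'f tower \<Rightarrow> 'f tower" where
  "to_level X k = (if k \<le> nc_dim X then nc_proj X k else add_zero_cells X (k - nc_dim X))"

lemma skeleton_pad: "k \<le> nc_dim X \<Longrightarrow> skeleton (pad X) k = skeleton X k"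
  by (induction k) (simp_all add: skeleton.simps pad_def)

locale padded_nccw =
  fixes X :: "'f nccw"
  assumes nccw: "nccw_complex X"
begin

abbreviation "P \<equiv> pad X"

lemma fd_fibre: "fd_cstar_algebra (fibre P k)"
proof -
  have "fd_cstar_algebra (fibre X j)" if "j \<le> nc_dim X" for j
    using nccw that by (auto simp: nccw_complex_def)
  then show ?thesis
    using fd_zero_alg[of "fibre X 0"] by (auto simp: pad_def fd_cstar_algebra_def)
qed

lemma cstar_fibre: "cstar_algebra (fibre P k)"
  using fd_fibre by (simp add: fd_cstar_algebra_def)

lemma attach_hom: "cstar_hom (skeleton P k) (C_alg (sphere_top (Suc k)) (fibre P (Suc k))) (attach P (Suc k))"
proof (cases "Suc k \<le> nc_dim X")
  case True
  then have "cstar_hom (skeleton X k) (C_alg (sphere_top (Suc k)) (fibre X (Suc k))) (attach X (Suc k))"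
  proof -
    have "\<forall>k\<in>{1..nc_dim X}. cstar_hom (skeleton X (k - 1)) (C_alg (sphere_top k) (fibre X k)) (attach X k)"
      using nccw unfolding nccw_complex_def by blast
    then show ?thesis using True bspec[of _ _ "Suc k"] by force
  qed
  then show ?thesis using True skeleton_pad[of k X] by (simp add: pad_def)
next
  case False
  have "cstar_hom (skeleton P k) (C_alg (sphere_top (Suc k)) (fibre P (Suc k)))
      (\<lambda>_. czero (C_alg (sphere_top (Suc k)) (fibre P (Suc k))))"
    by (intro cstar_hom_zero_map cstar_algebra_C_algI cstar_fibre compact_space_sphere_top)
  then show ?thesis using False by (simp add: pad_def C_alg_simps)
qed

sublocale P: cell_tower P
  by (rule cell_tower.intro[OF cstar_fibre attach_hom])

abbreviation n where "n \<equiv> nc_dim X"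
abbreviation T where "T \<equiv> nc_alg X"

lemma T_eq: "skeleton P n = T"
  by (simp add: nc_alg_def skeleton_pad)

lemma tail_to_level: "tower_tail (to_level X (Suc k) a) = to_level X k a"
proof (cases "Suc k \<le> n")
  case True
  then have "n - k = Suc (n - Suc k)" by simp
  then show ?thesis using True by (simp add: to_level_def nc_proj_def)
next
  case False
  then have "Suc k - n = Suc (k - n)" "k = n \<or> n < k" by auto
  then show ?thesis using False by (auto simp: to_level_def nc_proj_def)
qed

lemma to_level_self: "to_level X n a = a"
  by (simp add: to_level_def nc_proj_def)

lemma to_level_above: "n \<le> k \<Longrightarrow> to_level X (Suc k) a =
    Glue (\<lambda>s\<in>topspace (cube (Suc k)). czero (fibre X 0)) (to_level X k a)"
  using to_level_self[of a] by (cases "k = n") (auto simp: to_level_def Suc_diff_le)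

lemma zero_cell: "n < k \<Longrightarrow> czero (cell_alg P k) = (\<lambda>s\<in>topspace (cube k). czero (fibre X 0))"
  by (simp add: C_alg_simps pad_def)

lemma attach_above: "n < k \<Longrightarrow> attach P k a = (\<lambda>s\<in>cube_boundary k. czero (fibre X 0))"
  by (simp add: pad_def)

lemma hom_to_level_above: "n \<le> k \<Longrightarrow> cstar_hom T (skeleton P k) (to_level X k)"
proof (induction k rule: dec_induct)
  case base
  have "cstar_hom T T (\<lambda>a. a)" by (rule cstar_homI) simp_all
  moreover have "to_level X n = (\<lambda>a. a)" by (rule ext) (rule to_level_self)
  ultimately show ?case by (simp add: T_eq)
next
  case (step k)
  have "cstar_hom T (skeleton P (Suc k))
     (\<lambda>a. Glue (czero (cell_alg P (Suc k))) (to_level X k a))"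
  proof (rule P.hom_Glue[OF cstar_hom_zero_map[OF P.cstar_cell] step.IH])
    fix a assume "a \<in> ccarrier T"
    show "restrict (czero (cell_alg P (Suc k))) (cube_boundary (Suc k)) = attach P (Suc k) (to_level X k a)"
      using step cube_boundary_subset[of "Suc k"]
      by (auto simp: zero_cell attach_above restrict_def fun_eq_iff)
  qed
  moreover have "to_level X (Suc k) = (\<lambda>a. Glue (czero (cell_alg P (Suc k))) (to_level X k a))"
    using step by (simp add: to_level_above zero_cell fun_eq_iff)
  ultimately show ?case by simp
qed

lemma hom_surj_to_level_below: "k \<le> n \<Longrightarrow>
    cstar_hom T (skeleton P k) (to_level X k) \<and> to_level X k ` ccarrier T = skel P k"
proof (induction k rule: inc_induct)
  case base
  have "to_level X n = (\<lambda>a. a)" by (rule ext) (rule to_level_self)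
  then show ?case using hom_to_level_above[of n] by (simp add: T_eq)
next
  case (step k)
  have eq: "to_level X k = (\<lambda>a. tower_tail (to_level X (Suc k) a))"
    by (simp add: tail_to_level)
  have "cstar_hom T (skeleton P k) (to_level X k)"
    unfolding eq using step.IH by (intro cstar_hom_compose[OF _ hom_tail]) blast
  moreover have "to_level X k ` ccarrier T = tower_tail ` to_level X (Suc k) ` ccarrier T"
    unfolding eq by (simp add: image_image)
  ultimately show ?case using step.IH P.tail_surj[of k] by simp
qed

lemma surj_to_level_above: "n \<le> k \<Longrightarrow> to_level X k ` ccarrier T = skel P k"
proof (induction k rule: dec_induct)
  case base
  show ?case by (simp add: T_eq to_level_self)
next
  case (step k)
  show ?case
  proof
    show "to_level X (Suc k) ` ccarrier T \<subseteq> skel P (Suc k)"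
      using cstar_homD(1)[OF hom_to_level_above[of "Suc k"]] step by auto
    show "skel P (Suc k) \<subseteq> to_level X (Suc k) ` ccarrier T"
    proof
      fix x assume "x \<in> skel P (Suc k)"
      then obtain f b where x: "x = Glue f b" "f \<in> ccarrier (cell_alg P (Suc k))"
        "b \<in> skel P k" by (rule skeleton_SucE)
      then obtain a where a: "a \<in> ccarrier T" "b = to_level X k a" using step.IH by blast
      have ext: "f \<in> extensional (topspace (cube (Suc k)))" using x by (simp add: C_alg_simps)
      have "f = (\<lambda>s\<in>topspace (cube (Suc k)). czero (fibre X 0))"
      proof (rule extensionalityI[OF ext])
        fix s assume s: "s \<in> topspace (cube (Suc k))"
        have "f s \<in> ccarrier (fibre P (Suc k))"
          using x s by (auto simp: C_alg_simps cstar_algebra.continuous_map_in_carrier[OF cstar_fibre])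
        then show "f s = (\<lambda>s\<in>topspace (cube (Suc k)). czero (fibre X 0)) s"
          using s step by (simp add: pad_def)
      qed (rule restrict_extensional)
      then have "x = to_level X (Suc k) a" using x a step by (simp add: to_level_above)
      then show "x \<in> to_level X (Suc k) ` ccarrier T" using a by blast
    qed
  qed
qed

lemma hom_to_level: "cstar_hom T (skeleton P k) (to_level X k)"
  using hom_to_level_above hom_surj_to_level_below by (cases "k \<le> n") auto

lemma surj_to_level: "to_level X k ` ccarrier T = skel P k"
  using surj_to_level_above hom_surj_to_level_below by (cases "k \<le> n") auto

lemma to_level_eq_imp_eq: "n \<le> k \<Longrightarrow> to_level X k a = to_level X k b \<Longrightarrow> a = b"
proof (induction k rule: dec_induct)
  case base
  then show ?case by (simp add: to_level_self)
next
  case (step k)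
  have "to_level X k a = to_level X k b"
    using arg_cong[OF step.prems, of tower_tail] by (simp add: tail_to_level)
  then show ?case by (rule step.IH)
qed

lemma bij_to_level: "n \<le> k \<Longrightarrow> bij_betw (to_level X k) (ccarrier T) (skel P k)"
  using to_level_eq_imp_eq surj_to_level by (auto simp: bij_betw_def inj_on_def)

lemma cstar_T: "cstar_algebra T"
  using P.cstar_skeleton[of n] by (simp add: T_eq)

text \<open>
  The kernel of \<open>to_level X k\<close> describes the ideals on both sides of the dimension, since the map is
  injective above it.
\<close>

lemma canonical_ideal_Suc:
  "canonical_ideal X (Suc k) = {a \<in> ccarrier T. to_level X k a = czero (skeleton P k)}"
proof (cases "Suc k \<le> n")
  case True
  then show ?thesis by (simp add: canonical_ideal_def to_level_def skeleton_pad)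
next
  case False
  then have nk: "n \<le> k" by simp
  have z: "to_level X k (czero T) = czero (skeleton P k)"
    by (rule cstar_hom_zero[OF cstar_T P.cstar_skeleton hom_to_level])
  have "to_level X k a = czero (skeleton P k) \<longleftrightarrow> a = czero T" for a
    using to_level_eq_imp_eq[OF nk, of a "czero T"] z by metis
  then have "{a \<in> ccarrier T. to_level X k a = czero (skeleton P k)} = {czero T}"
    using cstar_algebra.zero_closed[OF cstar_T] by auto
  then show ?thesis
    using False by (simp add: canonical_ideal_def)
qed

text \<open>
  Otherwise every top cell would vanish, and with it the last canonical ideal.
\<close>

lemma ex_nonzero_top_fibre: "\<exists>z\<in>ccarrier (fibre P n). z \<noteq> czero (fibre P n)"
proof (rule ccontr)
  assume "\<not> ?thesis"
  then have triv: "z = czero (fibre P n)" if "z \<in> ccarrier (fibre P n)" for z using that by blast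
  interpret T: cstar_algebra T by (rule cstar_T)
  have zero: "a = czero T" if a: "a \<in> canonical_ideal X n" for a
  proof (cases n)
    case 0
    then have "a \<in> ccarrier T" using a by (simp add: canonical_ideal_def)
    moreover have "czero T \<in> ccarrier T" by simp
    moreover have "ccarrier T = Base ` ccarrier (fibre P 0)"
      using 0 T_eq skeleton_0_carrier[of P] by simp
    ultimately obtain u v where "a = Base u" "u \<in> ccarrier (fibre P 0)"
      "czero T = Base v" "v \<in> ccarrier (fibre P 0)" by blast
    then show ?thesis using triv[of u] triv[of v] 0 by simp
  next
    case (Suc j)
    have aT: "a \<in> skel P (Suc j)" and a0: "to_level X j a = czero (skeleton P j)"
      using a canonical_ideal_Suc[of j] Suc T_eq by auto
    have z: "czero T \<in> skel P (Suc j)" using T_eq Suc T.zero_closed by simp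
    show ?thesis
    proof (rule tower_eqI_Suc[OF aT z])
      fix s assume s: "s \<in> topspace (cube (Suc j))"
      have "tower_head x s = czero (fibre P (Suc j))" if "x \<in> skel P (Suc j)" for x
        using cstar_homD(1)[OF hom_head_at[OF cstar_fibre s] that] triv Suc by simp
      then show "tower_head a s = tower_head (czero T) s" using aT z by simp
    next
      have "to_level X j x = tower_tail x" for x
        using tail_to_level[of j x] to_level_self[of x] Suc by simp
      moreover have "to_level X j (czero T) = czero (skeleton P j)"
        by (rule cstar_hom_zero[OF cstar_T P.cstar_skeleton hom_to_level])
      ultimately show "tower_tail a = tower_tail (czero T)"
        using a0 by simp
    qed
  qed
  moreover have "czero T \<in> canonical_ideal X n"
  proof (cases n)
    case 0
    then show ?thesis by (simp add: canonical_ideal_def)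
  next
    case (Suc j)
    then show ?thesis
      using canonical_ideal_Suc[of j] cstar_hom_zero[OF cstar_T P.cstar_skeleton hom_to_level] by simp
  qed
  ultimately have "canonical_ideal X n = {czero T}" by blast
  then show False using nccw by (simp add: nccw_complex_def)
qed

end

text \<open>
  A scalar bump function that vanishes on the boundary, times a nonzero element of the fibre, can
  be glued to zero.
\<close>

lemma (in cell_tower) ex_nonzero_cell:
  assumes z: "z \<in> ccarrier (fibre X (Suc k))" "z \<noteq> czero (fibre X (Suc k))"
  shows "\<exists>w\<in>skel X (Suc k). tower_tail w = czero (skeleton X k) \<and> w \<noteq> czero (skeleton X (Suc k))"
proof -
  interpret F: cstar_algebra "fibre X (Suc k)" by (rule fibre)
  define bump where "bump s = (\<Prod>i<Suc k. s i * (1 - s i))" for s :: "nat \<Rightarrow> real"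
  define h where "h = (\<lambda>s\<in>topspace (cube (Suc k)). cscale (fibre X (Suc k)) (complex_of_real (bump s)) z)"
  have "continuous_map (cube (Suc k)) euclideanreal bump"
    unfolding bump_def by (intro continuous_intros continuous_map_cube_coordinate) auto
  moreover have "continuous_map euclideanreal euclidean complex_of_real"
    by (auto intro!: continuous_intros)
  ultimately have "continuous_map (cube (Suc k)) euclidean (complex_of_real \<circ> bump)"
    by (rule continuous_map_compose)
  then have "continuous_map (cube (Suc k)) euclidean (\<lambda>s. complex_of_real (bump s))"
    by (simp add: o_def)
  then have "h \<in> ccarrier (cell_alg X (Suc k))"
    unfolding h_def using z by (auto simp: C_alg_simps intro!: F.continuous_map_cscale)
  moreover have "restrict h (cube_boundary (Suc k)) = attach X (Suc k) (czero (skeleton X k))"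
  proof -
    have "bump s = 0" if s: "s \<in> cube_boundary (Suc k)" for s
    proof -
      obtain i where "i < Suc k" "s i = 0 \<or> s i = 1" using s by (auto simp: mem_cube_boundary)
      then have "\<exists>i\<in>{..<Suc k}. s i * (1 - s i) = 0" by auto
      then show ?thesis unfolding bump_def by (intro prod_zero) auto
    qed
    then have "restrict h (cube_boundary (Suc k)) = (\<lambda>s\<in>cube_boundary (Suc k). czero (fibre X (Suc k)))"
      using z cube_boundary_subset by (auto simp: h_def restrict_def fun_eq_iff F.scale_zero_left)
    then show ?thesis
      using cstar_hom_zero[OF cstar_skeleton cstar_sphere attach, of k] by (simp add: C_alg_simps)
  qed
  ultimately have w: "Glue h (czero (skeleton X k)) \<in> skel X (Suc k)"
    using cstar_algebra.zero_closed[OF cstar_skeleton] by (simp add: Glue_mem)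
  moreover have "Glue h (czero (skeleton X k)) \<noteq> czero (skeleton X (Suc k))"
  proof
    assume eq: "Glue h (czero (skeleton X k)) = czero (skeleton X (Suc k))"
    define c :: "nat \<Rightarrow> real" where "c = (\<lambda>i\<in>{..<Suc k}. 1/2)"
    have c: "c \<in> topspace (cube (Suc k))" by (auto simp: c_def topspace_cube)
    have "tower_head (czero (skeleton X (Suc k))) c = czero (fibre X (Suc k))"
      by (rule cstar_hom_zero[OF cstar_skeleton fibre hom_head_at[OF fibre c]])
    then have "cscale (fibre X (Suc k)) (complex_of_real (bump c)) z = czero (fibre X (Suc k))"
      using c by (simp add: eq[symmetric] h_def)
    moreover have "bump c \<noteq> 0" by (simp add: bump_def c_def)
    ultimately show False
      using z F.norm_scale[of z "complex_of_real (bump c)"] F.norm_eq_zero[of z] by simp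
  qed
  ultimately show ?thesis by (intro bexI[of _ "Glue h (czero (skeleton X k))"]) auto
qed

section \<open>The mapping cylinder of a simplicial morphism\<close>

locale filtered_morphism = X: padded_nccw X + Y: padded_nccw Y
  for X :: "'f nccw" and Y :: "'g nccw" +
  fixes \<alpha> :: "'f tower \<Rightarrow> 'g tower"
  assumes hom_\<alpha>: "cstar_hom (nc_alg X) (nc_alg Y) \<alpha>"
    and ideal_\<alpha>: "\<And>k. \<alpha> ` canonical_ideal X k \<subseteq> canonical_ideal Y k"
begin

text \<open>
  The map \<open>\<alpha>\<^sub>k\<close>.  The choice of a preimage under the surjection \<open>to_level X k\<close> does not matter by
  \<open>to_level_\<alpha>_cong\<close>.
\<close>

definition induced :: "nat \<Rightarrow> 'f tower \<Rightarrow> 'g tower" where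
  "induced k x = to_level Y k (\<alpha> (inv_into (ccarrier (nc_alg X)) (to_level X k) x))"

text \<open>
  The difference \<open>a - b\<close> lies in the kernel \<open>I\<^sub>k\<^sub>+\<^sub>1\<close>, so its image lies in \<open>J\<^sub>k\<^sub>+\<^sub>1\<close>.
\<close>

lemma to_level_\<alpha>_cong:
  assumes a: "a \<in> ccarrier (nc_alg X)" "b \<in> ccarrier (nc_alg X)" and eq: "to_level X k a = to_level X k b"
  shows "to_level Y k (\<alpha> a) = to_level Y k (\<alpha> b)"
proof -
  interpret XT: cstar_algebra "nc_alg X" by (rule X.cstar_T)
  interpret XS: cstar_algebra "skeleton X.P k" by (rule X.P.cstar_skeleton)
  interpret YS: cstar_algebra "skeleton Y.P k" by (rule Y.P.cstar_skeleton)
  note \<alpha>m = cstar_homD(1)[OF hom_\<alpha>]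
  have "to_level X k (cdiff (nc_alg X) a b) = czero (skeleton X.P k)"
    using cstar_hom_diff[OF X.cstar_T X.hom_to_level a] eq cstar_homD(1)[OF X.hom_to_level a(2)]
    by (simp add: XS.diff_self)
  then have "cdiff (nc_alg X) a b \<in> canonical_ideal X (Suc k)"
    using a by (simp add: X.canonical_ideal_Suc)
  then have "\<alpha> (cdiff (nc_alg X) a b) \<in> canonical_ideal Y (Suc k)" using ideal_\<alpha> by blast
  then have "to_level Y k (cdiff (nc_alg Y) (\<alpha> a) (\<alpha> b)) = czero (skeleton Y.P k)"
    using cstar_hom_diff[OF X.cstar_T hom_\<alpha> a] by (simp add: Y.canonical_ideal_Suc)
  then have "cdiff (skeleton Y.P k) (to_level Y k (\<alpha> a)) (to_level Y k (\<alpha> b)) = czero (skeleton Y.P k)"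
    using cstar_hom_diff[OF Y.cstar_T Y.hom_to_level \<alpha>m[OF a(1)] \<alpha>m[OF a(2)]] by simp
  then show ?thesis
    using YS.diff_eq_zero_iff cstar_homD(1)[OF Y.hom_to_level] \<alpha>m a by blast
qed

lemma induced_to_level:
  assumes a: "a \<in> ccarrier (nc_alg X)"
  shows "induced k (to_level X k a) = to_level Y k (\<alpha> a)"
proof -
  have x: "to_level X k a \<in> to_level X k ` ccarrier (nc_alg X)" using a by blast
  show ?thesis unfolding induced_def
    by (rule to_level_\<alpha>_cong[OF inv_into_into[OF x] a f_inv_into_f[OF x]])
qed

lemma to_levelE:
  assumes "x \<in> skel X.P k"
  obtains a where "a \<in> ccarrier (nc_alg X)" "x = to_level X k a"
  using assms X.surj_to_level[of k] by blast

lemma hom_induced: "cstar_hom (skeleton X.P k) (skeleton Y.P k) (induced k)"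
proof -
  interpret XT: cstar_algebra "nc_alg X" by (rule X.cstar_T)
  note L = cstar_homD[OF X.hom_to_level[of k]]
    and M = cstar_homD[OF cstar_hom_compose[OF hom_\<alpha> Y.hom_to_level[of k]]]
  show ?thesis
  proof (rule cstar_homI)
    fix x y assume "x \<in> skel X.P k" "y \<in> skel X.P k"
    then obtain a b where a: "a \<in> ccarrier (nc_alg X)" "x = to_level X k a"
      and b: "b \<in> ccarrier (nc_alg X)" "y = to_level X k b" by (metis to_levelE)
    show "induced k (cadd (skeleton X.P k) x y) = cadd (skeleton Y.P k) (induced k x) (induced k y)"
      using a b by (simp add: L(2)[symmetric] induced_to_level M)
    show "induced k (cmult (skeleton X.P k) x y) = cmult (skeleton Y.P k) (induced k x) (induced k y)"
      using a b by (simp add: L(4)[symmetric] induced_to_level M)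
  next
    fix x c assume "x \<in> skel X.P k"
    then obtain a where a: "a \<in> ccarrier (nc_alg X)" "x = to_level X k a" by (rule to_levelE)
    show "induced k x \<in> skel Y.P k"
      using a by (simp add: induced_to_level M)
    show "induced k (cscale (skeleton X.P k) c x) = cscale (skeleton Y.P k) c (induced k x)"
      using a by (simp add: L(3)[symmetric] induced_to_level M)
    show "induced k (cstar (skeleton X.P k) x) = cstar (skeleton Y.P k) (induced k x)"
      using a by (simp add: L(5)[symmetric] induced_to_level M)
  qed
qed

lemma tail_induced:
  assumes "x \<in> skel X.P (Suc k)"
  shows "tower_tail (induced (Suc k) x) = induced k (tower_tail x)"
proof -
  obtain a where a: "a \<in> ccarrier (nc_alg X)" "x = to_level X (Suc k) a"
    using assms by (rule to_levelE)
  then show ?thesis by (simp add: induced_to_level X.tail_to_level Y.tail_to_level)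
qed

sublocale skeletal_map "pad X" "pad Y" induced
  by unfold_locales (rule hom_induced, rule tail_induced)

text \<open>
  Under the dimension bounds the maps to level \<open>k + 1\<close> for \<open>X\<close>, and to levels \<open>k\<close> and \<open>k + 1\<close> for
  \<open>Y\<close>, are isomorphisms.  So a path \<open>g\<close> comes from a unique path \<open>f\<close> in the algebra of \<open>Y\<close>, and the
  component \<open>y\<close>, whose image at level \<open>k\<close> is \<open>g 0\<close>, must come from \<open>f 0\<close>.
\<close>

lemma Cyl_isomorphic_double_cyl:
  assumes k: "nc_dim X \<le> Suc k" "nc_dim Y \<le> k"
  shows "cstar_isomorphic (Cyl (nc_alg X) (nc_alg Y) \<alpha>) (double_cyl k)"
proof -
  let ?C = "Cyl (nc_alg X) (nc_alg Y) \<alpha>"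
  define \<Theta> where "\<Theta> p = (to_level X (Suc k) (fst p), to_level Y (Suc k) (snd p 0),
    \<lambda>t\<in>topspace unit_interval. to_level Y k (snd p t))" for p
  have Cyl_mem: "(a, f) \<in> ccarrier ?C \<longleftrightarrow> a \<in> ccarrier (nc_alg X) \<and> f \<in> extensional {0..1} \<and>
      continuous_map unit_interval (ctopology (nc_alg Y)) f \<and> \<alpha> a = f 1" for a f
    by (auto simp: Cyl_def pullback_simps C_alg_simps)
  have eval: "cstar_hom ?C (nc_alg Y) (\<lambda>p. snd p t)" if "t \<in> {0..1}" for t
    unfolding Cyl_def using that
    by (intro cstar_hom_compose[OF cstar_hom_pullback_snd cstar_hom_eval] Y.cstar_T) auto
  have hom: "cstar_hom ?C (double_cyl k) \<Theta>"
    unfolding double_cyl_def \<Theta>_def[abs_def]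
  proof (intro cstar_hom_into_pullback cstar_hom_into_C_alg)
    show "cstar_hom ?C (skeleton X.P (Suc k)) (\<lambda>p. to_level X (Suc k) (fst p))"
      unfolding Cyl_def by (rule cstar_hom_compose[OF cstar_hom_pullback_fst X.hom_to_level])
    show "cstar_hom ?C (skeleton Y.P (Suc k)) (\<lambda>p. to_level Y (Suc k) (snd p 0))"
      by (rule cstar_hom_compose[OF eval Y.hom_to_level]) simp
    show "cstar_hom ?C (skeleton Y.P k) (\<lambda>p. to_level Y k (snd p t))" if "t \<in> topspace unit_interval" for t
      using that by (intro cstar_hom_compose[OF eval Y.hom_to_level]) simp
    fix p assume p: "p \<in> ccarrier ?C"
    obtain a f where af: "p = (a, f)" by (cases p)
    have a: "a \<in> ccarrier (nc_alg X)" and f: "continuous_map unit_interval (ctopology (nc_alg Y)) f"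
      and f1: "\<alpha> a = f 1" using p unfolding af Cyl_mem by blast+
    show "(\<lambda>t\<in>topspace unit_interval. to_level Y k (snd p t)) \<in> ccarrier (C_alg unit_interval (skeleton Y.P k))"
      using cstar_hom_continuous_map[OF Y.cstar_T Y.P.cstar_skeleton Y.hom_to_level f]
      by (simp add: C_alg_simps af)
    show "tower_tail (to_level Y (Suc k) (snd p 0)) = (\<lambda>t\<in>topspace unit_interval. to_level Y k (snd p t)) 0"
      by (simp add: Y.tail_to_level)
    show "induced k (tower_tail (to_level X (Suc k) (fst p))) = snd (to_level Y (Suc k) (snd p 0),
        \<lambda>t\<in>topspace unit_interval. to_level Y k (snd p t)) 1"
      using induced_to_level[OF a] by (simp add: X.tail_to_level af f1)
  qed
  have "bij_betw \<Theta> (ccarrier ?C) (ccarrier (double_cyl k))"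
    unfolding bij_betw_def
  proof (intro conjI inj_onI)
    fix p q assume p: "p \<in> ccarrier ?C" and q: "q \<in> ccarrier ?C" and eq: "\<Theta> p = \<Theta> q"
    obtain a f where af: "p = (a, f)" by (cases p)
    obtain b g where bg: "q = (b, g)" by (cases q)
    have "to_level X (Suc k) a = to_level X (Suc k) b" using eq by (simp add: \<Theta>_def af bg)
    then have "a = b" by (rule X.to_level_eq_imp_eq[OF k(1)])
    moreover have "f = g"
    proof (rule extensionalityI[of _ "{0..1}"])
      show "f \<in> extensional {0..1}" "g \<in> extensional {0..1}"
        using p q by (simp_all add: af bg Cyl_mem)
      fix t :: real assume t: "t \<in> {0..1}"
      have "(\<lambda>t\<in>{0..1}. to_level Y k (f t)) = (\<lambda>t\<in>{0..1}. to_level Y k (g t))"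
        using eq by (simp add: \<Theta>_def af bg)
      from fun_cong[OF this, of t] have "to_level Y k (f t) = to_level Y k (g t)" using t by simp
      then show "f t = g t" by (rule Y.to_level_eq_imp_eq[OF k(2)])
    qed
    ultimately show "p = q" by (simp add: af bg)
  next
    show "\<Theta> ` ccarrier ?C = ccarrier (double_cyl k)"
    proof
      show "\<Theta> ` ccarrier ?C \<subseteq> ccarrier (double_cyl k)" using cstar_homD(1)[OF hom] by blast
      show "ccarrier (double_cyl k) \<subseteq> \<Theta> ` ccarrier ?C"
      proof
        fix p assume p: "p \<in> ccarrier (double_cyl k)"
        obtain x y g where xyg: "p = (x, y, g)" by (cases p)
        have x: "x \<in> skel X.P (Suc k)" and y: "y \<in> skel Y.P (Suc k)"
          and gc: "continuous_map unit_interval (ctopology (skeleton Y.P k)) g"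
          and ge: "g \<in> extensional {0..1}"
          and g0: "tower_tail y = g 0" and g1: "g 1 = induced k (tower_tail x)"
          using p by (auto simp: xyg double_cyl_mem C_alg_simps)
        obtain a where a: "a \<in> ccarrier (nc_alg X)" "x = to_level X (Suc k) a" using x by (rule to_levelE)
        obtain b where b: "b \<in> ccarrier (nc_alg Y)" "y = to_level Y (Suc k) b"
          using y Y.surj_to_level[of "Suc k"] by blast
        define inv where "inv = inv_into (ccarrier (nc_alg Y)) (to_level Y k)"
        have inv_hom: "cstar_hom (skeleton Y.P k) (nc_alg Y) inv"
          unfolding inv_def by (rule cstar_hom_inv[OF Y.cstar_T Y.hom_to_level Y.bij_to_level[OF k(2)]])
        have inv1: "inv (to_level Y k c) = c" if "c \<in> ccarrier (nc_alg Y)" for c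
          unfolding inv_def using Y.bij_to_level[OF k(2)] that by (simp add: bij_betw_def inv_into_f_f)
        have inv2: "to_level Y k (inv z) = z" if "z \<in> skel Y.P k" for z
          unfolding inv_def using that Y.surj_to_level[of k] by (simp add: f_inv_into_f)
        define f where "f = (\<lambda>t\<in>{0..1}. inv (g t))"
        have "continuous_map unit_interval (ctopology (nc_alg Y)) (\<lambda>t. inv (g t))"
          by (rule cstar_hom_continuous_map[OF Y.P.cstar_skeleton Y.cstar_T inv_hom gc])
        then have fc: "continuous_map unit_interval (ctopology (nc_alg Y)) f"
          by (rule continuous_map_eq) (simp add: f_def)
        have "f 1 = \<alpha> a"
          using induced_to_level[OF a(1), of k] inv1 cstar_homD(1)[OF hom_\<alpha> a(1)] a
          by (simp add: f_def g1 X.tail_to_level)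
        then have C: "(a, f) \<in> ccarrier ?C" using a fc by (simp add: Cyl_mem f_def)
        have "f 0 = b"
          using inv1[OF b(1)] b by (simp add: f_def g0[symmetric] Y.tail_to_level)
        moreover have "(\<lambda>t\<in>{0..1}. to_level Y k (f t)) = g"
        proof (rule extensionalityI[OF restrict_extensional ge])
          fix t :: real assume t: "t \<in> {0..1}"
          have "g t \<in> skel Y.P k"
            using cstar_algebra.continuous_map_in_carrier[OF Y.P.cstar_skeleton gc] t by simp
          then show "(\<lambda>t\<in>{0..1}. to_level Y k (f t)) t = g t" using t by (simp add: f_def inv2)
        qed
        ultimately have "\<Theta> (a, f) = p" by (simp add: \<Theta>_def xyg a b)
        then show "p \<in> \<Theta> ` ccarrier ?C" using C by blast
      qed
    qed
  qed
  with hom show ?thesis unfolding cstar_isomorphic_def by blast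
qed

text \<open>
  One of the nonzero algebras \<open>F\<^sub>n\<close> and \<open>G\<^sub>m\<close> is a summand of the top fibre, the latter as the
  fibre of the side cells.
\<close>

lemma ex_nonzero_fibre_Z:
  assumes k: "Suc k = max (nc_dim X) (Suc (nc_dim Y))"
  shows "\<exists>z\<in>ccarrier (fibre (Z N) (Suc k)). z \<noteq> czero (fibre (Z N) (Suc k))"
proof -
  note z = cstar_algebra.zero_closed[OF X.cstar_fibre] cstar_algebra.zero_closed[OF Y.cstar_fibre]
  consider "Suc k = nc_dim X" | "k = nc_dim Y" using k by (auto simp: max_def split: if_splits)
  then show ?thesis
  proof cases
    case 1
    then obtain x where "x \<in> ccarrier (fibre X.P (Suc k))" "x \<noteq> czero (fibre X.P (Suc k))"
      using X.ex_nonzero_top_fibre by metis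
    then show ?thesis using z
      by (intro bexI[of _ "(x, czero (fibre Y.P (Suc k)), czero (fibre Y.P k))"])
         (auto simp: fibre_Z direct_sum_simps)
  next
    case 2
    then obtain y where "y \<in> ccarrier (fibre Y.P k)" "y \<noteq> czero (fibre Y.P k)"
      using Y.ex_nonzero_top_fibre by metis
    then show ?thesis using z
      by (intro bexI[of _ "(czero (fibre X.P (Suc k)), czero (fibre Y.P (Suc k)), y)"])
         (auto simp: fibre_Z direct_sum_simps)
  qed
qed

lemma nccw_complex_Z:
  assumes k: "Suc k = max (nc_dim X) (Suc (nc_dim Y))"
  shows "nccw_complex (Z (Suc k))"
proof -
  let ?Z = "Z (Suc k)"
  interpret Z: cell_tower ?Z by (rule cell_tower_Z)
  have dim: "nc_dim ?Z = Suc k" by (simp add: cyl_nccw_def)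
  have "fd_cstar_algebra (side_fibre Y.P j)" for j
    using fd_zero_alg[OF Y.cstar_fibre] Y.fd_fibre by (cases j) auto
  then have fd: "fd_cstar_algebra (fibre ?Z j)" for j
    unfolding fibre_Z by (intro fd_direct_sum X.fd_fibre Y.fd_fibre)
  have at: "cstar_hom (skeleton ?Z (j - 1)) (C_alg (sphere_top j) (fibre ?Z j)) (attach ?Z j)" if "1 \<le> j" for j
    using Z.attach[of "j - 1"] that by simp
  obtain z where "z \<in> ccarrier (fibre ?Z (Suc k))" "z \<noteq> czero (fibre ?Z (Suc k))"
    using ex_nonzero_fibre_Z[OF k] by blast
  from Z.ex_nonzero_cell[OF this] obtain w where "w \<in> ccarrier (skeleton ?Z (Suc k))"
    "tower_tail w = czero (skeleton ?Z k)" "w \<noteq> czero (skeleton ?Z (Suc k))" by blast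
  then have "w \<in> canonical_ideal ?Z (nc_dim ?Z)" "w \<noteq> czero (nc_alg ?Z)"
    by (simp_all add: canonical_ideal_def nc_alg_def nc_proj_def dim)
  then show ?thesis using fd at by (auto simp: nccw_complex_def)
qed

end

theorem proposition4p9:
  fixes A :: "'f nccw" and B :: "'g nccw" and n m :: nat
    and \<alpha> :: "'f tower \<Rightarrow> 'g tower"
  assumes "nccw_complex A" and "nc_dim A = n"
    and "nccw_complex B" and "nc_dim B = m"
    and "simplicial A B \<alpha>"
  shows "\<exists>C :: ('f \<times> 'g \<times> 'g) nccw.
           nccw_complex C \<and> nc_dim C = max n (m + 1) \<and>
           cstar_isomorphic (Cyl (nc_alg A) (nc_alg B) \<alpha>) (nc_alg C)"
proof -
  interpret filtered_morphism A B \<alpha>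
    using assms by unfold_locales (auto simp: simplicial_def)
  define k where "k = max n (m + 1) - 1"
  have k: "Suc k = max (nc_dim A) (Suc (nc_dim B))" "nc_dim A \<le> Suc k" "nc_dim B \<le> k"
    using assms by (auto simp: k_def)
  have alg: "nc_alg (Z (Suc k)) = skeleton (Z (Suc k)) (Suc k)"
    by (simp add: nc_alg_def cyl_nccw_def)
  have "cstar_isomorphic (double_cyl k) (skeleton (Z (Suc k)) (Suc k))"
    by (rule cstar_isomorphic_sym[OF cell_tower.cstar_skeleton[OF cell_tower_Z] skeleton_Z_isomorphic])
  then have "cstar_isomorphic (Cyl (nc_alg A) (nc_alg B) \<alpha>) (nc_alg (Z (Suc k)))"
    unfolding alg by (rule cstar_isomorphic_trans[OF Cyl_isomorphic_double_cyl[OF k(2,3)]])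
  moreover have "nc_dim (Z (Suc k)) = max n (m + 1)"
    using k assms by (simp add: cyl_nccw_def)
  ultimately show ?thesis using nccw_complex_Z[OF k(1)] by blast
qed

end
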